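(* Let $\delta,\ell\in\mathbb{N}$. There exists $D_{\delta,n}\in\mathbb{N}$ such that if $d\ge D_{\delta,n}$ and $I\subseteq R$ is an ideal equigenerated in degree $d$ with $\dim_K I_d=\delta$, and $I_d$ contains a regular sequence of length $\ell$, then $\operatorname{ubl}_I(d)\ge \ell-1$.
   Context: $\mathbb{N}=\{0,1,2,\dots\}$. $K$ is a field of characteristic $0$, $n\ge 3$, $R=K[x_1,\dots,x_n]$ is standard graded, and all ideals are homogeneous. $I_d$ is the degree-$d$ component of $I$; $I$ is equigenerated in degree $d$ if all its minimal generators have degree $d$. Regular sequences consist of homogeneous polynomials. Reverse lexicographic (revlex) order: for monomials of the same degree, $x_1^{p_1}\cdots x_n^{p_n}>x_1^{q_1}\cdots x_n^{q_n}$ if the last nonzero entry of $(p_1-q_1,\dots,p_n-q_n)$ is negative. $\operatorname{in}(I)$ is the initial ideal with respect to revlex. $\operatorname{gin}(I)$ is the generic initial ideal with respect to revlex, i.e. the common value of $\operatorname{in}(\sigma(I))$ for $\sigma$ in a nonempty Zariski open set of linear changes of coordinates. A monomial $x_1^{d-k}x_2^k\in\operatorname{gin}(I)_d$ with $k\ge 1$ is uncovered with respect to $I$ if $x_1^{d-k}x_2^{k-1}x_3\notin\operatorname{gin}(I)_d$. The uncovered bottom length $\operatorname{ubl}_I(d)$ is the number of uncovered monomials of the form $x_1^{d-k}x_2^k\in\operatorname{gin}(I)_d$ with $k\in\{1,\dots,d\}$. *)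

theory Defs
  imports
    "HOL-Library.Poly_Mapping"
    "HOL-Algebra.Ideal"
    "Jordan_Normal_Form.Matrix"
begin

type_synonym ('i, 'k) mpoly = "('i \<Rightarrow>\<^sub>0 nat) \<Rightarrow>\<^sub>0 'k"

definition polys :: "'i set \<Rightarrow> ('i, 'k::zero) mpoly set" where
  "polys V = {p. \<forall>m \<in> Poly_Mapping.keys p. Poly_Mapping.keys m \<subseteq> V}"

definition poly_ring :: "'i set \<Rightarrow> ('i, 'k::comm_ring_1) mpoly ring" where
  "poly_ring V = \<lparr>carrier = polys V, monoid.mult = (*), one = 1, zero = 0, add = (+)\<rparr>"

(* K[x_1,...,x_n]: the index i < n stands for the variable x_(i+1). *)
abbreviation R :: "nat \<Rightarrow> (nat, 'k::comm_ring_1) mpoly ring" where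
  "R n \<equiv> poly_ring {..<n}"

lemma cring_poly_ring: "cring (poly_ring V :: ('i, 'k::comm_ring_1) mpoly ring)"
proof (rule cringI)
  have add: "p + q \<in> polys V" if "p \<in> polys V" "q \<in> polys V" for p q :: "('i, 'k) mpoly"
    using that Poly_Mapping.keys_add[of p q] by (fastforce simp: polys_def)
  have mult: "p * q \<in> polys V" if pq: "p \<in> polys V" "q \<in> polys V" for p q :: "('i, 'k) mpoly"
  proof -
    have "Poly_Mapping.keys m \<subseteq> V" if m: "m \<in> Poly_Mapping.keys (p * q)" for m
    proof -
      obtain a b where "m = a + b" "a \<in> Poly_Mapping.keys p" "b \<in> Poly_Mapping.keys q"
        using m Poly_Mapping.keys_mult[of p q] by blast
      then show ?thesis
        using pq Poly_Mapping.keys_add[of a b] by (fastforce simp: polys_def)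
    qed
    then show ?thesis by (simp add: polys_def)
  qed
  show "abelian_group (poly_ring V :: ('i, 'k) mpoly ring)"
  proof (rule abelian_groupI)
    fix p :: "('i, 'k) mpoly"
    assume "p \<in> carrier (poly_ring V)"
    then show "\<exists>q \<in> carrier (poly_ring V). q \<oplus>\<^bsub>poly_ring V\<^esub> p = \<zero>\<^bsub>poly_ring V\<^esub>"
      by (intro bexI[of _ "- p"]) (auto simp: poly_ring_def polys_def)
  qed (auto simp: poly_ring_def add add.assoc add.commute, simp add: polys_def)
  show "comm_monoid (poly_ring V :: ('i, 'k) mpoly ring)"
    by (rule comm_monoidI)
      (auto simp: poly_ring_def mult mult.assoc mult.commute, simp add: polys_def)
qed (auto simp: poly_ring_def distrib_right)

interpretation mpoly: vector_space "\<lambda>(c::'k::field) (p::('i, 'k) mpoly). Poly_Mapping.map ((*) c) p"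
  by unfold_locales
    (auto simp: mult_map_scale_conv_mult distrib_left distrib_right single_add mult_single
      mult.assoc[symmetric])

definition mdeg :: "('i \<Rightarrow>\<^sub>0 nat) \<Rightarrow> nat" where
  "mdeg m = (\<Sum>i \<in> Poly_Mapping.keys m. Poly_Mapping.lookup m i)"

definition forms :: "nat \<Rightarrow> nat \<Rightarrow> (nat, 'k::comm_ring_1) mpoly set" where
  "forms n d = {p \<in> carrier (R n). \<forall>m \<in> Poly_Mapping.keys p. mdeg m = d}"

definition homogeneous_ideal :: "nat \<Rightarrow> (nat, 'k::comm_ring_1) mpoly set \<Rightarrow> bool" where
  "homogeneous_ideal n I \<longleftrightarrow> ideal I (R n) \<and>
     (\<exists>G \<subseteq> (\<Union>d. forms n d). I = genideal (R n) G)"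

definition graded_part :: "nat \<Rightarrow> (nat, 'k::comm_ring_1) mpoly set \<Rightarrow> nat \<Rightarrow> (nat, 'k) mpoly set" where
  "graded_part n I d = I \<inter> forms n d"

definition minimal_generators ::
  "nat \<Rightarrow> (nat, 'k::comm_ring_1) mpoly set \<Rightarrow> (nat, 'k) mpoly set \<Rightarrow> bool" where
  "minimal_generators n I G \<longleftrightarrow> G \<subseteq> (\<Union>d. forms n d) \<and> genideal (R n) G = I \<and>
     (\<forall>G'. G' \<subset> G \<longrightarrow> genideal (R n) G' \<noteq> I)"

(* The degrees of the elements of a minimal homogeneous generating set do not depend on its choice. *)
definition equigenerated :: "nat \<Rightarrow> nat \<Rightarrow> (nat, 'k::comm_ring_1) mpoly set \<Rightarrow> bool" where
  "equigenerated n d I \<longleftrightarrow> (\<exists>G. minimal_generators n I G \<and> (\<forall>g \<in> G. g \<in> forms n d))"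

definition regular_sequence :: "nat \<Rightarrow> (nat, 'k::comm_ring_1) mpoly list \<Rightarrow> bool" where
  "regular_sequence n fs \<longleftrightarrow> set fs \<subseteq> (\<Union>d. forms n d) \<and>
     genideal (R n) (set fs) \<noteq> carrier (R n) \<and>
     (\<forall>i < length fs. \<forall>g \<in> carrier (R n).
        fs ! i * g \<in> genideal (R n) (set (take i fs)) \<longrightarrow>
        g \<in> genideal (R n) (set (take i fs)))"

(* Only used to compare monomials of the same degree. *)
definition revlex_less :: "(nat \<Rightarrow>\<^sub>0 nat) \<Rightarrow> (nat \<Rightarrow>\<^sub>0 nat) \<Rightarrow> bool" where
  "revlex_less q p \<longleftrightarrow> (\<exists>i. Poly_Mapping.lookup p i < Poly_Mapping.lookup q i \<and>
     (\<forall>j > i. Poly_Mapping.lookup p j = Poly_Mapping.lookup q j))"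

(* Meaningful for nonzero homogeneous f. *)
definition leading_exponent :: "(nat, 'k::zero) mpoly \<Rightarrow> (nat \<Rightarrow>\<^sub>0 nat)" where
  "leading_exponent f = (THE m. m \<in> Poly_Mapping.keys f \<and>
     (\<forall>m' \<in> Poly_Mapping.keys f. m' \<noteq> m \<longrightarrow> revlex_less m' m))"

definition initial_ideal :: "nat \<Rightarrow> (nat, 'k::comm_ring_1) mpoly set \<Rightarrow> (nat, 'k) mpoly set" where
  "initial_ideal n I = genideal (R n)
     {Poly_Mapping.single (leading_exponent f) 1 | f. f \<in> I \<and> f \<noteq> 0 \<and> (\<exists>d. f \<in> forms n d)}"

definition insertion :: "('k::zero \<Rightarrow> 'r::comm_ring_1) \<Rightarrow> ('i \<Rightarrow> 'r) \<Rightarrow> ('i, 'k) mpoly \<Rightarrow> 'r" where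
  "insertion h a p = (\<Sum>m \<in> Poly_Mapping.keys p. h (Poly_Mapping.lookup p m) *
     (\<Prod>i \<in> Poly_Mapping.keys m. a i ^ Poly_Mapping.lookup m i))"

definition linear_change :: "nat \<Rightarrow> 'k::comm_ring_1 mat \<Rightarrow> (nat, 'k) mpoly \<Rightarrow> (nat, 'k) mpoly" where
  "linear_change n \<sigma> = insertion (Poly_Mapping.single 0)
     (\<lambda>j. \<Sum>i<n. Poly_Mapping.single (Poly_Mapping.single i 1) (\<sigma> $$ (i, j)))"

definition GL :: "nat \<Rightarrow> 'k::comm_ring_1 mat set" where
  "GL n = {\<sigma> \<in> carrier_mat n n. invertible_mat \<sigma>}"

(* The Zariski topology of GL n is the subspace topology of the affine space of n x n matrices;
   S consists of polynomials in the n^2 matrix entries. *)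
definition zariski_open_GL :: "nat \<Rightarrow> 'k::comm_ring_1 mat set \<Rightarrow> bool" where
  "zariski_open_GL n U \<longleftrightarrow> (\<exists>S \<subseteq> polys ({..<n} \<times> {..<n}).
     U = {\<sigma> \<in> GL n. \<exists>p \<in> S. insertion id (\<lambda>ij. \<sigma> $$ ij) p \<noteq> 0})"

definition gin :: "nat \<Rightarrow> (nat, 'k::comm_ring_1) mpoly set \<Rightarrow> (nat, 'k) mpoly set" where
  "gin n I = (THE J. \<exists>U. zariski_open_GL n U \<and> U \<noteq> {} \<and>
     (\<forall>\<sigma> \<in> U. initial_ideal n (linear_change n \<sigma> ` I) = J))"

definition x_monom :: "nat \<Rightarrow> nat \<Rightarrow> nat \<Rightarrow> (nat, 'k::comm_ring_1) mpoly" where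
  "x_monom a b c = Poly_Mapping.single
     (Poly_Mapping.single 0 a + Poly_Mapping.single 1 b + Poly_Mapping.single 2 c) 1"

definition uncovered :: "nat \<Rightarrow> (nat, 'k::comm_ring_1) mpoly set \<Rightarrow> nat \<Rightarrow> nat \<Rightarrow> bool" where
  "uncovered n I d k \<longleftrightarrow> k \<ge> 1 \<and> x_monom (d - k) k 0 \<in> graded_part n (gin n I) d \<and>
     x_monom (d - k) (k - 1) 1 \<notin> graded_part n (gin n I) d"

definition ubl :: "nat \<Rightarrow> (nat, 'k::comm_ring_1) mpoly set \<Rightarrow> nat \<Rightarrow> nat" where
  "ubl n I d = card {m :: (nat, 'k) mpoly. \<exists>k \<in> {1..d}. m = x_monom (d - k) k 0 \<and> uncovered n I d k}"

end

theory Submission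
  imports Defs "HOL-Computational_Algebra.Polynomial" "Jordan_Normal_Form.Determinant"
begin

text \<open>
  Write \<open>x\<^sub>1, x\<^sub>2, \<dots>\<close> for the variables \<open>Var 0\<close>, \<open>Var 1\<close>, \<open>\<dots>\<close>. The idea is to look at the ideal on a
  generic line. Move \<open>I\<close> into generic coordinates and let \<open>Z\<^sub>t\<close> be the space of binary forms obtained from
  its degree \<open>t\<close> part by setting \<open>x\<^sub>3 = \<dots> = x\<^sub>n = 0\<close>. For a space \<open>Z\<close> of binary forms put
  \<open>(Z : S\<^sub>q) = {w. w p \<in> Z for all binary forms p of degree q}\<close>.

  Lower bound for the uncovered monomials (\<open>ubl_ge\<close>). The monomials of the generic initial ideal in
  \<open>x\<^sub>1, x\<^sub>2\<close> of degree \<open>d\<close> are counted by \<open>dim Z\<^sub>d\<close>, and a monomial can only be covered by one that is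
  linear in \<open>x\<^sub>3\<close>; there are at most \<open>dim (Z\<^sub>d : S\<^sub>1)\<close> of those. Since
  \<open>x\<^sub>1 Z \<inter> x\<^sub>2 Z = x\<^sub>1 x\<^sub>2 (Z : S\<^sub>1)\<close>, every \<open>Z\<close> satisfies
  \<open>dim (x\<^sub>1 Z + x\<^sub>2 Z) + dim (Z : S\<^sub>1) = 2 dim Z\<close> (\<open>dim_pencil_colon\<close>), and
  \<open>Z\<^sub>t\<^sub>+\<^sub>1 = x\<^sub>1 Z\<^sub>t + x\<^sub>2 Z\<^sub>t\<close> for \<open>t \<ge> d\<close> because \<open>I\<close> is generated in degree \<open>d\<close>. Hence the uncovered bottom
  length is at least \<open>r\<^sub>0 - 1\<close>, where \<open>r\<^sub>k = dim Z\<^sub>d\<^sub>+\<^sub>k\<^sub>+\<^sub>1 - dim Z\<^sub>d\<^sub>+\<^sub>k\<close>, and it remains to show that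
  \<open>r\<^sub>0\<close> is at least the length of the regular sequence.

  Degeneration (\<open>slice_in_colon\<close>). If a form \<open>f\<close> in the moved ideal has an initial monomial whose
  part in \<open>x\<^sub>3, \<dots>, x\<^sub>n\<close> is \<open>x\<^sup>j\<close>, then the coefficient of \<open>x\<^sup>j\<close> in \<open>f\<close>, a binary form, lies in
  \<open>(Z\<^sub>t : S\<^sub>q)\<close> with \<open>q = deg x\<^sup>j\<close>. To see this, bend the line slightly, along powers of a parameter
  chosen so that \<open>x\<^sup>j\<close> becomes the dominant term of \<open>f\<close>; the rank of the restriction cannot jump near a
  generic line, so the limit of the rescaled restrictions of \<open>f\<close> stays in \<open>Z\<^sub>t\<close>. Consequently at most
  \<open>dim (Z\<^sub>t : S\<^sub>q)\<close> initial monomials of degree \<open>t\<close> involve \<open>x\<^sup>j\<close>.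

  Counting (\<open>regular_length_le\<close>). The sequence \<open>r\<^sub>k\<close> is nonincreasing and \<open>r\<^sub>0\<close> is at most \<open>\<delta>\<close>, so for
  large \<open>d\<close> it is constant, say equal to \<open>r\<close>, for \<open>k\<close> between some \<open>k\<^sub>0\<close> and a much larger \<open>k\<^sub>1 < d\<close>.
  There taking the colon runs back through the sequence \<open>Z\<^sub>t\<close>, so \<open>dim (Z\<^sub>d\<^sub>+\<^sub>k\<^sub>1 : S\<^sub>q)\<close> is at most
  \<open>r (k\<^sub>1 - q)\<close> plus a constant, and summing over all \<open>j\<close> bounds the dimension of the degree \<open>d + k\<^sub>1\<close> part
  of \<open>I\<close> by \<open>r C\<close> plus lower order terms, \<open>C\<close> being the number of monomials of degree \<open>k\<^sub>1\<close>. On the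
  other hand a regular sequence of length \<open>l\<close> in degree \<open>d\<close> has no syzygies of degree \<open>k\<^sub>1 < d\<close>, so this
  dimension is at least \<open>l C\<close>. Thus \<open>l \<le> r \<le> r\<^sub>0\<close>.

  All this presupposes that a generic initial ideal exists; this is \<open>generic_leads_all_degrees\<close>.
\<close>

section \<open>Exponent vectors and the reverse lexicographic order\<close>

abbreviation "lookup \<equiv> Poly_Mapping.lookup"
abbreviation "keys \<equiv> Poly_Mapping.keys"
abbreviation "single \<equiv> Poly_Mapping.single"

type_synonym exponent = "nat \<Rightarrow>\<^sub>0 nat"

lemma revlex_irrefl [simp]: "\<not> revlex_less p p"
  by (simp add: revlex_less_def)

lemma revlex_trans: "revlex_less p q \<Longrightarrow> revlex_less q r \<Longrightarrow> revlex_less p r"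
proof -
  assume "revlex_less p q" "revlex_less q r"
  then obtain i j where i: "lookup q i < lookup p i" "\<forall>k>i. lookup q k = lookup p k"
    and j: "lookup r j < lookup q j" "\<forall>k>j. lookup r k = lookup q k"
    unfolding revlex_less_def by blast
  have "lookup r (max i j) < lookup p (max i j)"
    using i j by (cases i j rule: linorder_cases) (auto simp: max_def)
  moreover have "\<forall>k > max i j. lookup r k = lookup p k"
    using i j by auto
  ultimately show ?thesis
    unfolding revlex_less_def by blast
qed

lemma revlex_asym: "revlex_less p q \<Longrightarrow> \<not> revlex_less q p"
  using revlex_trans revlex_irrefl by blast

text \<open>Two exponent vectors differ in finitely many places only, so there is a last one; this makes the
  reverse lexicographic order total on all exponent vectors, of whatever degree.\<close>

lemma last_difference:
  assumes "p \<noteq> (q :: exponent)"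
  obtains i where "lookup p i \<noteq> lookup q i" "\<forall>k>i. lookup p k = lookup q k"
proof -
  let ?D = "{i. lookup p i \<noteq> lookup q i}"
  have "?D \<subseteq> keys p \<union> keys q"
    by (auto simp: in_keys_iff)
  then have fin: "finite ?D"
    by (rule finite_subset) simp
  have ne: "?D \<noteq> {}"
    using assms by (auto intro: poly_mapping_eqI)
  show ?thesis
  proof (rule that)
    show "lookup p (Max ?D) \<noteq> lookup q (Max ?D)"
      using Max_in[OF fin ne] by simp
    show "\<forall>k>Max ?D. lookup p k = lookup q k"
      using Max_ge[OF fin] by (meson leD mem_Collect_eq)
  qed
qed

lemma revlex_total: "p = q \<or> revlex_less p q \<or> revlex_less q p"
proof (cases "p = q")
  case False
  then obtain i where "lookup p i \<noteq> lookup q i" "\<forall>k>i. lookup p k = lookup q k"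
    by (rule last_difference)
  then show ?thesis
    unfolding revlex_less_def by (metis nat_neq_iff)
qed simp

lemma revlex_add_right [simp]: "revlex_less (p + a) (q + a) \<longleftrightarrow> revlex_less p q"
  by (simp add: revlex_less_def lookup_add)

lemma revlex_add_left [simp]: "revlex_less (a + p) (a + q) \<longleftrightarrow> revlex_less p q"
  by (simp add: revlex_less_def lookup_add)

lemma revlex_max_exists:
  assumes "finite S" "S \<noteq> {}"
  shows "\<exists>m\<in>S. \<forall>m'\<in>S. m' \<noteq> m \<longrightarrow> revlex_less m' m"
  using assms
proof (induction S rule: finite_ne_induct)
  case (insert x F)
  then obtain m where m: "m \<in> F" "\<forall>m'\<in>F. m' \<noteq> m \<longrightarrow> revlex_less m' m"
    by blast
  show ?case
  proof (cases "revlex_less m x")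
    case True
    have "revlex_less m' x" if "m' \<in> F" for m'
      using m(2) that True revlex_trans by metis
    then show ?thesis
      by (intro bexI[of _ x]) auto
  next
    case False
    then have "x = m \<or> revlex_less x m"
      using revlex_total by metis
    then show ?thesis
      using m by (intro bexI[of _ m]) auto
  qed
qed simp

lemma leading_exponent_props:
  assumes "f \<noteq> 0"
  shows "leading_exponent f \<in> keys f \<and>
    (\<forall>m'\<in>keys f. m' \<noteq> leading_exponent f \<longrightarrow> revlex_less m' (leading_exponent f))"
proof -
  have "keys f \<noteq> {}"
    using assms by simp
  then obtain m where m: "m \<in> keys f" "\<forall>m'\<in>keys f. m' \<noteq> m \<longrightarrow> revlex_less m' m"
    using revlex_max_exists[of "keys f"] by auto
  show ?thesis
    unfolding leading_exponent_def
  proof (rule theI[where a = m])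
    fix x
    assume x: "x \<in> keys f \<and> (\<forall>m'\<in>keys f. m' \<noteq> x \<longrightarrow> revlex_less m' x)"
    then show "x = m"
      using m revlex_asym by metis
  qed (use m in simp)
qed

lemma leading_exponent_in_keys: "f \<noteq> 0 \<Longrightarrow> leading_exponent f \<in> keys f"
  using leading_exponent_props by blast

lemma leading_exponent_max:
  "m \<in> keys f \<Longrightarrow> m \<noteq> leading_exponent f \<Longrightarrow> revlex_less m (leading_exponent f)"
  using leading_exponent_props[of f] by (metis empty_iff keys_zero)

lemma leading_exponent_eqI:
  assumes "m \<in> keys f" "\<And>m'. m' \<in> keys f \<Longrightarrow> m' \<noteq> m \<Longrightarrow> revlex_less m' m"
  shows "leading_exponent f = m"
proof -
  have "f \<noteq> 0"
    using assms(1) by auto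
  then show ?thesis
    using assms leading_exponent_props[of f] revlex_asym by metis
qed

lemma poly_as_sum:
  fixes f :: "('a, 'k::comm_ring_1) mpoly"
  assumes "finite A" "keys f \<subseteq> A"
  shows "f = (\<Sum>a\<in>A. single a (lookup f a))"
proof (rule poly_mapping_eqI)
  fix m
  have "lookup (\<Sum>a\<in>A. single a (lookup f a)) m = (\<Sum>a\<in>A. if a = m then lookup f m else 0)"
    by (auto simp: lookup_sum lookup_single when_def intro!: sum.cong)
  also have "\<dots> = lookup f m"
    using assms by (auto simp: in_keys_iff)
  finally show "lookup f m = lookup (\<Sum>a\<in>A. single a (lookup f a)) m"
    by simp
qed

lemma lookup_mult_finite:
  fixes f g :: "('a, 'k::comm_ring_1) mpoly"
  assumes "finite A" "keys f \<subseteq> A" "finite B" "keys g \<subseteq> B"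
  shows "lookup (f * g) k = (\<Sum>a\<in>A. \<Sum>b\<in>B. if k = a + b then lookup f a * lookup g b else 0)"
proof -
  have "f * g = (\<Sum>a\<in>A. single a (lookup f a)) * (\<Sum>b\<in>B. single b (lookup g b))"
    using poly_as_sum assms by metis
  also have "\<dots> = (\<Sum>a\<in>A. \<Sum>b\<in>B. single (a + b) (lookup f a * lookup g b))"
    by (simp add: sum_product mult_single)
  finally show ?thesis
    by (auto simp: lookup_sum lookup_single when_def intro!: sum.cong)
qed

lemma lookup_monomial_mult [simp]:
  "lookup (single m c * f) (m + a) = c * lookup (f :: (nat, 'k::comm_ring_1) mpoly) a"
proof -
  have "lookup (single m c * f) (m + a) =
      (\<Sum>b\<in>keys f. if m + a = m + b then lookup (single m c) m * lookup f b else 0)"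
    by (subst lookup_mult_finite[of "{m}" _ "keys f"]) auto
  also have "\<dots> = (\<Sum>b\<in>keys f. if b = a then c * lookup f b else 0)"
    by (intro sum.cong) auto
  also have "\<dots> = c * lookup f a"
    by (auto simp: in_keys_iff)
  finally show ?thesis .
qed

lemma keys_monomial_mult:
  "keys (single m 1 * f) = (+) m ` keys (f :: (nat, 'k::comm_ring_1) mpoly)"
proof (intro equalityI subsetI)
  fix x assume x: "x \<in> keys (single m 1 * f)"
  then obtain b where "x = m + b"
    using keys_mult[of "single m 1" f] by (auto split: if_splits)
  then show "x \<in> (+) m ` keys f"
    using x by (auto simp: in_keys_iff)
qed (auto simp: in_keys_iff)

lemma lookup_const_mult [simp]:
  "lookup (single 0 c * f) a = c * lookup (f :: (nat, 'k::comm_ring_1) mpoly) a"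
  using lookup_monomial_mult[of 0 c f a] by simp

lemma monomial_mult_eq_0 [simp]:
  "single m 1 * f = 0 \<longleftrightarrow> (f :: (nat, 'k::comm_ring_1) mpoly) = 0"
  using keys_monomial_mult[of m f] by (metis image_is_empty keys_eq_empty)

lemma leading_exponent_monomial_mult:
  assumes "(f :: (nat, 'k::comm_ring_1) mpoly) \<noteq> 0"
  shows "leading_exponent (single m 1 * f) = m + leading_exponent f"
  by (rule leading_exponent_eqI)
    (use assms leading_exponent_in_keys leading_exponent_max in \<open>auto simp: keys_monomial_mult\<close>)

section \<open>Dimension counts leading exponents\<close>

text \<open>The ambient polynomial space is infinite-dimensional, where the dimension of a space without a
  finite basis is 0 by convention. A common finite support of all elements rules this case out.\<close>

definition finitely_supported :: "('a, 'k::zero) mpoly set \<Rightarrow> bool" where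
  "finitely_supported X \<longleftrightarrow> (\<exists>M. finite M \<and> (\<forall>f\<in>X. keys f \<subseteq> M))"

definition leads :: "(nat, 'k::zero) mpoly set \<Rightarrow> exponent set" where
  "leads X = leading_exponent ` (X - {0})"

lemma finitely_supported_mono: "finitely_supported Y \<Longrightarrow> X \<subseteq> Y \<Longrightarrow> finitely_supported X"
  unfolding finitely_supported_def by blast

lemma leads_mono: "X \<subseteq> Y \<Longrightarrow> leads X \<subseteq> leads Y"
  unfolding leads_def by blast

lemma finite_leads: "finitely_supported X \<Longrightarrow> finite (leads X)"
proof -
  assume "finitely_supported X"
  then obtain M where "finite M" "\<forall>f\<in>X. keys f \<subseteq> M"
    unfolding finitely_supported_def by blast
  moreover from this have "leads X \<subseteq> M"
    unfolding leads_def using leading_exponent_in_keys by blast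
  ultimately show ?thesis
    using finite_subset by blast
qed

text \<open>Independence of an indexed family: unlike independence of a set it forbids repetitions, so it can be
  compared along a family of vectors that depends on parameters.\<close>

definition lin_indep :: "'i set \<Rightarrow> ('i \<Rightarrow> (nat, 'k::field) mpoly) \<Rightarrow> bool" where
  "lin_indep A v \<longleftrightarrow> (\<forall>c. (\<Sum>i\<in>A. single 0 (c i) * v i) = 0 \<longrightarrow> (\<forall>i\<in>A. c i = 0))"

lemma lin_indepD:
  "lin_indep A v \<Longrightarrow> (\<Sum>i\<in>A. single 0 (c i) * v i) = 0 \<Longrightarrow> i \<in> A \<Longrightarrow> c i = 0"
  unfolding lin_indep_def by blast

lemma lin_indep_if_leads_distinct:
  assumes "finite A" "\<And>i. i \<in> A \<Longrightarrow> v i \<noteq> 0" "inj_on (leading_exponent \<circ> v) A"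
  shows "lin_indep A v"
  unfolding lin_indep_def
proof (intro allI impI, rule ccontr)
  fix c
  assume sum0: "(\<Sum>i\<in>A. single 0 (c i) * v i) = 0" and "\<not> (\<forall>i\<in>A. c i = 0)"
  define S where "S = {i\<in>A. c i \<noteq> 0}"
  have "finite S" "S \<noteq> {}"
    using assms(1) \<open>\<not> (\<forall>i\<in>A. c i = 0)\<close> unfolding S_def by auto
  then obtain b where b: "b \<in> S"
    "\<forall>i\<in>S. leading_exponent (v i) \<noteq> leading_exponent (v b) \<longrightarrow>
      revlex_less (leading_exponent (v i)) (leading_exponent (v b))"
    using revlex_max_exists[of "(\<lambda>i. leading_exponent (v i)) ` S"] by auto
  have "c i * lookup (v i) (leading_exponent (v b)) = 0" if "i \<in> A" "i \<noteq> b" for i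
  proof (cases "i \<in> S")
    case True
    have "leading_exponent (v i) \<noteq> leading_exponent (v b)"
      using assms(3) that b(1) unfolding S_def inj_on_def by auto
    then have "revlex_less (leading_exponent (v i)) (leading_exponent (v b))"
      using b(2) True by blast
    then have "leading_exponent (v b) \<notin> keys (v i)"
      using leading_exponent_max[of "leading_exponent (v b)" "v i"] revlex_asym by fastforce
    then show ?thesis
      by (simp add: in_keys_iff)
  qed (use that in \<open>simp add: S_def\<close>)
  then have "(\<Sum>i\<in>A - {b}. c i * lookup (v i) (leading_exponent (v b))) = 0"
    by (intro sum.neutral) simp
  moreover have "b \<in> A"
    using b(1) unfolding S_def by simp
  ultimately have "lookup (\<Sum>i\<in>A. single 0 (c i) * v i) (leading_exponent (v b)) =
      c b * lookup (v b) (leading_exponent (v b))"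
    using assms(1) by (simp add: lookup_sum lookup_add sum.remove)
  moreover have "lookup (v b) (leading_exponent (v b)) \<noteq> 0"
    using b(1) assms(2) leading_exponent_in_keys[of "v b"] unfolding S_def by (auto simp: in_keys_iff)
  ultimately show False
    using sum0 b(1) unfolding S_def by simp
qed

lemma lin_indep_imp_independent:
  assumes "lin_indep A v" "finite A"
  shows "mpoly.independent (v ` A)" "inj_on v A"
proof -
  show inj: "inj_on v A"
  proof (rule inj_onI, rule ccontr)
    fix i j
    assume ij: "i \<in> A" "j \<in> A" "v i = v j" "i \<noteq> j"
    let ?c = "\<lambda>k. if k = i then 1 else if k = j then - 1 else 0"
    have "(\<Sum>k\<in>A. single 0 (?c k) * v k) = (\<Sum>k\<in>{i, j}. single 0 (?c k) * v k)"
      using ij assms(2) by (intro sum.mono_neutral_right) auto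
    also have "\<dots> = 0"
      using ij by (simp add: single_uminus)
    finally show False
      using lin_indepD[OF assms(1), of ?c i] ij by auto
  qed
  show "mpoly.independent (v ` A)"
  proof (rule mpoly.independent_if_scalars_zero)
    fix f x
    assume "(\<Sum>x\<in>v ` A. Poly_Mapping.map ((*) (f x)) x) = 0" "x \<in> v ` A"
    then show "f x = 0"
      using lin_indepD[OF assms(1), of "\<lambda>i. f (v i)"] inj
      by (auto simp: sum.reindex mult_map_scale_conv_mult)
  qed (use assms in simp)
qed

lemma subspace_closed:
  assumes "mpoly.subspace (X :: ('i, 'k::field) mpoly set)"
  shows "0 \<in> X" "f \<in> X \<Longrightarrow> g \<in> X \<Longrightarrow> f + g \<in> X" "f \<in> X \<Longrightarrow> g \<in> X \<Longrightarrow> f - g \<in> X"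
    "f \<in> X \<Longrightarrow> single 0 c * f \<in> X" "(\<And>i. i \<in> A \<Longrightarrow> F i \<in> X) \<Longrightarrow> sum F A \<in> X"
proof -
  show "0 \<in> X" "f \<in> X \<Longrightarrow> g \<in> X \<Longrightarrow> f + g \<in> X" "f \<in> X \<Longrightarrow> g \<in> X \<Longrightarrow> f - g \<in> X"
    "(\<And>i. i \<in> A \<Longrightarrow> F i \<in> X) \<Longrightarrow> sum F A \<in> X"
    using assms by (auto intro: mpoly.subspace_0 mpoly.subspace_add mpoly.subspace_diff mpoly.subspace_sum)
  show "f \<in> X \<Longrightarrow> single 0 c * f \<in> X"
    using mpoly.subspace_scale[OF assms, of f c] by (simp add: mult_map_scale_conv_mult)
qed

lemma subspaceI:
  assumes "0 \<in> X" "\<And>f g. f \<in> X \<Longrightarrow> g \<in> X \<Longrightarrow> f + g \<in> X" "\<And>f c. f \<in> X \<Longrightarrow> single 0 c * f \<in> X"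
  shows "mpoly.subspace (X :: ('i, 'k::field) mpoly set)"
  unfolding mpoly.subspace_def using assms by (simp add: mult_map_scale_conv_mult)

lemma lead_representatives:
  obtains v where "\<And>m. m \<in> leads X \<Longrightarrow> v m \<in> X \<and> v m \<noteq> 0 \<and> leading_exponent (v m) = m"
proof -
  have "\<forall>m\<in>leads X. \<exists>f. f \<in> X \<and> f \<noteq> 0 \<and> leading_exponent f = m"
    unfolding leads_def by blast
  then show ?thesis
    using that by metis
qed

text \<open>Gaussian elimination: subtracting a multiple of the representative with the same leading exponent
  makes the leading exponent smaller, and only finitely many exponents are available.\<close>

lemma in_span_leads:
  fixes X :: "(nat, 'k::field) mpoly set"
  assumes X: "mpoly.subspace X" "finitely_supported X"
    and v: "\<And>m. m \<in> leads X \<Longrightarrow> v m \<in> X \<and> v m \<noteq> 0 \<and> leading_exponent (v m) = m"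
    and f: "f \<in> X"
  shows "\<exists>c. f = (\<Sum>m\<in>leads X. single 0 (c m) * v m)"
proof -
  obtain M where M: "finite M" "\<forall>f\<in>X. keys f \<subseteq> M"
    using X(2) unfolding finitely_supported_def by blast
  define S where "S g = (if g = 0 then {} else
    {m\<in>M. m = leading_exponent g \<or> revlex_less m (leading_exponent g)})" for g :: "(nat, 'k) mpoly"
  show ?thesis
    using f
  proof (induction "card (S f)"
      arbitrary: f rule: less_induct)
    case less
    show ?case
    proof (cases "f = 0")
      case True
      then show ?thesis
        by (intro exI[of _ "\<lambda>_. 0"]) simp
    next
      case False
      define l where "l = leading_exponent f"
      have l: "l \<in> leads X"
        using less.prems False unfolding leads_def l_def by blast
      define a where "a = lookup f l / lookup (v l) l"
      define g where "g = f - single 0 a * v l"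
      have vl: "v l \<in> X" "v l \<noteq> 0" "leading_exponent (v l) = l"
        using v l by blast+
      then have nz: "lookup (v l) l \<noteq> 0"
        using leading_exponent_in_keys[of "v l"] by (simp add: in_keys_iff)
      have gX: "g \<in> X"
        unfolding g_def using X(1) less.prems vl(1) by (auto intro: subspace_closed)
      have gl: "revlex_less m l" if "m \<in> keys g" for m
      proof -
        have "lookup g l = 0"
          using nz by (simp add: g_def a_def lookup_minus)
        then have "m \<noteq> l"
          using that by (auto simp: in_keys_iff)
        moreover have "m \<in> keys f \<or> m \<in> keys (v l)"
          using that by (auto simp: g_def in_keys_iff lookup_minus)
        ultimately show ?thesis
          using leading_exponent_max[of m f] leading_exponent_max[of m "v l"] vl(3)
          unfolding l_def by auto
      qed
      have lM: "l \<in> M"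
        using less.prems M(2) leading_exponent_in_keys[OF False] unfolding l_def by blast
      have "S g \<subseteq> S f - {l}"
      proof (cases "g = 0")
        case g: False
        then have gl': "revlex_less (leading_exponent g) l"
          using gl leading_exponent_in_keys by blast
        have "x \<in> S f - {l}" if "x \<in> S g" for x
        proof -
          have "x \<in> M" "x = leading_exponent g \<or> revlex_less x (leading_exponent g)"
            using that g by (auto simp: S_def)
          moreover from this have "revlex_less x l"
            using gl' revlex_trans by metis
          ultimately show ?thesis
            using False by (auto simp: S_def l_def)
        qed
        then show ?thesis
          by blast
      qed (simp add: S_def)
      moreover have "l \<in> S f"
        using lM False by (simp add: S_def l_def)
      moreover have "finite (S f)"
        using M(1) by (simp add: S_def)
      ultimately have "card (S g) < card (S f)"
        by (intro psubset_card_mono) auto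
      then obtain c where c: "g = (\<Sum>m\<in>leads X. single 0 (c m) * v m)"
        using less.hyps gX by blast
      let ?d = "\<lambda>m. if m = l then a else 0"
      have "(\<Sum>m\<in>leads X. single 0 (?d m) * v m) = (\<Sum>m\<in>leads X. if m = l then single 0 a * v l else 0)"
        by (rule sum.cong) auto
      also have "\<dots> = single 0 a * v l"
        using l finite_leads[OF X(2)] by simp
      finally have "f = (\<Sum>m\<in>leads X. single 0 (c m) * v m) + (\<Sum>m\<in>leads X. single 0 (?d m) * v m)"
        unfolding c[symmetric] g_def by simp
      also have "\<dots> = (\<Sum>m\<in>leads X. single 0 (c m + ?d m) * v m)"
        by (simp add: sum.distrib[symmetric] distrib_right single_add del: if_distrib)
      finally show ?thesis
        by (intro exI[of _ "\<lambda>m. c m + ?d m"])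
    qed
  qed
qed

lemma span_leads:
  fixes X :: "(nat, 'k::field) mpoly set"
  assumes X: "mpoly.subspace X" "finitely_supported X"
    and v: "\<And>m. m \<in> leads X \<Longrightarrow> v m \<in> X \<and> v m \<noteq> 0 \<and> leading_exponent (v m) = m"
  shows "X \<subseteq> mpoly.span (v ` leads X)"
proof
  fix f assume "f \<in> X"
  then obtain c where c: "f = (\<Sum>m\<in>leads X. single 0 (c m) * v m)"
    using in_span_leads[OF X v] by blast
  show "f \<in> mpoly.span (v ` leads X)"
    unfolding c
    by (intro subspace_closed(5)[OF mpoly.subspace_span] subspace_closed(4)[OF mpoly.subspace_span]
        mpoly.span_base) auto
qed

lemma lin_indep_leads:
  fixes X :: "(nat, 'k::field) mpoly set"
  assumes "finitely_supported X"
    and v: "\<And>m. m \<in> leads X \<Longrightarrow> v m \<in> X \<and> v m \<noteq> 0 \<and> leading_exponent (v m) = m"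
  shows "lin_indep (leads X) v"
  by (rule lin_indep_if_leads_distinct) (use v finite_leads[OF assms(1)] in \<open>auto simp: inj_on_def\<close>)

text \<open>This is the bridge between linear algebra and initial ideals: representatives of the leading
  exponents form an echelon basis.\<close>

lemma dim_eq_card_leads:
  fixes X :: "(nat, 'k::field) mpoly set"
  assumes X: "mpoly.subspace X" "finitely_supported X"
  shows "mpoly.dim X = card (leads X)"
proof -
  obtain v where v: "\<And>m. m \<in> leads X \<Longrightarrow> v m \<in> X \<and> v m \<noteq> 0 \<and> leading_exponent (v m) = m"
    using lead_representatives[of X] by blast
  note ind = lin_indep_imp_independent[OF lin_indep_leads[OF X(2) v] finite_leads[OF X(2)]]
  have "card (v ` leads X) = mpoly.dim X"
    by (intro mpoly.basis_card_eq_dim span_leads X v ind(1)) (use v in auto)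
  then show ?thesis
    using card_image[OF ind(2)] by simp
qed

lemma dim_mono:
  fixes X Y :: "(nat, 'k::field) mpoly set"
  assumes "mpoly.subspace X" "mpoly.subspace Y" "finitely_supported Y" "X \<subseteq> Y"
  shows "mpoly.dim X \<le> mpoly.dim Y"
  using assms dim_eq_card_leads finitely_supported_mono
  by (metis card_mono finite_leads leads_mono)

lemma subspace_eq_if_dim_le:
  fixes X Y :: "(nat, 'k::field) mpoly set"
  assumes "mpoly.subspace X" "mpoly.subspace Y" "finitely_supported Y" "X \<subseteq> Y" "mpoly.dim Y \<le> mpoly.dim X"
  shows "X = Y"
proof -
  have fX: "finitely_supported X"
    using assms finitely_supported_mono by blast
  have "leads X = leads Y"
    using assms dim_eq_card_leads fX
    by (metis card_seteq finite_leads leads_mono)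
  obtain v where v: "\<And>m. m \<in> leads X \<Longrightarrow> v m \<in> X \<and> v m \<noteq> 0 \<and> leading_exponent (v m) = m"
    using lead_representatives[of X] by blast
  have "f \<in> X" if "f \<in> Y" for f
  proof -
    have "\<exists>c. f = (\<Sum>m\<in>leads Y. single 0 (c m) * v m)"
      by (rule in_span_leads[OF assms(2,3) _ that]) (use v assms(4) \<open>leads X = leads Y\<close> in blast)
    then show ?thesis
      using v \<open>leads X = leads Y\<close> by (auto intro!: subspace_closed[OF assms(1)])
  qed
  then show ?thesis
    using assms(4) by blast
qed

lemma lin_indep_card_le_dim:
  fixes X :: "(nat, 'k::field) mpoly set"
  assumes X: "mpoly.subspace X" "finitely_supported X"
    and "finite A" "lin_indep A v" "\<And>i. i \<in> A \<Longrightarrow> v i \<in> X"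
  shows "card A \<le> mpoly.dim X"
proof -
  have ind: "mpoly.independent (v ` A)" "inj_on v A"
    using lin_indep_imp_independent[OF assms(4,3)] by blast+
  obtain w where w: "\<And>m. m \<in> leads X \<Longrightarrow> w m \<in> X \<and> w m \<noteq> 0 \<and> leading_exponent (w m) = m"
    using lead_representatives[of X] by blast
  have "v ` A \<subseteq> mpoly.span (w ` leads X)"
    using assms(5) span_leads[OF X w] by blast
  then have "card (v ` A) \<le> card (w ` leads X)"
    using mpoly.independent_span_bound[OF _ ind(1)] finite_leads[OF X(2)] by blast
  also have "\<dots> \<le> mpoly.dim X"
    using card_image_le[OF finite_leads[OF X(2)], of w] dim_eq_card_leads[OF X] by simp
  finally show ?thesis
    using card_image[OF ind(2)] by simp
qed


lemma single_eq_0_iff [simp]: "single m c = 0 \<longleftrightarrow> c = 0"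
  by (metis lookup_single_eq lookup_zero single_zero)

lemma additive_sum:
  assumes X: "mpoly.subspace (X :: (nat, 'k::field) mpoly set)"
    and add: "\<And>f g. f \<in> X \<Longrightarrow> g \<in> X \<Longrightarrow> T (f + g) = T f + T g"
    and zero: "T 0 = (0 :: (nat, 'k::field) mpoly)"
    and F: "\<And>i. i \<in> A \<Longrightarrow> F i \<in> X"
  shows "T (\<Sum>i\<in>A. F i) = (\<Sum>i\<in>A. T (F i))"
  using F
proof (induction A rule: infinite_finite_induct)
  case (insert x A)
  then show ?case
    using add[of "F x" "sum F A"] subspace_closed(5)[OF X, of A F] by simp
qed (simp_all add: zero)

lemma dim_le_of_injective:
  fixes X Y :: "(nat, 'k::field) mpoly set"
  assumes X: "mpoly.subspace X" "finitely_supported X" and Y: "mpoly.subspace Y" "finitely_supported Y"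
    and add: "\<And>f g. f \<in> X \<Longrightarrow> g \<in> X \<Longrightarrow> T (f + g) = T f + T g"
    and scale: "\<And>f c. f \<in> X \<Longrightarrow> T (single 0 c * f) = single 0 c * T f"
    and inj: "\<And>f. f \<in> X \<Longrightarrow> T f = 0 \<Longrightarrow> f = 0"
    and mem: "\<And>f. f \<in> X \<Longrightarrow> T f \<in> Y"
  shows "mpoly.dim X \<le> mpoly.dim Y"
proof -
  obtain v where v: "\<And>m. m \<in> leads X \<Longrightarrow> v m \<in> X \<and> v m \<noteq> 0 \<and> leading_exponent (v m) = m"
    using lead_representatives[of X] by blast
  have zero: "T 0 = 0"
    using scale[of 0 0] subspace_closed(1)[OF X(1)] by simp
  have "lin_indep (leads X) (\<lambda>m. T (v m))"
    unfolding lin_indep_def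
  proof (intro allI impI)
    fix c assume c: "(\<Sum>m\<in>leads X. single 0 (c m) * T (v m)) = 0"
    have "T (\<Sum>m\<in>leads X. single 0 (c m) * v m) = (\<Sum>m\<in>leads X. T (single 0 (c m) * v m))"
      by (rule additive_sum[OF X(1) add zero]) (use v X(1) in \<open>auto intro: subspace_closed\<close>)
    also have "\<dots> = (\<Sum>m\<in>leads X. single 0 (c m) * T (v m))"
      using v scale by (intro sum.cong) auto
    finally have "T (\<Sum>m\<in>leads X. single 0 (c m) * v m) = 0"
      using c by simp
    moreover have "(\<Sum>m\<in>leads X. single 0 (c m) * v m) \<in> X"
      using v by (intro subspace_closed(5)[OF X(1)] subspace_closed(4)[OF X(1)]) auto
    ultimately have "(\<Sum>m\<in>leads X. single 0 (c m) * v m) = 0"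
      using inj by metis
    moreover have "lin_indep (leads X) v"
      by (rule lin_indep_leads[OF X(2) v])
    ultimately show "\<forall>m\<in>leads X. c m = 0"
      unfolding lin_indep_def by blast
  qed
  then have "card (leads X) \<le> mpoly.dim Y"
    using finite_leads[OF X(2)] v mem by (intro lin_indep_card_le_dim[OF Y]) auto
  then show ?thesis
    using dim_eq_card_leads[OF X] by simp
qed

text \<open>The usual formula, for finite-dimensional subspaces of a space that may have infinite dimension.
  A basis \<open>C\<close> of the intersection is extended to a basis \<open>D\<close> of \<open>A\<close>; together with a basis \<open>E\<close> of \<open>B\<close>,
  the new vectors \<open>D - C\<close> form a basis of the sum.\<close>

lemma (in vector_space) dim_sum_Int:
  assumes A: "subspace A" "finite SA" "A \<subseteq> span SA" and B: "subspace B" "finite SB" "B \<subseteq> span SB"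
  shows "dim {x + y |x y. x \<in> A \<and> y \<in> B} + dim (A \<inter> B) = dim A + dim B"
proof -
  obtain C where C: "C \<subseteq> A \<inter> B" "independent C" "A \<inter> B \<subseteq> span C" "card C = dim (A \<inter> B)"
    by (rule basis_exists)
  obtain D where D: "C \<subseteq> D" "D \<subseteq> A" "independent D" "A \<subseteq> span D"
    using maximal_independent_subset_extend[of C A] C by blast
  obtain E where E: "E \<subseteq> B" "independent E" "B \<subseteq> span E" "card E = dim B"
    by (rule basis_exists)
  have finD: "finite D" and finE: "finite E"
    using independent_span_bound[OF A(2) D(3)] independent_span_bound[OF B(2) E(2)] D(2) E(1) A(3) B(3)
    by blast+
  have finC: "finite C"
    using D(1) finD finite_subset by blast
  have dimD: "card D = dim A"
    using basis_card_eq_dim D by blast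
  have disj: "(D - C) \<inter> E = {}"
  proof (rule ccontr)
    assume "(D - C) \<inter> E \<noteq> {}"
    then obtain x where x: "x \<in> D" "x \<notin> C" "x \<in> E"
      by blast
    then have "x \<in> span C"
      using D(2) E(1) C(3) by blast
    then have "x \<in> span (D - {x})"
      using span_mono[of C "D - {x}"] D(1) x(2) by blast
    then show False
      using D(3) x(1) unfolding dependent_def by blast
  qed
  have "independent ((D - C) \<union> E)"
  proof (rule independent_if_scalars_zero)
    fix f x
    assume f: "(\<Sum>x\<in>D - C \<union> E. scale (f x) x) = 0" and x: "x \<in> D - C \<union> E"
    define u where "u = (\<Sum>x\<in>D - C. scale (f x) x)"
    have split: "u + (\<Sum>x\<in>E. scale (f x) x) = 0"
      using f disj finD finE unfolding u_def by (simp add: sum.union_disjoint)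
    have "u \<in> A"
      unfolding u_def using A(1) D(2) by (intro subspace_sum subspace_scale) auto
    moreover have "u \<in> B"
    proof -
      have "u = - (\<Sum>x\<in>E. scale (f x) x)"
        using split by (simp add: eq_neg_iff_add_eq_0)
      then show ?thesis
        using B(1) E(1) by (auto intro!: subspace_sum subspace_scale subspace_neg)
    qed
    ultimately have "u \<in> span C"
      using C(3) by blast
    then obtain g where g: "u = (\<Sum>x\<in>C. scale (g x) x)"
      using span_finite[OF finC] by auto
    let ?h = "\<lambda>x. if x \<in> C then - g x else f x"
    have "(\<Sum>x\<in>D. scale (?h x) x) = (\<Sum>x\<in>D - C. scale (?h x) x) + (\<Sum>x\<in>C. scale (?h x) x)"
      using sum.subset_diff[OF D(1) finD] by blast
    also have "\<dots> = u + - u"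
    proof (intro arg_cong2[where f = "(+)"])
      show "(\<Sum>x\<in>D - C. scale (?h x) x) = u"
        unfolding u_def by (rule sum.cong) auto
      show "(\<Sum>x\<in>C. scale (?h x) x) = - u"
        unfolding g sum_negf[symmetric] by (rule sum.cong) auto
    qed
    finally have h0: "(\<Sum>x\<in>D. scale (?h x) x) = 0"
      by simp
    have f0: "f y = 0" if "y \<in> D - C" for y
      using independentD[OF D(3) finD subset_refl h0, of y] that by auto
    then have "u = 0"
      unfolding u_def by simp
    then have "(\<Sum>x\<in>E. scale (f x) x) = 0"
      using split by simp
    then have "f y = 0" if "y \<in> E" for y
      using independentD[OF E(2) finE subset_refl] that by blast
    then show "f x = 0"
      using f0 x by blast
  qed (use finD finE in simp)
  moreover have "span ((D - C) \<union> E) = span {x + y |x y. x \<in> A \<and> y \<in> B}"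
  proof (rule span_eq[THEN iffD2], intro conjI subsetI)
    fix x assume x: "x \<in> D - C \<union> E"
    have "x + 0 \<in> {x + y |x y. x \<in> A \<and> y \<in> B}" if "x \<in> A"
      using that subspace_0[OF B(1)] by blast
    moreover have "0 + x \<in> {x + y |x y. x \<in> A \<and> y \<in> B}" if "x \<in> B"
      using that subspace_0[OF A(1)] by blast
    ultimately have "x \<in> {x + y |x y. x \<in> A \<and> y \<in> B}"
      using x D(2) E(1) by auto
    then show "x \<in> span {x + y |x y. x \<in> A \<and> y \<in> B}"
      by (rule span_base)
  next
    fix z assume "z \<in> {x + y |x y. x \<in> A \<and> y \<in> B}"
    then obtain x y where z: "z = x + y" "x \<in> A" "y \<in> B"
      by blast
    have CE: "C \<subseteq> span (D - C \<union> E)"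
      using C(1) E(3) span_mono[of E "D - C \<union> E"] by blast
    have "D \<subseteq> span (D - C \<union> E)"
      using CE span_superset[of "D - C \<union> E"] by blast
    then have "x \<in> span (D - C \<union> E)"
      using z(2) D(4) span_minimal[OF _ subspace_span] by blast
    moreover have "y \<in> span (D - C \<union> E)"
      using z(3) E(3) span_mono[of E "D - C \<union> E"] by blast
    ultimately show "z \<in> span (D - C \<union> E)"
      using z(1) span_add by blast
  qed
  ultimately have "dim {x + y |x y. x \<in> A \<and> y \<in> B} = card ((D - C) \<union> E)"
    using dim_eq_card by blast
  also have "\<dots> = card D - card C + card E"
    using disj finD finE finC D(1) by (simp add: card_Un_disjoint card_Diff_subset)
  finally show ?thesis
    using C(4) dimD E(4) card_mono[OF finD D(1)] by simp
qed

lemma dim_sum_Int_poly: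
  fixes A B :: "(nat, 'k::field) mpoly set"
  assumes "mpoly.subspace A" "finitely_supported A" "mpoly.subspace B" "finitely_supported B"
  shows "mpoly.dim {f + g |f g. f \<in> A \<and> g \<in> B} + mpoly.dim (A \<inter> B) = mpoly.dim A + mpoly.dim B"
proof -
  obtain v where v: "\<And>m. m \<in> leads A \<Longrightarrow> v m \<in> A \<and> v m \<noteq> 0 \<and> leading_exponent (v m) = m"
    using lead_representatives[of A] by blast
  obtain w where w: "\<And>m. m \<in> leads B \<Longrightarrow> w m \<in> B \<and> w m \<noteq> 0 \<and> leading_exponent (w m) = m"
    using lead_representatives[of B] by blast
  show ?thesis
    by (rule mpoly.dim_sum_Int[OF assms(1) _ span_leads[OF assms(1,2) v] assms(3) _ span_leads[OF assms(3,4) w]])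
      (use finite_leads assms in auto)
qed

section \<open>Exponents split at the line\<close>

text \<open>The two parts of an exponent: \<open>lo\<close> belongs to the variables \<open>x\<^sub>1, x\<^sub>2\<close> on the line
  \<open>x\<^sub>3 = \<dots> = x\<^sub>n = 0\<close>, and \<open>hi\<close> to the transversal variables.\<close>

definition lo :: "exponent \<Rightarrow> exponent" where
  "lo m = single 0 (lookup m 0) + single 1 (lookup m 1)"

definition hi :: "exponent \<Rightarrow> exponent" where
  "hi m = m - lo m"

lemma lookup_lo: "lookup (lo m) i = (if i < 2 then lookup m i else 0)"
  by (auto simp: lo_def lookup_add lookup_single when_def less_2_cases_iff)

lemma lookup_hi: "lookup (hi m) i = (if i < 2 then 0 else lookup m i)"
  by (auto simp: hi_def lookup_minus lookup_lo)

lemma lo_plus_hi [simp]: "lo m + hi m = m"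
  by (rule poly_mapping_eqI) (simp add: lookup_add lookup_lo lookup_hi)

lemma lo_add: "lo (a + b) = lo a + lo b" and hi_add: "hi (a + b) = hi a + hi b"
  by (rule poly_mapping_eqI, simp add: lookup_add lookup_lo lookup_hi)+

lemma lo_hi_simps [simp]: "lo (lo m) = lo m" "hi (hi m) = hi m" "lo (hi m) = 0" "hi (lo m) = 0"
    "lo 0 = 0" "hi 0 = 0"
  by (rule poly_mapping_eqI, simp add: lookup_lo lookup_hi)+

lemma hi_eq_0_iff: "hi m = 0 \<longleftrightarrow> lo m = m"
  by (metis lo_hi_simps(4) lo_plus_hi add.right_neutral)

lemma mdeg_superset:
  assumes "finite A" "keys m \<subseteq> A"
  shows "mdeg m = (\<Sum>i\<in>A. lookup m i)"
  unfolding mdeg_def using assms by (intro sum.mono_neutral_left) (auto simp: in_keys_iff)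

lemma mdeg_add [simp]: "mdeg (a + b) = mdeg a + mdeg b"
proof -
  have "keys (a + b) \<subseteq> keys a \<union> keys b"
    by (rule Poly_Mapping.keys_add)
  then show ?thesis
    by (simp add: mdeg_superset[of "keys a \<union> keys b"] lookup_add sum.distrib)
qed

lemma mdeg_single [simp]: "mdeg (single i e) = e"
  by (simp add: mdeg_def)

lemma mdeg_0 [simp]: "mdeg 0 = 0"
  by (simp add: mdeg_def)

lemma mdeg_eq_0_iff [simp]: "mdeg m = 0 \<longleftrightarrow> m = 0"
  unfolding mdeg_def by (auto simp: in_keys_iff intro: poly_mapping_eqI)

lemma lookup_le_mdeg: "lookup m i \<le> mdeg m"
proof (cases "i \<in> keys m")
  case True
  then show ?thesis
    unfolding mdeg_def by (intro member_le_sum) auto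
qed (simp add: in_keys_iff)

lemma exponents_bounded:
  fixes A :: "nat set"
  assumes A: "finite A"
  shows "finite {m. keys m \<subseteq> A \<and> mdeg m \<le> Q}"
    and "card {m. keys m \<subseteq> A \<and> mdeg m \<le> Q} \<le> Suc Q ^ card A"
proof -
  let ?J = "{m. keys m \<subseteq> A \<and> mdeg m \<le> Q}"
  let ?P = "\<Pi>\<^sub>E i\<in>A. {..Q}"
  have inj: "inj_on (\<lambda>m. restrict (lookup m) A) ?J"
  proof (rule inj_onI, rule poly_mapping_eqI)
    fix m m' k
    assume *: "m \<in> ?J" "m' \<in> ?J" "restrict (lookup m) A = restrict (lookup m') A"
    show "lookup m k = lookup m' k"
    proof (cases "k \<in> A")
      case True
      then show ?thesis
        using fun_cong[OF *(3), of k] by simp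
    next
      case False
      then have "k \<notin> keys m" "k \<notin> keys m'"
        using *(1,2) by auto
      then show ?thesis
        by (simp add: in_keys_iff)
    qed
  qed
  have sub: "(\<lambda>m. restrict (lookup m) A) ` ?J \<subseteq> ?P"
    by (intro image_subsetI PiE_I) (auto intro: le_trans[OF lookup_le_mdeg])
  have finP: "finite ?P"
    using A by (intro finite_PiE) auto
  show "finite ?J"
    using finite_imageD[OF finite_subset[OF sub finP] inj] .
  have "card ?J \<le> card ?P"
    by (rule card_inj_on_le[OF inj sub finP])
  then show "card ?J \<le> Suc Q ^ card A"
    using A by (simp add: card_PiE)
qed

definition restrict_keys :: "(exponent \<Rightarrow> bool) \<Rightarrow> (nat, 'k::comm_ring_1) mpoly \<Rightarrow> (nat, 'k) mpoly" where
  "restrict_keys P f = Poly_Mapping.mapp (\<lambda>m c. c when P m) f"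

lemma lookup_restrict_keys [simp]: "lookup (restrict_keys P f) m = (if P m then lookup f m else 0)"
  by (auto simp: restrict_keys_def lookup_mapp when_def in_keys_iff)

lemma keys_restrict_keys: "keys (restrict_keys P f) = {m \<in> keys f. P m}"
  by (auto simp: in_keys_iff split: if_splits)

lemma restrict_keys_add: "restrict_keys P (f + g) = restrict_keys P f + restrict_keys P g"
  by (rule poly_mapping_eqI) (simp add: lookup_add)

lemma restrict_keys_scale: "restrict_keys P (single 0 c * f) = single 0 c * restrict_keys P f"
  by (rule poly_mapping_eqI) simp

lemma restrict_keys_0 [simp]: "restrict_keys P 0 = 0"
  by (rule poly_mapping_eqI) simp

lemma subspace_restrict_keys:
  "mpoly.subspace X \<Longrightarrow> mpoly.subspace (restrict_keys P ` X :: (nat, 'k::field) mpoly set)"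
  by (rule subspaceI)
    (auto simp: image_iff intro: subspace_closed restrict_keys_add[symmetric] restrict_keys_scale[symmetric]
      bexI[of _ 0] intro!: bexI)

lemma finitely_supported_restrict_keys:
  "finitely_supported X \<Longrightarrow> finitely_supported (restrict_keys P ` X)"
  unfolding finitely_supported_def keys_restrict_keys by (fastforce simp: keys_restrict_keys)

definition up_closed :: "(exponent \<Rightarrow> bool) \<Rightarrow> bool" where
  "up_closed P \<longleftrightarrow> (\<forall>m m'. P m \<longrightarrow> revlex_less m m' \<longrightarrow> P m')"

lemma leading_exponent_restrict_keys:
  assumes "f \<noteq> 0" "P (leading_exponent f)"
  shows "restrict_keys P f \<noteq> 0" "leading_exponent (restrict_keys P f) = leading_exponent f"
proof -
  have l: "leading_exponent f \<in> keys (restrict_keys P f)"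
    using assms leading_exponent_in_keys by (simp add: keys_restrict_keys)
  then show "restrict_keys P f \<noteq> 0"
    by auto
  show "leading_exponent (restrict_keys P f) = leading_exponent f"
    using l leading_exponent_max by (intro leading_exponent_eqI) (auto simp: keys_restrict_keys)
qed

text \<open>Keeping only the terms from an upper segment of the monomial order keeps exactly the leading
  exponents in that segment, so the count of initial monomials in an upper segment is a rank. Both the
  existence of generic initial ideals and the restriction to a line use this.\<close>

lemma leads_restrict_keys:
  assumes "up_closed P"
  shows "leads (restrict_keys P ` X) = {m \<in> leads X. P m}"
proof (intro equalityI subsetI)
  fix m assume "m \<in> leads (restrict_keys P ` X)"
  then obtain f where f: "f \<in> X" "restrict_keys P f \<noteq> 0" "m = leading_exponent (restrict_keys P f)"
    unfolding leads_def by blast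
  then have f0: "f \<noteq> 0"
    by auto
  have "m \<in> keys f" "P m"
    using leading_exponent_in_keys[OF f(2)] f(3) by (auto simp: keys_restrict_keys)
  then have "P (leading_exponent f)"
    using leading_exponent_max[of m f] assms unfolding up_closed_def by metis
  then have "m = leading_exponent f"
    using leading_exponent_restrict_keys(2)[OF f0] f(3) by simp
  then show "m \<in> {m \<in> leads X. P m}"
    using \<open>P m\<close> f(1) f0 unfolding leads_def by blast
next
  fix m assume "m \<in> {m \<in> leads X. P m}"
  then obtain f where f: "f \<in> X" "f \<noteq> 0" "m = leading_exponent f" "P (leading_exponent f)"
    unfolding leads_def by blast
  then show "m \<in> leads (restrict_keys P ` X)"
    using leading_exponent_restrict_keys[of f P] unfolding leads_def by (metis DiffI image_eqI singletonD)
qed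

lemma dim_restrict_keys:
  fixes X :: "(nat, 'k::field) mpoly set"
  assumes "mpoly.subspace X" "finitely_supported X" "up_closed P"
  shows "mpoly.dim (restrict_keys P ` X) = card {m \<in> leads X. P m}"
  using assms
  by (simp add: leads_restrict_keys dim_eq_card_leads subspace_restrict_keys finitely_supported_restrict_keys)

definition line_part :: "(nat, 'k::comm_ring_1) mpoly \<Rightarrow> (nat, 'k) mpoly" where
  "line_part = restrict_keys (\<lambda>m. hi m = 0)"

text \<open>For the reverse lexicographic order the monomials in \<open>x\<^sub>1, x\<^sub>2\<close> form an upper segment; this is
  why restriction to a line is compatible with initial monomials.\<close>

lemma up_closed_hi_0: "up_closed (\<lambda>m. hi m = 0)"
  unfolding up_closed_def
proof (intro allI impI)
  fix m m' :: exponent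
  assume m: "hi m = 0" and "revlex_less m m'"
  then obtain i where i: "lookup m' i < lookup m i" "\<forall>j>i. lookup m' j = lookup m j"
    unfolding revlex_less_def by blast
  have hi0: "lookup m k = 0" if "k \<ge> 2" for k
    using m that lookup_hi[of m k] by simp
  then have "i < 2"
    using i(1) by (metis linorder_not_less not_less_zero)
  then have "lookup m' k = 0" if "k \<ge> 2" for k
    using i(2) hi0 that by simp
  then show "hi m' = 0"
    by (intro poly_mapping_eqI) (simp add: lookup_hi)
qed

text \<open>The coefficient of the transversal monomial with exponent \<open>j\<close>, as a polynomial in \<open>x\<^sub>1, x\<^sub>2\<close>.\<close>

definition slice :: "exponent \<Rightarrow> (nat, 'k::comm_ring_1) mpoly \<Rightarrow> (nat, 'k) mpoly" where
  "slice j f = (\<Sum>m\<in>{m \<in> keys f. hi m = j}. single (lo m) (lookup f m))"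

lemma lookup_slice:
  assumes "lo j = 0"
  shows "lookup (slice j f) a = (if hi a = 0 then lookup f (a + j) else 0)"
proof -
  have "lookup (slice j f) a = (\<Sum>m\<in>{m \<in> keys f. hi m = j}. if lo m = a then lookup f m else 0)"
    unfolding slice_def lookup_sum lookup_single when_def by (rule refl)
  also have "\<dots> = (\<Sum>m\<in>{m \<in> keys f. hi m = j}. if m = a + j then if hi a = 0 then lookup f (a + j) else 0 else 0)"
  proof (intro sum.cong refl)
    fix m assume m: "m \<in> {m \<in> keys f. hi m = j}"
    show "(if lo m = a then lookup f m else 0) = (if m = a + j then if hi a = 0 then lookup f (a + j) else 0 else 0)"
    proof (cases "lo m = a")
      case True
      then have "m = a + j" "hi a = 0"
        using m lo_plus_hi[of m] by auto
      then show ?thesis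
        using True by simp
    next
      case False
      have "m \<noteq> a + j \<or> hi a \<noteq> 0"
        using False assms by (auto simp: lo_add hi_eq_0_iff)
      then show ?thesis
        using False by auto
    qed
  qed
  also have "\<dots> = (if a + j \<in> {m \<in> keys f. hi m = j} then if hi a = 0 then lookup f (a + j) else 0 else 0)"
    by simp
  also have "\<dots> = (if hi a = 0 then lookup f (a + j) else 0)"
  proof -
    have "hi j = j"
      using assms lo_plus_hi[of j] by (metis add_0)
    then show ?thesis
      by (auto simp: in_keys_iff hi_add)
  qed
  finally show ?thesis .
qed

lemma leading_exponent_slice:
  assumes "f \<noteq> 0" "hi (leading_exponent f) = j"
  shows "slice j f \<noteq> 0" "leading_exponent (slice j f) = lo (leading_exponent f)"
proof -
  let ?l = "leading_exponent f"
  have j: "lo j = 0"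
    using assms(2) by auto
  have lj: "lo ?l + j = ?l"
    using assms(2) by (metis lo_plus_hi)
  have l: "lo ?l \<in> keys (slice j f)"
    using leading_exponent_in_keys[OF assms(1)] by (simp add: in_keys_iff lookup_slice[OF j] lj)
  then show "slice j f \<noteq> 0"
    by auto
  show "leading_exponent (slice j f) = lo ?l"
  proof (rule leading_exponent_eqI[OF l])
    fix a assume a: "a \<in> keys (slice j f)" "a \<noteq> lo ?l"
    then have "a + j \<in> keys f"
      by (simp add: in_keys_iff lookup_slice[OF j] split: if_splits)
    moreover have "a + j \<noteq> ?l"
      using a(2) lj by (metis add_right_cancel)
    ultimately have "revlex_less (a + j) (lo ?l + j)"
      using leading_exponent_max lj by metis
    then show "revlex_less a (lo ?l)"
      by simp
  qed
qed

section \<open>Colon spaces and pencils of binary forms\<close>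

abbreviation Var :: "nat \<Rightarrow> (nat, 'k::comm_ring_1) mpoly" where
  "Var i \<equiv> single (single i 1) 1"

text \<open>The colon space \<open>(Z : S\<^sub>1)\<close>; its iterates are the spaces \<open>(Z : S\<^sub>q)\<close>, see \<open>funpow_colon_iff\<close>.\<close>

definition colon :: "(nat, 'k::comm_ring_1) mpoly set \<Rightarrow> (nat, 'k) mpoly set" where
  "colon Z = {w. Var 0 * w \<in> Z \<and> Var 1 * w \<in> Z}"

definition pencil :: "(nat, 'k::comm_ring_1) mpoly set \<Rightarrow> (nat, 'k) mpoly set" where
  "pencil Z = {f + g |f g. f \<in> (*) (Var 0) ` Z \<and> g \<in> (*) (Var 1) ` Z}"

lemma subspace_colon: "mpoly.subspace Z \<Longrightarrow> mpoly.subspace (colon Z :: (nat, 'k::field) mpoly set)"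
  by (rule subspaceI)
    (auto simp: colon_def distrib_left mult.left_commute[of _ "single 0 _"] intro: subspace_closed)

lemma finitely_supported_preimage:
  assumes "finitely_supported Z" "\<And>w. w \<in> X \<Longrightarrow> single m 1 * (w :: (nat, 'k::comm_ring_1) mpoly) \<in> Z"
  shows "finitely_supported X"
proof -
  obtain M where M: "finite M" "\<forall>f\<in>Z. keys f \<subseteq> M"
    using assms(1) unfolding finitely_supported_def by blast
  have "keys w \<subseteq> (+) m -` M" if "w \<in> X" for w
  proof -
    have "keys (single m 1 * w) \<subseteq> M"
      using M(2) assms(2)[OF that] by blast
    then show ?thesis
      by (auto simp: keys_monomial_mult)
  qed
  moreover have "finite ((+) m -` M)"
    using M(1) by (intro finite_vimageI) (auto simp: inj_on_def)
  ultimately show ?thesis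
    unfolding finitely_supported_def by blast
qed

lemma finitely_supported_colon: "finitely_supported Z \<Longrightarrow> finitely_supported (colon Z)"
  by (rule finitely_supported_preimage[of Z _ "single 0 1"]) (auto simp: colon_def)

lemma subspace_mult_image:
  "mpoly.subspace Z \<Longrightarrow> mpoly.subspace ((*) p ` Z :: (nat, 'k::field) mpoly set)"
  by (rule subspaceI)
    (auto simp: image_iff mult.left_commute[of _ "single 0 _"] distrib_left[symmetric]
       intro: subspace_closed bexI[of _ 0] intro!: bexI)

lemma finitely_supported_mult_image:
  "finitely_supported Z \<Longrightarrow> finitely_supported ((*) (single m 1) ` Z :: (nat, 'k::comm_ring_1) mpoly set)"
  unfolding finitely_supported_def
proof -
  assume "\<exists>M. finite M \<and> (\<forall>f\<in>Z. keys f \<subseteq> M)"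
  then obtain M where M: "finite M" "\<forall>f\<in>Z. keys f \<subseteq> M"
    by blast
  then show "\<exists>M. finite M \<and> (\<forall>f\<in>(*) (single m 1) ` Z. keys f \<subseteq> M)"
    by (intro exI[of _ "(+) m ` M"]) (auto simp: keys_monomial_mult)
qed

lemma dim_monomial_mult_image:
  fixes Z :: "(nat, 'k::field) mpoly set"
  assumes "mpoly.subspace Z" "finitely_supported Z"
  shows "mpoly.dim ((*) (single m 1) ` Z) = mpoly.dim Z"
proof -
  have "leads ((*) (single m 1) ` Z) = (+) m ` leads Z"
  proof (intro equalityI subsetI)
    fix x assume "x \<in> leads ((*) (single m 1) ` Z)"
    then obtain g where g: "g \<in> (*) (single m 1) ` Z" "g \<noteq> 0" "x = leading_exponent g"
      unfolding leads_def by blast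
    then obtain f where f: "f \<in> Z" "g = single m 1 * f"
      by blast
    with g(2) have "f \<noteq> 0"
      by auto
    with f g(3) show "x \<in> (+) m ` leads Z"
      using leading_exponent_monomial_mult[of f m] unfolding leads_def by auto
  next
    fix x assume "x \<in> (+) m ` leads Z"
    then obtain f where f: "f \<in> Z" "f \<noteq> 0" "x = m + leading_exponent f"
      unfolding leads_def by auto
    then show "x \<in> leads ((*) (single m 1) ` Z)"
      unfolding leads_def
      by (intro image_eqI[where x = "single m 1 * f"]) (auto simp: leading_exponent_monomial_mult simp del: mult_eq_0_iff)
  qed
  then show ?thesis
    using assms by (simp add: dim_eq_card_leads subspace_mult_image finitely_supported_mult_image card_image)
qed

lemma divide_by_variable:
  fixes f :: "(nat, 'k::comm_ring_1) mpoly"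
  assumes "\<And>m. m \<in> keys f \<Longrightarrow> lookup m i > 0"
  obtains w where "f = Var i * w"
proof
  have *: "single i 1 + (m - single i 1) = m" if "m \<in> keys f" for m
    using assms[OF that] by (intro poly_mapping_eqI) (auto simp: lookup_add lookup_minus lookup_single when_def)
  have "f = (\<Sum>m\<in>keys f. single m (lookup f m))"
    by (rule poly_as_sum) auto
  also have "\<dots> = (\<Sum>m\<in>keys f. Var i * single (m - single i 1) (lookup f m))"
    by (rule sum.cong) (simp_all add: mult_single * del: One_nat_def)
  finally show "f = Var i * (\<Sum>m\<in>keys f. single (m - single i 1) (lookup f m))"
    by (simp add: sum_distrib_left)
qed

text \<open>If \<open>x\<^sub>1 a = x\<^sub>2 b\<close> then \<open>x\<^sub>2\<close> divides \<open>a\<close>, and the quotient is the same as that of \<open>b\<close> by \<open>x\<^sub>1\<close>.\<close>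

lemma Int_mult_image_eq_colon:
  "(*) (Var 0) ` Z \<inter> (*) (Var 1) ` Z = (*) (single (single 0 1 + single 1 1) 1) ` colon (Z :: (nat, 'k::comm_ring_1) mpoly set)"
proof -
  have eq: "single (single 0 1 + single 1 1) 1 * w = Var 0 * (Var 1 * w)"
    "single (single 0 1 + single 1 1) 1 * w = Var 1 * (Var 0 * w)" for w :: "(nat, 'k) mpoly"
    by (simp_all add: mult.assoc[symmetric] mult_single add.commute)
  show ?thesis
  proof (intro equalityI subsetI)
    fix f assume "f \<in> (*) (Var 0) ` Z \<inter> (*) (Var 1) ` Z"
    then obtain a b where ab: "a \<in> Z" "b \<in> Z" "f = Var 0 * a" "f = Var 1 * b"
      by blast
    have "lookup m 1 > 0" if m: "m \<in> keys a" for m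
    proof -
      have "single 0 1 + m \<in> keys f"
        using m ab(3) by (simp add: keys_monomial_mult)
      then obtain m' where "single 0 1 + m = single 1 1 + m'"
        using ab(4) by (auto simp: keys_monomial_mult)
      then have "lookup (single 0 1 + m) 1 = lookup (single 1 1 + m') 1"
        by simp
      then show ?thesis
        by (simp add: lookup_add lookup_single)
    qed
    then obtain w where w: "a = Var 1 * w"
      using divide_by_variable by blast
    have "Var 1 * (b - Var 0 * w) = 0"
      using ab(3,4) w by (simp add: right_diff_distrib mult.left_commute)
    then have "b = Var 0 * w"
      by simp
    then have "w \<in> colon Z"
      using ab w by (simp add: colon_def)
    moreover have "f = single (single 0 1 + single 1 1) 1 * w"
      by (simp only: ab(3) w eq(1))
    ultimately show "f \<in> (*) (single (single 0 1 + single 1 1) 1) ` colon Z"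
      by blast
  next
    fix f assume "f \<in> (*) (single (single 0 1 + single 1 1) 1) ` colon Z"
    then obtain w where "w \<in> colon Z" and w: "f = single (single 0 1 + single 1 1) 1 * w"
      by blast
    then have "Var 0 * w \<in> Z" "Var 1 * w \<in> Z"
      by (auto simp: colon_def)
    moreover have "f = Var 0 * (Var 1 * w)" "f = Var 1 * (Var 0 * w)"
      unfolding w by (rule eq)+
    ultimately show "f \<in> (*) (Var 0) ` Z \<inter> (*) (Var 1) ` Z"
      by blast
  qed
qed

lemma dim_pencil_colon:
  fixes Z :: "(nat, 'k::field) mpoly set"
  assumes Z: "mpoly.subspace Z" "finitely_supported Z"
  shows "mpoly.dim (pencil Z) + mpoly.dim (colon Z) = 2 * mpoly.dim Z"
proof -
  have "mpoly.dim (pencil Z) + mpoly.dim ((*) (Var 0) ` Z \<inter> (*) (Var 1) ` Z) =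
      mpoly.dim ((*) (Var 0) ` Z) + mpoly.dim ((*) (Var 1) ` Z)"
    unfolding pencil_def
    by (rule dim_sum_Int_poly) (use Z in \<open>auto intro: subspace_mult_image finitely_supported_mult_image\<close>)
  then show ?thesis
    unfolding Int_mult_image_eq_colon
    using Z by (simp add: dim_monomial_mult_image subspace_colon finitely_supported_colon)
qed

lemma colon_iff: "w \<in> colon Z \<longleftrightarrow> Var 0 * w \<in> Z \<and> Var 1 * w \<in> Z"
  by (simp add: colon_def)

lemma funpow_colon_iff:
  fixes Z :: "(nat, 'k::comm_ring_1) mpoly set"
  shows "w \<in> (colon ^^ q) Z \<longleftrightarrow> (\<forall>a b. a + b = q \<longrightarrow> single (single 0 a + single 1 b) 1 * w \<in> Z)"
proof (induction q arbitrary: w)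
  case (Suc q)
  let ?mon = "\<lambda>a b. single (single 0 a + single (1::nat) b) (1::'k)"
  have "single 0 a + single 1 b + single 0 1 = single 0 (Suc a) + single (1::nat) b"
    "single 0 a + single 1 b + single 1 1 = single 0 a + single (1::nat) (Suc b)" for a b :: nat
    by (rule poly_mapping_eqI, simp add: lookup_add lookup_single when_def)+
  then have shift: "?mon a b * (Var 0 * w) = ?mon (Suc a) b * w" "?mon a b * (Var 1 * w) = ?mon a (Suc b) * w" for a b
    by (simp_all add: mult.assoc[symmetric] mult_single)
  show ?case
  proof
    assume "w \<in> (colon ^^ Suc q) Z"
    then have IH: "\<And>a b. a + b = q \<Longrightarrow> ?mon (Suc a) b * w \<in> Z" "\<And>a b. a + b = q \<Longrightarrow> ?mon a (Suc b) * w \<in> Z"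
      unfolding funpow.simps o_apply colon_iff Suc.IH shift by blast+
    show "\<forall>a b. a + b = Suc q \<longrightarrow> ?mon a b * w \<in> Z"
    proof (intro allI impI)
      fix a b assume ab: "a + b = Suc q"
      show "?mon a b * w \<in> Z"
      proof (cases a)
        case 0
        then show ?thesis
          using IH(2)[of 0 q] ab by simp
      next
        case (Suc a')
        then show ?thesis
          using IH(1)[of a' b] ab by simp
      qed
    qed
  next
    assume "\<forall>a b. a + b = Suc q \<longrightarrow> ?mon a b * w \<in> Z"
    then show "w \<in> (colon ^^ Suc q) Z"
      unfolding funpow.simps o_apply colon_iff Suc.IH shift by simp
  qed
qed simp

lemma subspace_funpow_colon:
  "mpoly.subspace Z \<Longrightarrow> mpoly.subspace ((colon ^^ q) Z :: (nat, 'k::field) mpoly set)"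
  by (induction q) (simp_all add: subspace_colon)

lemma finitely_supported_funpow_colon:
  "finitely_supported Z \<Longrightarrow> finitely_supported ((colon ^^ q) Z)"
  by (induction q) (simp_all add: finitely_supported_colon)

text \<open>Multiplication by \<open>x\<^sub>1\<^sup>q\<close> embeds the iterated colon space into \<open>Z\<close>.\<close>

lemma dim_funpow_colon_le:
  fixes Z :: "(nat, 'k::field) mpoly set"
  assumes Z: "mpoly.subspace Z" "finitely_supported Z"
  shows "mpoly.dim ((colon ^^ q) Z) \<le> mpoly.dim Z"
proof (rule dim_le_of_injective[where T = "(*) (single (single 0 q) 1)"])
  fix w assume "w \<in> (colon ^^ q) Z"
  then show "single (single 0 q) 1 * w \<in> Z"
    using funpow_colon_iff[of w q Z] by (auto dest: spec[of _ q])
qed (use Z in \<open>auto simp: subspace_funpow_colon finitely_supported_funpow_colon distrib_left mult.left_commute\<close>)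

text \<open>A nonzero \<open>w\<close> in the iterated colon space yields the \<open>q + 1\<close> elements \<open>x\<^sub>1\<^sup>a x\<^sub>2\<^sup>b w\<close> of \<open>Z\<close>, which have
  different leading exponents.\<close>

lemma funpow_colon_trivial:
  fixes Z :: "(nat, 'k::field) mpoly set"
  assumes Z: "mpoly.subspace Z" "finitely_supported Z" and q: "mpoly.dim Z \<le> q"
  shows "(colon ^^ q) Z \<subseteq> {0}"
proof (rule ccontr)
  assume "\<not> ?thesis"
  then obtain w where w: "w \<in> (colon ^^ q) Z" "w \<noteq> 0"
    by blast
  let ?e = "\<lambda>a. single 0 a + single (1::nat) (q - a)"
  have mem: "?e a + leading_exponent w \<in> leads Z" if "a \<le> q" for a
  proof -
    have "single (?e a) 1 * w \<in> Z"
      using w(1) that unfolding funpow_colon_iff by simp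
    then show ?thesis
      using w(2) leading_exponent_monomial_mult[OF w(2), of "?e a"] unfolding leads_def
      by (metis (no_types, lifting) DiffI image_eqI monomial_mult_eq_0 singletonD)
  qed
  have "inj_on (\<lambda>a. ?e a + leading_exponent w) {..q}"
  proof (rule inj_onI)
    fix a b assume "?e a + leading_exponent w = ?e b + leading_exponent w"
    then have "lookup (?e a) 0 = lookup (?e b) 0"
      by simp
    then show "a = b"
      by (simp add: lookup_add lookup_single)
  qed
  then have "card {..q} \<le> card (leads Z)"
    using mem finite_leads[OF Z(2)] by (intro card_inj_on_le[where f = "\<lambda>a. ?e a + leading_exponent w"]) auto
  then show False
    using q dim_eq_card_leads[OF Z] by simp
qed


section \<open>Substitution homomorphisms and linear changes of coordinates\<close>

text \<open>Exponents such as \<open>single i 1\<close> should keep this shape under simplification.\<close>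

declare One_nat_def [simp del]

definition eval_monom :: "('i \<Rightarrow> 'r::comm_ring_1) \<Rightarrow> ('i \<Rightarrow>\<^sub>0 nat) \<Rightarrow> 'r" where
  "eval_monom a m = (\<Prod>i\<in>keys m. a i ^ lookup m i)"

lemma eval_monom_superset:
  assumes "finite A" "keys m \<subseteq> A"
  shows "eval_monom a m = (\<Prod>i\<in>A. a i ^ lookup m i)"
  unfolding eval_monom_def using assms by (intro prod.mono_neutral_left) (auto simp: in_keys_iff)

lemma eval_monom_add: "eval_monom a (m + m') = eval_monom a m * eval_monom a m'"
proof -
  have "keys (m + m') \<subseteq> keys m \<union> keys m'"
    by (rule Poly_Mapping.keys_add)
  then show ?thesis
    by (simp add: eval_monom_superset[of "keys m \<union> keys m'"] lookup_add power_add prod.distrib)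
qed

lemma eval_monom_0 [simp]: "eval_monom a 0 = 1"
  by (simp add: eval_monom_def)

lemma eval_monom_single [simp]: "eval_monom a (single i e) = a i ^ e"
  by (simp add: eval_monom_def)

lemma insertion_superset:
  assumes "h 0 = 0" "finite A" "keys p \<subseteq> A"
  shows "insertion h a p = (\<Sum>m\<in>A. h (lookup p m) * eval_monom a m)"
  unfolding insertion_def eval_monom_def[symmetric]
  using assms by (intro sum.mono_neutral_left) (auto simp: in_keys_iff)

lemma insertion_single:
  assumes "h 0 = 0"
  shows "insertion h a (single m c) = h c * eval_monom a m"
  using insertion_superset[of h "{m}" "single m c" a] assms by simp

lemma comm_ring_hom_insertion:
  fixes h :: "'k::comm_ring_1 \<Rightarrow> 'r::comm_ring_1"
  assumes "comm_ring_hom h"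
  shows "comm_ring_hom (insertion h a :: ('i, 'k) mpoly \<Rightarrow> 'r)"
proof -
  interpret h: comm_ring_hom h by fact
  have add: "insertion h a (p + q) = insertion h a p + insertion h a q" for p q :: "('i, 'k) mpoly"
  proof -
    have "keys (p + q) \<subseteq> keys p \<union> keys q"
      by (rule Poly_Mapping.keys_add)
    then show ?thesis
      by (simp add: insertion_superset[of h "keys p \<union> keys q"] lookup_add h.hom_add sum.distrib distrib_right)
  qed
  have sum: "insertion h a (sum f A) = (\<Sum>x\<in>A. insertion h a (f x))" for f :: "'x \<Rightarrow> ('i, 'k) mpoly" and A
    by (induction A rule: infinite_finite_induct) (simp_all add: add, simp_all add: insertion_def)
  have "insertion h a (p * q) = insertion h a p * insertion h a q" for p q :: "('i, 'k) mpoly"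
  proof -
    have "p * q = (\<Sum>m\<in>keys p. single m (lookup p m)) * (\<Sum>m\<in>keys q. single m (lookup q m))"
      using poly_as_sum[of "keys p" p] poly_as_sum[of "keys q" q] by simp
    also have "\<dots> = (\<Sum>m\<in>keys p. \<Sum>m'\<in>keys q. single (m + m') (lookup p m * lookup q m'))"
      by (simp add: sum_product mult_single)
    finally have "insertion h a (p * q) =
        (\<Sum>m\<in>keys p. \<Sum>m'\<in>keys q. h (lookup p m) * h (lookup q m') * (eval_monom a m * eval_monom a m'))"
      by (simp add: sum insertion_single h.hom_mult eval_monom_add)
    also have "\<dots> = insertion h a p * insertion h a q"
      by (simp add: insertion_superset[of h "keys p"] insertion_superset[of h "keys q"] sum_product ac_simps)
    finally show ?thesis .
  qed
  moreover have "insertion h a 0 = 0" "insertion h a (1 :: ('i, 'k) mpoly) = 1"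
    using insertion_single[of h a 0 1] by (simp_all add: insertion_def)
  ultimately show ?thesis
    by unfold_locales (simp_all add: add)
qed

lemma monomial_eq_prod:
  "single m (c :: 'k::comm_ring_1) = single 0 c * eval_monom (\<lambda>i. single (single i 1) 1) m"
proof -
  have pow: "single (single i 1) 1 ^ e = single (single i e) (1 :: 'k)" for i :: 'a and e
    by (induction e) (simp_all add: mult_single single_add[symmetric] One_nat_def)
  have "eval_monom (\<lambda>i. single (single i 1) (1::'k)) m = single (\<Sum>i\<in>keys m. single i (lookup m i)) 1"
  proof -
    have "(\<Prod>i\<in>A. single (single i (lookup m i)) (1::'k)) = single (\<Sum>i\<in>A. single i (lookup m i)) 1" for A
      by (induction A rule: infinite_finite_induct) (simp_all add: mult_single)
    then show ?thesis
      by (simp add: eval_monom_def pow)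
  qed
  also have "(\<Sum>i\<in>keys m. single i (lookup m i)) = m"
    by (rule poly_mapping_eqI) (auto simp: lookup_sum lookup_single when_def in_keys_iff sum.delta)
  finally show ?thesis
    by (simp add: mult_single)
qed

text \<open>The universal property of the polynomial ring. It turns identities between composed substitutions
  into a comparison on constants and variables.\<close>

lemma hom_eq_insertion:
  fixes \<phi> :: "('i, 'k::comm_ring_1) mpoly \<Rightarrow> 'r::comm_ring_1"
  assumes "comm_ring_hom \<phi>"
  shows "\<phi> p = insertion (\<lambda>c. \<phi> (single 0 c)) (\<lambda>i. \<phi> (single (single i 1) 1)) p"
proof -
  interpret comm_ring_hom \<phi> by fact
  have "\<phi> p = \<phi> (\<Sum>m\<in>keys p. single m (lookup p m))"
    using poly_as_sum[of "keys p" p] by simp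
  also have "\<dots> = (\<Sum>m\<in>keys p. \<phi> (single 0 (lookup p m)) * eval_monom (\<lambda>i. \<phi> (single (single i 1) 1)) m)"
    unfolding hom_sum
    by (subst monomial_eq_prod) (simp add: hom_mult eval_monom_def hom_prod hom_power)
  finally show ?thesis
    unfolding insertion_def eval_monom_def .
qed

lemma insertion_cong:
  assumes "p \<in> polys V" "\<And>i. i \<in> V \<Longrightarrow> a i = b i"
  shows "insertion h a p = insertion h b p"
  unfolding insertion_def
proof (intro sum.cong refl arg_cong2[where f = "(*)"] prod.cong)
  fix m i assume "m \<in> keys p" "i \<in> keys m"
  then have "i \<in> V"
    using assms(1) by (auto simp: polys_def)
  then show "a i ^ lookup m i = b i ^ lookup m i"
    using assms(2) by simp
qed

lemma homs_eq_on_polys: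
  assumes "comm_ring_hom \<phi>" "comm_ring_hom \<psi>" "p \<in> polys V"
    and "\<And>c. \<phi> (single 0 c) = \<psi> (single 0 c)" "\<And>i. i \<in> V \<Longrightarrow> \<phi> (single (single i 1) 1) = \<psi> (single (single i 1) 1)"
  shows "\<phi> p = \<psi> p"
  unfolding hom_eq_insertion[OF assms(1), of p] hom_eq_insertion[OF assms(2), of p] assms(4)
  by (rule insertion_cong[OF assms(3,5)])

lemma comm_ring_hom_const: "comm_ring_hom (single 0 :: 'k::comm_ring_1 \<Rightarrow> ('i, 'k) mpoly)"
  by unfold_locales (simp_all add: single_add mult_single)

definition linear_form :: "nat \<Rightarrow> 'k::comm_ring_1 mat \<Rightarrow> nat \<Rightarrow> (nat, 'k) mpoly" where
  "linear_form n \<sigma> j = (\<Sum>i<n. single (single i 1) (\<sigma> $$ (i, j)))"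

lemma linear_change_eq: "linear_change n \<sigma> = insertion (single 0) (linear_form n \<sigma>)"
  unfolding linear_change_def linear_form_def ..

lemma comm_ring_hom_linear_change: "comm_ring_hom (linear_change n \<sigma>)"
  unfolding linear_change_eq by (rule comm_ring_hom_insertion[OF comm_ring_hom_const])

interpretation linear_change: comm_ring_hom "linear_change n \<sigma>" for n \<sigma>
  by (rule comm_ring_hom_linear_change)

lemma linear_change_const [simp]: "linear_change n \<sigma> (single 0 c) = single 0 c"
  unfolding linear_change_eq by (subst insertion_single) simp_all

lemma linear_change_Var [simp]: "linear_change n \<sigma> (Var j) = linear_form n \<sigma> j"
  unfolding linear_change_eq by (subst insertion_single) simp_all

lemma linear_change_mult_const: "linear_change n \<sigma> (single 0 c * p) = single 0 c * linear_change n \<sigma> p"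
  by (simp add: linear_change.hom_mult)

lemma linear_change_compose:
  assumes "\<sigma> \<in> carrier_mat n n" "\<tau> \<in> carrier_mat n n" "p \<in> polys {..<n}"
  shows "linear_change n \<tau> (linear_change n \<sigma> p) = linear_change n (\<tau> * \<sigma>) p"
proof (rule homs_eq_on_polys[OF _ comm_ring_hom_linear_change assms(3)])
  show "comm_ring_hom (\<lambda>p. linear_change n \<tau> (linear_change n \<sigma> p))"
    by unfold_locales (simp_all add: linear_change.hom_add linear_change.hom_mult)
  show "linear_change n \<tau> (linear_change n \<sigma> (single 0 c)) = linear_change n (\<tau> * \<sigma>) (single 0 c)" for c
    by simp
  fix j assume j: "j \<in> {..<n}"
  have single_eq: "single (single i 1) c = single 0 c * Var i" for i :: nat and c :: 'a
    by (simp add: mult_single)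
  have "linear_change n \<tau> (linear_change n \<sigma> (Var j)) =
      (\<Sum>i<n. single 0 (\<sigma> $$ (i, j)) * (\<Sum>k<n. single (single k 1) (\<tau> $$ (k, i))))"
    unfolding linear_change_Var unfolding linear_form_def linear_change.hom_sum
    by (subst single_eq) (simp add: linear_change_mult_const linear_form_def)
  also have "\<dots> = (\<Sum>i<n. \<Sum>k<n. single (single k 1) (\<sigma> $$ (i, j) * \<tau> $$ (k, i)))"
    by (simp add: sum_distrib_left mult_single)
  also have "\<dots> = (\<Sum>k<n. single (single k 1) (\<Sum>i<n. \<sigma> $$ (i, j) * \<tau> $$ (k, i)))"
  proof (subst sum.swap, rule sum.cong[OF refl])
    fix k
    show "(\<Sum>i<n. single (single k 1) (\<sigma> $$ (i, j) * \<tau> $$ (k, i))) =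
        single (single k 1) (\<Sum>i<n. \<sigma> $$ (i, j) * \<tau> $$ (k, i))"
      by (rule poly_mapping_eqI) (simp add: lookup_sum lookup_single when_def)
  qed
  also have "\<dots> = (\<Sum>k<n. single (single k 1) ((\<tau> * \<sigma>) $$ (k, j)))"
  proof (intro sum.cong refl)
    fix k assume "k \<in> {..<n}"
    then have "(\<tau> * \<sigma>) $$ (k, j) = (\<Sum>i<n. \<sigma> $$ (i, j) * \<tau> $$ (k, i))"
      using assms(1,2) j by (auto simp: scalar_prod_def lessThan_atLeast0 intro!: sum.cong)
    then show "single (single k 1) (\<Sum>i<n. \<sigma> $$ (i, j) * \<tau> $$ (k, i)) =
        single (single k 1) ((\<tau> * \<sigma>) $$ (k, j))"
      by simp
  qed
  also have "\<dots> = linear_change n (\<tau> * \<sigma>) (Var j)"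
    by (simp add: linear_form_def)
  finally show "linear_change n \<tau> (linear_change n \<sigma> (Var j)) = linear_change n (\<tau> * \<sigma>) (Var j)" .
qed

lemma linear_change_one:
  assumes "p \<in> polys {..<n}"
  shows "linear_change n (1\<^sub>m n) p = p"
proof (rule homs_eq_on_polys[OF comm_ring_hom_linear_change _ assms])
  show "comm_ring_hom (\<lambda>p :: (nat, 'a) mpoly. p)"
    by unfold_locales simp_all
  fix j assume j: "j \<in> {..<n}"
  have "linear_form n (1\<^sub>m n) j = (\<Sum>i<n. if i = j then Var j else 0)"
    using j unfolding linear_form_def by (intro sum.cong) auto
  then show "linear_change n (1\<^sub>m n) (Var j) = Var j"
    using j by simp
qed simp

lemma GL_inverse:
  assumes "\<sigma> \<in> GL n"
  obtains \<tau> where "\<tau> \<in> carrier_mat n n" "\<tau> * \<sigma> = 1\<^sub>m n" "\<sigma> * \<tau> = 1\<^sub>m n"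
proof -
  have \<sigma>: "\<sigma> \<in> carrier_mat n n"
    using assms by (simp add: GL_def)
  from assms obtain \<tau> where \<tau>: "\<sigma> * \<tau> = 1\<^sub>m (dim_row \<sigma>)" "\<tau> * \<sigma> = 1\<^sub>m (dim_row \<tau>)"
    unfolding GL_def invertible_mat_def inverts_mat_def by blast
  have "dim_row \<tau> = n"
    using arg_cong[OF \<tau>(2), of dim_col] \<sigma> by simp
  moreover have "dim_col \<tau> = n"
    using arg_cong[OF \<tau>(1), of dim_col] \<sigma> by simp
  ultimately show ?thesis
    using that[of \<tau>] \<tau> \<sigma> by auto
qed

lemma GL_iff_det: "\<sigma> \<in> GL n \<longleftrightarrow> \<sigma> \<in> carrier_mat n n \<and> det (\<sigma> :: 'k::field mat) \<noteq> 0"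
proof
  assume \<sigma>: "\<sigma> \<in> GL n"
  then have c: "\<sigma> \<in> carrier_mat n n"
    by (simp add: GL_def)
  obtain \<tau> where \<tau>: "\<tau> \<in> carrier_mat n n" "\<tau> * \<sigma> = 1\<^sub>m n"
    using GL_inverse[OF \<sigma>] by blast
  have "det \<tau> * det \<sigma> = 1"
    using det_mult[OF \<tau>(1) c] \<tau>(2) by simp
  then show "\<sigma> \<in> carrier_mat n n \<and> det \<sigma> \<noteq> 0"
    using c by auto
next
  assume \<sigma>: "\<sigma> \<in> carrier_mat n n \<and> det \<sigma> \<noteq> 0"
  then have "\<sigma> \<in> Units (ring_mat TYPE('k) n ())"
    by (intro det_non_zero_imp_unit) auto
  then obtain \<tau> where "\<tau> \<in> carrier_mat n n" "\<tau> * \<sigma> = 1\<^sub>m n" "\<sigma> * \<tau> = 1\<^sub>m n"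
    unfolding Units_def ring_mat_def by auto
  then show "\<sigma> \<in> GL n"
    using \<sigma> by (auto simp: GL_def invertible_mat_def inverts_mat_def)
qed

section \<open>Forms of a fixed degree\<close>

definition monoms :: "nat \<Rightarrow> nat \<Rightarrow> exponent set" where
  "monoms n d = {m. keys m \<subseteq> {..<n} \<and> mdeg m = d}"

lemma carrier_R [simp]: "carrier (R n) = polys {..<n}"
  by (simp add: poly_ring_def)

lemma forms_iff: "p \<in> forms n d \<longleftrightarrow> keys p \<subseteq> monoms n d"
  by (auto simp: forms_def polys_def monoms_def)

lemma finite_monoms [simp]: "finite (monoms n d)"
  by (rule finite_subset[OF _ exponents_bounded(1)[of "{..<n}" d]]) (auto simp: monoms_def)

lemma monoms_add: "a \<in> monoms n d \<Longrightarrow> b \<in> monoms n e \<Longrightarrow> a + b \<in> monoms n (d + e)"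
  using Poly_Mapping.keys_add[of a b] by (auto simp: monoms_def)

lemma finitely_supported_forms: "X \<subseteq> forms n d \<Longrightarrow> finitely_supported X"
  unfolding finitely_supported_def
proof (intro exI[of _ "monoms n d"] conjI ballI)
  fix f assume "X \<subseteq> forms n d" "f \<in> X"
  then have "f \<in> forms n d"
    by blast
  then show "keys f \<subseteq> monoms n d"
    by (simp add: forms_iff)
qed simp

lemma subspace_forms: "mpoly.subspace (forms n d :: (nat, 'k::field) mpoly set)"
  by (rule subspaceI) (auto simp: forms_iff in_keys_iff lookup_add subset_eq)

lemma forms_mult:
  "p \<in> forms n d \<Longrightarrow> q \<in> forms n e \<Longrightarrow> p * q \<in> forms n (d + e)"
  using keys_mult[of p q] monoms_add unfolding forms_iff by fastforce

lemma forms_const: "single 0 c \<in> forms n 0"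
  by (auto simp: forms_iff monoms_def)

lemma forms_power: "p \<in> forms n d \<Longrightarrow> p ^ e \<in> forms n (d * e)"
  using forms_const[of 1 n] by (induction e) (auto simp: forms_mult)

lemma forms_prod:
  "(\<And>i. i \<in> A \<Longrightarrow> f i \<in> forms n (g i)) \<Longrightarrow> (\<Prod>i\<in>A. f i) \<in> forms n (\<Sum>i\<in>A. g i)"
  using forms_const[of 1 n] by (induction A rule: infinite_finite_induct) (auto simp: forms_mult)

lemma forms_linear_form: "linear_form n \<sigma> j \<in> forms n 1"
proof -
  have "keys (linear_form n \<sigma> j) \<subseteq> (\<Union>i\<in>{..<n}. keys (single (single i 1) (\<sigma> $$ (i, j))))"
    unfolding linear_form_def by (rule keys_sum)
  also have "\<dots> \<subseteq> monoms n 1"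
    by (auto simp: monoms_def split: if_splits)
  finally show ?thesis
    by (simp add: forms_iff)
qed

lemma linear_change_forms:
  fixes p :: "(nat, 'k::field) mpoly"
  assumes "p \<in> forms n d"
  shows "linear_change n \<sigma> p \<in> forms n d"
  unfolding linear_change_eq insertion_def
proof (rule subspace_closed(5)[OF subspace_forms])
  fix m assume "m \<in> keys p"
  then have m: "mdeg m = d"
    using assms by (auto simp: forms_iff monoms_def)
  have "(\<Prod>i\<in>keys m. linear_form n \<sigma> i ^ lookup m i) \<in> forms n (\<Sum>i\<in>keys m. 1 * lookup m i)"
    by (intro forms_prod forms_power forms_linear_form)
  then have "(\<Prod>i\<in>keys m. linear_form n \<sigma> i ^ lookup m i) \<in> forms n d"
    using m by (simp add: mdeg_def)
  then show "single 0 (lookup p m) * (\<Prod>i\<in>keys m. linear_form n \<sigma> i ^ lookup m i) \<in> forms n d"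
    by (rule subspace_closed(4)[OF subspace_forms])
qed

lemma polys_iff: "p \<in> polys V \<longleftrightarrow> (\<forall>m\<in>keys p. keys m \<subseteq> V)"
  by (simp add: polys_def)

lemma forms_subset_polys: "forms n d \<subseteq> polys {..<n}"
  by (auto simp: forms_def)

lemma polys_add: "(p :: ('i, 'k::comm_ring_1) mpoly) \<in> polys V \<Longrightarrow> q \<in> polys V \<Longrightarrow> p + q \<in> polys V"
  using cring_poly_ring[of V] cring.cring_simprules(1)[of "poly_ring V" p q] by (simp add: poly_ring_def)

lemma polys_mult: "(p :: ('i, 'k::comm_ring_1) mpoly) \<in> polys V \<Longrightarrow> q \<in> polys V \<Longrightarrow> p * q \<in> polys V"
  using cring_poly_ring[of V] cring.cring_simprules(5)[of "poly_ring V" p q] by (simp add: poly_ring_def)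

lemma polys_const [simp]: "single 0 c \<in> polys V"
  by (auto simp: polys_iff)

lemma polys_sum: "(\<And>i. i \<in> A \<Longrightarrow> f i \<in> polys V) \<Longrightarrow> sum f A \<in> (polys V :: ('i, 'k::comm_ring_1) mpoly set)"
  by (induction A rule: infinite_finite_induct) (auto intro: polys_add simp: polys_iff[of 0])

lemma polys_prod: "(\<And>i. i \<in> A \<Longrightarrow> f i \<in> polys V) \<Longrightarrow> prod f A \<in> (polys V :: ('i, 'k::comm_ring_1) mpoly set)"
  using polys_const[of "1 :: 'k" V] by (induction A rule: infinite_finite_induct) (auto intro: polys_mult)

lemma polys_power: "(p :: ('i, 'k::comm_ring_1) mpoly) \<in> polys V \<Longrightarrow> p ^ e \<in> polys V"
  using polys_const[of "1 :: 'k" V] by (induction e) (auto intro: polys_mult)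

lemma linear_change_polys: "linear_change n \<sigma> p \<in> polys {..<n}"
proof -
  have "linear_form n \<sigma> i \<in> polys {..<n}" for i
    using forms_linear_form forms_subset_polys by blast
  then show ?thesis
    unfolding linear_change_eq insertion_def
    by (intro polys_sum polys_mult polys_prod polys_power polys_const)
qed


section \<open>Linear independence is an open condition\<close>

text \<open>Abstract rings of functions on a parameter set. They are used for polynomial functions of a matrix
  and for polynomial functions of one scalar.\<close>

definition function_ring :: "('s \<Rightarrow> 'k::comm_ring_1) set \<Rightarrow> bool" where
  "function_ring P \<longleftrightarrow> (\<forall>c. (\<lambda>_. c) \<in> P) \<and>
     (\<forall>f\<in>P. \<forall>g\<in>P. (\<lambda>s. f s + g s) \<in> P \<and> (\<lambda>s. f s * g s) \<in> P)"

lemma function_ring_closed: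
  assumes "function_ring P"
  shows "(\<lambda>_. c) \<in> P" "f \<in> P \<Longrightarrow> g \<in> P \<Longrightarrow> (\<lambda>s. f s + g s) \<in> P"
    "f \<in> P \<Longrightarrow> g \<in> P \<Longrightarrow> (\<lambda>s. f s * g s) \<in> P"
  using assms by (auto simp: function_ring_def)

lemma function_ring_diff:
  assumes "function_ring P" "f \<in> P" "g \<in> P"
  shows "(\<lambda>s. f s - g s) \<in> P"
proof -
  have "(\<lambda>s. f s + (- 1) * g s) \<in> P"
    by (intro function_ring_closed[OF assms(1)] assms(2,3))
  then show ?thesis
    by simp
qed

lemma function_ring_sum:
  assumes "function_ring P" "\<And>i. i \<in> A \<Longrightarrow> f i \<in> P"
  shows "(\<lambda>s. \<Sum>i\<in>A. f i s) \<in> P"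
  using assms(2)
  by (induction A rule: infinite_finite_induct) (auto intro: function_ring_closed[OF assms(1)])

lemma function_ring_prod:
  assumes "function_ring P" "\<And>i. i \<in> A \<Longrightarrow> f i \<in> P"
  shows "(\<lambda>s. \<Prod>i\<in>A. f i s) \<in> P"
  using assms(2)
  by (induction A rule: infinite_finite_induct) (auto intro: function_ring_closed[OF assms(1)])

text \<open>One elimination step that avoids division: clear the coefficient at \<open>m\<close> with the pivot \<open>v x\<close>. Polynomial
  dependence on parameters is preserved.\<close>

lemma lin_indep_insert_iff:
  fixes v :: "'i \<Rightarrow> (nat, 'k::field) mpoly"
  assumes "finite F" "x \<notin> F" "lookup (v x) m \<noteq> 0"
  shows "lin_indep (insert x F) v \<longleftrightarrow>
    lin_indep F (\<lambda>i. single 0 (lookup (v x) m) * v i - single 0 (lookup (v i) m) * v x)"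
    (is "_ \<longleftrightarrow> lin_indep F ?w")
proof -
  define a where "a = lookup (v x) m"
  have a: "a \<noteq> 0"
    using assms(3) by (simp add: a_def)
  have sum_w: "(\<Sum>i\<in>F. single 0 (c i) * ?w i) =
      single 0 a * (\<Sum>i\<in>F. single 0 (c i) * v i) - single 0 (\<Sum>i\<in>F. c i * lookup (v i) m) * v x" for c
  proof -
    have "single 0 (\<Sum>i\<in>F. c i * lookup (v i) m) = (\<Sum>i\<in>F. single 0 (c i) * single 0 (lookup (v i) m) :: (nat, 'k) mpoly)"
      using assms(1) by (induction F rule: finite_induct) (simp_all add: single_add mult_single)
    then show ?thesis
      by (simp add: right_diff_distrib sum_subtractf sum_distrib_left sum_distrib_right a_def ac_simps)
  qed
  show ?thesis
  proof
    assume ind: "lin_indep (insert x F) v"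
    show "lin_indep F ?w"
      unfolding lin_indep_def
    proof (intro allI impI ballI)
      fix c i assume c: "(\<Sum>i\<in>F. single 0 (c i) * ?w i) = 0" and i: "i \<in> F"
      let ?d = "\<lambda>i. if i = x then - (\<Sum>i\<in>F. c i * lookup (v i) m) else a * c i"
      have "(\<Sum>i\<in>F. single 0 (?d i) * v i) = single 0 a * (\<Sum>i\<in>F. single 0 (c i) * v i)"
        unfolding sum_distrib_left using assms(2)
        by (intro sum.cong) (auto simp: mult.assoc[symmetric] mult_single)
      then have "(\<Sum>i\<in>insert x F. single 0 (?d i) * v i) = 0"
        using c[unfolded sum_w] assms(1,2) by (simp add: single_uminus)
      then have "?d i = 0"
        using lin_indepD[OF ind, of ?d i] i by blast
      moreover have "i \<noteq> x"
        using i assms(2) by blast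
      ultimately show "c i = 0"
        using a by simp
    qed
  next
    assume ind: "lin_indep F ?w"
    show "lin_indep (insert x F) v"
      unfolding lin_indep_def
    proof (intro allI impI)
      fix c assume c: "(\<Sum>i\<in>insert x F. single 0 (c i) * v i) = 0"
      then have "single 0 (c x) * v x + (\<Sum>i\<in>F. single 0 (c i) * v i) = 0"
        using assms(1,2) by simp
      then have cx: "(\<Sum>i\<in>F. single 0 (c i) * v i) = - (single 0 (c x) * v x)"
        by (rule add_eq_0_iff[THEN iffD1])
      have "lookup (\<Sum>i\<in>F. single 0 (c i) * v i) m = (\<Sum>i\<in>F. c i * lookup (v i) m)"
        by (simp add: lookup_sum)
      then have e: "(\<Sum>i\<in>F. c i * lookup (v i) m) = - (c x * a)"
        unfolding cx by (simp add: a_def)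
      have "single 0 (- (c x * a)) = - (single 0 a * single 0 (c x) :: (nat, 'k) mpoly)"
        by (simp add: single_uminus mult_single mult.commute)
      then have "(\<Sum>i\<in>F. single 0 (c i) * ?w i) = 0"
        unfolding sum_w cx e by (simp add: mult.assoc)
      then have F0: "\<forall>i\<in>F. c i = 0"
        using ind unfolding lin_indep_def by blast
      then have "single 0 (c x) * v x = 0"
        using cx by simp
      then have "c x = 0"
        using a by (auto simp: a_def)
      then show "\<forall>i\<in>insert x F. c i = 0"
        using F0 by simp
    qed
  qed
qed

text \<open>Eliminate with pivots that are nonzero at \<open>s0\<close>. The elimination still works wherever all of these
  pivots are nonzero, so \<open>h\<close> is their product.\<close>

lemma lin_indep_open:
  fixes v :: "'s \<Rightarrow> 'i \<Rightarrow> (nat, 'k::field) mpoly"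
  assumes P: "function_ring P" and "finite A"
    and "\<And>i m. i \<in> A \<Longrightarrow> (\<lambda>s. lookup (v s i) m) \<in> P" and "lin_indep A (v s0)"
  shows "\<exists>h\<in>P. h s0 \<noteq> 0 \<and> (\<forall>s. h s \<noteq> 0 \<longrightarrow> lin_indep A (v s))"
  using assms(2-)
proof (induction A arbitrary: v rule: finite_induct)
  case empty
  then show ?case
    by (intro bexI[of _ "\<lambda>_. 1"]) (auto intro: function_ring_closed[OF P] simp: lin_indep_def)
next
  case (insert x F)
  have "v s0 x \<noteq> 0"
  proof
    assume "v s0 x = 0"
    then have "(\<Sum>i\<in>insert x F. single 0 (if i = x then 1 else 0) * v s0 i) = 0"
      by (intro sum.neutral) auto
    then have "(if x = x then 1 else 0) = (0 :: 'k)"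
      using lin_indepD[OF insert.prems(2), of "\<lambda>i. if i = x then 1 else 0" x] by simp
    then show False
      by simp
  qed
  then obtain m where m: "lookup (v s0 x) m \<noteq> 0"
    by (metis leading_exponent_in_keys in_keys_iff)
  define w where "w = (\<lambda>s i. single 0 (lookup (v s x) m) * v s i - single 0 (lookup (v s i) m) * v s x)"
  have "lin_indep F (w s0)"
    using insert.prems(2) lin_indep_insert_iff[where v = "v s0", OF insert.hyps m] by (simp add: w_def)
  moreover have "(\<lambda>s. lookup (w s i) m') \<in> P" if "i \<in> F" for i m'
    using insert.prems(1) that
    by (auto simp: w_def lookup_minus intro!: function_ring_diff[OF P] function_ring_closed(3)[OF P])
  ultimately obtain h where h: "h \<in> P" "h s0 \<noteq> 0" "\<forall>s. h s \<noteq> 0 \<longrightarrow> lin_indep F (w s)"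
    using insert.IH[of w] by blast
  show ?case
  proof (intro bexI[of _ "\<lambda>s. h s * lookup (v s x) m"] conjI allI impI)
    fix s assume "h s * lookup (v s x) m \<noteq> 0"
    then have "lookup (v s x) m \<noteq> 0" "lin_indep F (w s)"
      using h(3) by auto
    then show "lin_indep (insert x F) (v s)"
      using lin_indep_insert_iff[where v = "v s", OF insert.hyps] by (simp add: w_def)
  next
    show "(\<lambda>s. h s * lookup (v s x) m) \<in> P"
      using h(1) insert.prems(1) by (intro function_ring_closed(3)[OF P]) auto
  qed (use h(2) m in simp)
qed

text \<open>A polynomial depending on parameters. The common finite support is what makes the coefficients of a
  product finite sums of products.\<close>

definition poly_family :: "('s \<Rightarrow> 'k::comm_ring_1) set \<Rightarrow> ('s \<Rightarrow> (nat, 'k) mpoly) \<Rightarrow> bool" where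
  "poly_family P F \<longleftrightarrow> (\<exists>M. finite M \<and> (\<forall>s. keys (F s) \<subseteq> M)) \<and> (\<forall>m. (\<lambda>s. lookup (F s) m) \<in> P)"

lemma poly_family_single:
  assumes "function_ring P" "f \<in> P"
  shows "poly_family P (\<lambda>s. single m (f s))"
proof -
  have "(\<lambda>s. lookup (single m (f s)) m') \<in> P" for m'
    using assms function_ring_closed(1)[OF assms(1), of 0] by (cases "m = m'") (simp_all add: lookup_single)
  moreover have "\<forall>s. keys (single m (f s)) \<subseteq> {m}"
    by simp
  ultimately show ?thesis
    unfolding poly_family_def by blast
qed

lemma poly_family_add:
  assumes P: "function_ring P" and "poly_family P F" "poly_family P G"
  shows "poly_family P (\<lambda>s. F s + G s)"
proof -
  obtain M N where M: "finite M" "\<forall>s. keys (F s) \<subseteq> M" and N: "finite N" "\<forall>s. keys (G s) \<subseteq> N"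
    using assms(2,3) unfolding poly_family_def by blast
  have "keys (F s + G s) \<subseteq> M \<union> N" for s
    using Poly_Mapping.keys_add[of "F s" "G s"] M(2)[rule_format, of s] N(2)[rule_format, of s] by blast
  moreover have "(\<lambda>s. lookup (F s + G s) m) \<in> P" for m
    using assms(2,3) unfolding poly_family_def lookup_add by (intro function_ring_closed(2)[OF P]) auto
  moreover have "finite (M \<union> N)"
    using M(1) N(1) by simp
  ultimately show ?thesis
    unfolding poly_family_def by blast
qed

lemma poly_family_mult:
  assumes P: "function_ring P" and F: "poly_family P F" and G: "poly_family P G"
  shows "poly_family P (\<lambda>s. F s * G s)"
proof -
  obtain M N where M: "finite M" "\<And>s. keys (F s) \<subseteq> M" and N: "finite N" "\<And>s. keys (G s) \<subseteq> N"
    using assms(2,3) unfolding poly_family_def by blast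
  have "keys (F s * G s) \<subseteq> (\<lambda>(a, b). a + b) ` (M \<times> N)" for s
    using keys_mult[of "F s" "G s"] M(2)[of s] N(2)[of s] by fastforce
  moreover have "(\<lambda>s. lookup (F s * G s) m) \<in> P" for m
  proof -
    have "(\<lambda>s. if m = a + b then lookup (F s) a * lookup (G s) b else 0) \<in> P" for a b
      using F G function_ring_closed(1)[OF P, of 0] unfolding poly_family_def
      by (cases "m = a + b") (auto intro: function_ring_closed(3)[OF P])
    then have "(\<lambda>s. \<Sum>a\<in>M. \<Sum>b\<in>N. if m = a + b then lookup (F s) a * lookup (G s) b else 0) \<in> P"
      by (intro function_ring_sum[OF P])
    then show ?thesis
      by (simp only: lookup_mult_finite[OF M(1) M(2) N(1) N(2)])
  qed
  moreover have "finite ((\<lambda>(a, b). a + b) ` (M \<times> N))"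
    using M(1) N(1) by simp
  ultimately show ?thesis
    unfolding poly_family_def by blast
qed

lemma poly_family_sum:
  assumes P: "function_ring P" and "\<And>i. i \<in> A \<Longrightarrow> poly_family P (F i)"
  shows "poly_family P (\<lambda>s. \<Sum>i\<in>A. F i s)"
proof -
  have zero: "poly_family P (\<lambda>s. 0)"
    using poly_family_single[OF P function_ring_closed(1)[OF P, of 0], of 0] by simp
  show ?thesis
    using assms(2)
    by (induction A rule: infinite_finite_induct) (simp_all add: zero poly_family_add[OF P])
qed

lemma poly_family_one: "function_ring P \<Longrightarrow> poly_family P (\<lambda>s. 1)"
  using poly_family_single[of P "\<lambda>_. 1" 0] function_ring_closed(1)[of P 1] by simp

lemma poly_family_prod:
  assumes P: "function_ring P" and "\<And>i. i \<in> A \<Longrightarrow> poly_family P (F i)"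
  shows "poly_family P (\<lambda>s. \<Prod>i\<in>A. F i s)"
  using assms(2)
  by (induction A rule: infinite_finite_induct) (simp_all add: poly_family_one[OF P] poly_family_mult[OF P])

lemma poly_family_power:
  assumes P: "function_ring P" and "poly_family P F"
  shows "poly_family P (\<lambda>s. F s ^ e)"
  using assms(2) by (induction e) (simp_all add: poly_family_one[OF P] poly_family_mult[OF P])

section \<open>Generic coordinates\<close>

text \<open>The functions whose nonvanishing loci form a base of the Zariski topology on matrices.\<close>

definition mat_funs :: "nat \<Rightarrow> ('k::comm_ring_1 mat \<Rightarrow> 'k) set" where
  "mat_funs n = {\<lambda>\<sigma>. insertion id (\<lambda>ij. \<sigma> $$ ij) p |p. p \<in> polys ({..<n} \<times> {..<n})}"

lemma comm_ring_hom_id: "comm_ring_hom (id :: 'k::comm_ring_1 \<Rightarrow> 'k)"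
  by unfold_locales simp_all

lemma function_ring_mat_funs: "function_ring (mat_funs n :: ('k::comm_ring_1 mat \<Rightarrow> 'k) set)"
proof -
  interpret comm_ring_hom "insertion id a :: ('i, 'k::comm_ring_1) mpoly \<Rightarrow> 'k" for a
    by (rule comm_ring_hom_insertion[OF comm_ring_hom_id])
  have const: "(\<lambda>_. c) \<in> mat_funs n" for c :: 'k
    unfolding mat_funs_def
    by (rule CollectI, rule exI[of _ "single 0 c"]) (simp add: insertion_single)
  have ops: "(\<lambda>s. f s + g s) \<in> mat_funs n" "(\<lambda>s. f s * g s) \<in> mat_funs n"
    if fg: "f \<in> mat_funs n" "g \<in> mat_funs n" for f g :: "'k mat \<Rightarrow> 'k"
  proof -
    obtain p q where pq: "p \<in> polys ({..<n} \<times> {..<n})" "q \<in> polys ({..<n} \<times> {..<n})"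
      "f = (\<lambda>\<sigma>. insertion id (\<lambda>ij. \<sigma> $$ ij) p)" "g = (\<lambda>\<sigma>. insertion id (\<lambda>ij. \<sigma> $$ ij) q)"
      using fg unfolding mat_funs_def by blast
    show "(\<lambda>s. f s + g s) \<in> mat_funs n"
      unfolding mat_funs_def
      by (rule CollectI, rule exI[of _ "p + q"]) (use pq in \<open>simp add: hom_add polys_add\<close>)
    show "(\<lambda>s. f s * g s) \<in> mat_funs n"
      unfolding mat_funs_def
      by (rule CollectI, rule exI[of _ "p * q"]) (use pq in \<open>simp add: hom_mult polys_mult\<close>)
  qed
  show ?thesis
    by (simp add: function_ring_def const ops)
qed

lemma entry_mat_funs: "i < n \<Longrightarrow> j < n \<Longrightarrow> (\<lambda>\<sigma>. \<sigma> $$ (i, j)) \<in> mat_funs n"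
  unfolding mat_funs_def
  by (rule CollectI, rule exI[of _ "single (single (i, j) 1) 1"]) (simp add: insertion_single polys_iff)

lemma poly_family_linear_change:
  assumes "f \<in> polys {..<n}"
  shows "poly_family (mat_funs n) (\<lambda>\<sigma>. linear_change n \<sigma> f)"
proof -
  note R = function_ring_mat_funs[of n]
  have form: "poly_family (mat_funs n) (\<lambda>\<sigma>. linear_form n \<sigma> j)" if "j < n" for j
    unfolding linear_form_def
  proof (rule poly_family_sum[OF R])
    fix i assume "i \<in> {..<n}"
    then have "(\<lambda>\<sigma>. \<sigma> $$ (i, j)) \<in> mat_funs n"
      using that by (intro entry_mat_funs) auto
    then show "poly_family (mat_funs n) (\<lambda>\<sigma>. single (single i 1) (\<sigma> $$ (i, j)))"
      by (rule poly_family_single[OF R])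
  qed
  have "poly_family (mat_funs n) (\<lambda>\<sigma>. single 0 (lookup f m) * (\<Prod>i\<in>keys m. linear_form n \<sigma> i ^ lookup m i))"
    if m: "m \<in> keys f" for m
  proof (rule poly_family_mult[OF R])
    show "poly_family (mat_funs n) (\<lambda>\<sigma>. single 0 (lookup f m))"
      by (rule poly_family_single[OF R function_ring_closed(1)[OF R]])
    show "poly_family (mat_funs n) (\<lambda>\<sigma>. \<Prod>i\<in>keys m. linear_form n \<sigma> i ^ lookup m i)"
    proof (rule poly_family_prod[OF R])
      fix i assume "i \<in> keys m"
      then have "i < n"
        using assms m by (auto simp: polys_iff)
      then show "poly_family (mat_funs n) (\<lambda>\<sigma>. linear_form n \<sigma> i ^ lookup m i)"
        by (rule poly_family_power[OF R form])
    qed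
  qed
  then show ?thesis
    unfolding linear_change_eq insertion_def by (rule poly_family_sum[OF R])
qed

definition poly_funs :: "('k::comm_ring_1 \<Rightarrow> 'k) set" where
  "poly_funs = range poly"

lemma function_ring_poly_funs: "function_ring (poly_funs :: ('k::comm_ring_1 \<Rightarrow> 'k) set)"
proof -
  have const: "(\<lambda>_. c) \<in> poly_funs" for c :: 'k
    unfolding poly_funs_def by (rule range_eqI[of _ _ "[:c:]"]) auto
  have ops: "(\<lambda>s. f s + g s) \<in> poly_funs" "(\<lambda>s. f s * g s) \<in> poly_funs"
    if fg: "f \<in> poly_funs" "g \<in> poly_funs" for f g :: "'k \<Rightarrow> 'k"
  proof -
    obtain p q where pq: "f = poly p" "g = poly q"
      using fg unfolding poly_funs_def by blast
    show "(\<lambda>s. f s + g s) \<in> poly_funs"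
      unfolding poly_funs_def pq by (rule range_eqI[of _ _ "p + q"]) auto
    show "(\<lambda>s. f s * g s) \<in> poly_funs"
      unfolding poly_funs_def pq by (rule range_eqI[of _ _ "p * q"]) auto
  qed
  show ?thesis
    by (simp add: function_ring_def const ops)
qed

lemma id_poly_funs: "(\<lambda>x. x) \<in> poly_funs"
  unfolding poly_funs_def by (rule range_eqI[of _ _ "[:0, 1:]"]) auto

lemma finite_zeros_poly_funs:
  assumes "f \<in> poly_funs" "f (x0 :: 'k::idom) \<noteq> 0"
  shows "finite {x. f x = 0}"
proof -
  obtain p where "f = poly p"
    using assms(1) unfolding poly_funs_def by blast
  moreover from this assms(2) have "p \<noteq> 0"
    by auto
  ultimately show ?thesis
    using poly_roots_finite[of p] by simp
qed

lemma power_poly_funs: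
  assumes "f \<in> poly_funs"
  shows "(\<lambda>x. f x ^ e) \<in> poly_funs"
  using assms
  by (induction e) (auto intro: function_ring_closed[OF function_ring_poly_funs])

text \<open>Along a path given by polynomials, membership in a basic open subset of \<open>GL n\<close> fails at the zeros of two
  polynomials in one variable only, one of them coming from the determinant.\<close>

lemma finite_exceptions_on_path:
  fixes path :: "'k::field \<Rightarrow> 'k mat"
  assumes c: "\<And>x. path x \<in> carrier_mat n n"
    and e: "\<And>i j. i < n \<Longrightarrow> j < n \<Longrightarrow> (\<lambda>x. path x $$ (i, j)) \<in> poly_funs"
    and h: "h \<in> mat_funs n" "h (path x0) \<noteq> 0" and G: "path x0 \<in> GL n"
  shows "finite {x. \<not> (path x \<in> GL n \<and> h (path x) \<noteq> 0)}"
proof -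
  note R = function_ring_poly_funs
  obtain p where p: "p \<in> polys ({..<n} \<times> {..<n})" "h = (\<lambda>\<sigma>. insertion id (\<lambda>ij. \<sigma> $$ ij) p)"
    using h(1) unfolding mat_funs_def by blast
  have "(\<lambda>x. path x $$ ij) \<in> poly_funs" if "m \<in> keys p" "ij \<in> keys m" for m ij
  proof -
    have "ij \<in> {..<n} \<times> {..<n}"
      using p(1) that unfolding polys_iff by blast
    then show ?thesis
      using e by (cases ij) simp
  qed
  then have "(\<lambda>x. h (path x)) \<in> poly_funs"
    unfolding p(2) insertion_def
    by (intro function_ring_sum[OF R] function_ring_closed(1,3)[OF R] function_ring_prod[OF R] power_poly_funs)
  then have f1: "finite {x. h (path x) = 0}"
    using h(2) finite_zeros_poly_funs by blast
  have "(\<lambda>x. det (path x)) \<in> poly_funs"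
  proof -
    have "(\<lambda>x. \<Prod>i = 0..<n. path x $$ (i, q i)) \<in> poly_funs" if "q permutes {0..<n}" for q
      using that permutes_in_image[OF that] by (intro function_ring_prod[OF R] e) auto
    then have "(\<lambda>x. \<Sum>q\<in>{q. q permutes {0..<n}}. signof q * (\<Prod>i = 0..<n. path x $$ (i, q i))) \<in> poly_funs"
      by (intro function_ring_sum[OF R] function_ring_closed(1,3)[OF R]) auto
    then show ?thesis
      by (simp add: det_def'[OF c])
  qed
  moreover have "det (path x0) \<noteq> 0"
    using G by (simp add: GL_iff_det)
  ultimately have f2: "finite {x. det (path x) = 0}"
    using finite_zeros_poly_funs by blast
  have "{x. \<not> (path x \<in> GL n \<and> h (path x) \<noteq> 0)} \<subseteq> {x. h (path x) = 0} \<union> {x. det (path x) = 0}"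
    using c by (auto simp: GL_iff_det)
  then show ?thesis
    using f1 f2 finite_subset by blast
qed

text \<open>Two nonempty open sets meet: on the straight path joining a point of one to a point of the other,
  each of the two sets misses finitely many parameters only.\<close>

lemma GL_irreducible:
  fixes h1 h2 :: "'k::field_char_0 mat \<Rightarrow> 'k"
  assumes h: "h1 \<in> mat_funs n" "h2 \<in> mat_funs n"
    and \<sigma>: "\<sigma>1 \<in> GL n" "h1 \<sigma>1 \<noteq> 0" "\<sigma>2 \<in> GL n" "h2 \<sigma>2 \<noteq> 0"
  shows "\<exists>\<sigma>\<in>GL n. h1 \<sigma> \<noteq> 0 \<and> h2 \<sigma> \<noteq> 0"
proof -
  have c: "\<sigma>1 \<in> carrier_mat n n" "\<sigma>2 \<in> carrier_mat n n"
    using \<sigma> by (auto simp: GL_def)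
  define path where "path = (\<lambda>x. mat n n (\<lambda>ij. \<sigma>1 $$ ij + x * (\<sigma>2 $$ ij - \<sigma>1 $$ ij)))"
  have "path 0 = \<sigma>1" "path 1 = \<sigma>2"
    using c by (auto simp: path_def)
  moreover have "(\<lambda>x. path x $$ (i, j)) \<in> poly_funs" if "i < n" "j < n" for i j
    using that
    by (auto simp: path_def intro!: function_ring_closed[OF function_ring_poly_funs] id_poly_funs)
  moreover have "path x \<in> carrier_mat n n" for x
    by (simp add: path_def)
  ultimately have "finite {x. \<not> (path x \<in> GL n \<and> h1 (path x) \<noteq> 0)}" "finite {x. \<not> (path x \<in> GL n \<and> h2 (path x) \<noteq> 0)}"
    using finite_exceptions_on_path[of path n h1 0] finite_exceptions_on_path[of path n h2 1] h \<sigma> by auto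
  then have "finite ({x. \<not> (path x \<in> GL n \<and> h1 (path x) \<noteq> 0)} \<union> {x. \<not> (path x \<in> GL n \<and> h2 (path x) \<noteq> 0)})"
    by simp
  then obtain x where "x \<notin> {x. \<not> (path x \<in> GL n \<and> h1 (path x) \<noteq> 0)} \<union> {x. \<not> (path x \<in> GL n \<and> h2 (path x) \<noteq> 0)}"
    using ex_new_if_finite[OF infinite_UNIV_char_0] by blast
  then show ?thesis
    by (intro bexI[of _ "path x"]) auto
qed

lemma GL_irreducible_finite:
  fixes h :: "'t \<Rightarrow> 'k::field_char_0 mat \<Rightarrow> 'k"
  assumes "finite T" and "\<And>t. t \<in> T \<Longrightarrow> h t \<in> mat_funs n"
    and "\<And>t. t \<in> T \<Longrightarrow> \<exists>\<sigma>\<in>GL n. h t \<sigma> \<noteq> 0"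
  shows "\<exists>\<sigma>\<in>GL n. (\<Prod>t\<in>T. h t \<sigma>) \<noteq> 0"
  using assms
proof (induction T rule: finite_induct)
  case empty
  have "(1\<^sub>m n :: 'k mat) \<in> GL n"
    by (simp add: GL_iff_det)
  then show ?case
    by (intro bexI[of _ "1\<^sub>m n"]) simp_all
next
  case (insert t T)
  then obtain \<sigma>1 \<sigma>2 where "\<sigma>1 \<in> GL n" "(\<Prod>t\<in>T. h t \<sigma>1) \<noteq> 0" "\<sigma>2 \<in> GL n" "h t \<sigma>2 \<noteq> 0"
    by (metis insertCI)
  moreover have "(\<lambda>\<sigma>. \<Prod>t\<in>T. h t \<sigma>) \<in> mat_funs n"
    using insert.prems(1) by (intro function_ring_prod[OF function_ring_mat_funs]) auto
  ultimately obtain \<sigma> where "\<sigma> \<in> GL n" "(\<Prod>t\<in>T. h t \<sigma>) \<noteq> 0" "h t \<sigma> \<noteq> 0"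
    using GL_irreducible[of "\<lambda>\<sigma>. \<Prod>t\<in>T. h t \<sigma>" n "h t"] insert.prems(1) by blast
  then show ?case
    using insert.hyps by (intro bexI[of _ \<sigma>]) simp_all
qed


section \<open>Existence of the generic initial ideal\<close>

definition not_below :: "exponent \<Rightarrow> exponent \<Rightarrow> bool" where
  "not_below m m' \<longleftrightarrow> m' = m \<or> revlex_less m m'"

lemma up_closed_not_below: "up_closed (not_below m)"
  unfolding up_closed_def not_below_def using revlex_trans by metis

lemma eq_if_card_not_below_eq:
  assumes "finite M" "A \<subseteq> M" "B \<subseteq> M"
    and card: "\<And>m. m \<in> M \<Longrightarrow> card {a \<in> A. not_below m a} = card {b \<in> B. not_below m b}"
  shows "A = B"
proof (rule ccontr)
  assume "A \<noteq> B"
  define D where "D = (A - B) \<union> (B - A)"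
  have "finite D" "D \<noteq> {}"
    using assms(1-3) \<open>A \<noteq> B\<close> finite_subset unfolding D_def by blast+
  then obtain m where m: "m \<in> D" "\<forall>m'\<in>D. m' \<noteq> m \<longrightarrow> revlex_less m' m"
    using revlex_max_exists by blast
  define C where "C = {a \<in> A. revlex_less m a}"
  have CB: "C = {b \<in> B. revlex_less m b}"
  proof -
    have "a \<in> A \<longleftrightarrow> a \<in> B" if "revlex_less m a" for a
    proof -
      have "a \<notin> D"
        using m(2) that revlex_asym revlex_irrefl by metis
      then show ?thesis
        by (auto simp: D_def)
    qed
    then show ?thesis
      by (auto simp: C_def)
  qed
  have finC: "finite C" and mC: "m \<notin> C"
    using assms(1,2) by (auto simp: C_def intro: finite_subset)
  have "{a \<in> A. not_below m a} = (if m \<in> A then insert m C else C)"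
    by (auto simp: not_below_def C_def)
  moreover have "{b \<in> B. not_below m b} = (if m \<in> B then insert m C else C)"
    unfolding CB by (auto simp: not_below_def)
  moreover have "m \<in> M" "(m \<in> A) \<noteq> (m \<in> B)"
    using m(1) assms(2,3) by (auto simp: D_def)
  ultimately show False
    using card[of m] finC mC by (auto split: if_splits)
qed

lemma subspace_linear_change_image:
  "mpoly.subspace X \<Longrightarrow> mpoly.subspace (linear_change n \<sigma> ` X :: (nat, 'k::field) mpoly set)"
  by (rule subspaceI)
    (auto simp: image_iff linear_change.hom_add[symmetric] linear_change_mult_const[symmetric]
      intro: subspace_closed bexI[of _ 0] intro!: bexI)

lemma linear_change_image_forms:
  "X \<subseteq> forms n t \<Longrightarrow> linear_change n \<sigma> ` X \<subseteq> (forms n t :: (nat, 'k::field) mpoly set)"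
  using linear_change_forms by blast

lemma leads_forms: "X \<subseteq> forms n t \<Longrightarrow> leads X \<subseteq> monoms n t"
  unfolding leads_def using leading_exponent_in_keys by (fastforce simp: forms_iff)

text \<open>The number of initial monomials in an upper segment is the rank of a truncation, and ranks can only
  grow in a neighbourhood.\<close>

lemma rank_semicontinuous:
  fixes X :: "(nat, 'k::field) mpoly set"
  assumes X: "mpoly.subspace X" "X \<subseteq> forms n t"
  shows "\<exists>h\<in>mat_funs n. h \<sigma>0 \<noteq> 0 \<and> (\<forall>\<sigma>. h \<sigma> \<noteq> 0 \<longrightarrow>
    card {m' \<in> leads (linear_change n \<sigma>0 ` X). not_below m m'} \<le>
    card {m' \<in> leads (linear_change n \<sigma> ` X). not_below m m'})"
proof -
  define A where "A = {m' \<in> leads (linear_change n \<sigma>0 ` X). not_below m m'}"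
  have finA: "finite A"
    using finite_leads[OF finitely_supported_forms[OF linear_change_image_forms[OF X(2)]]]
    unfolding A_def by simp
  have "\<forall>a\<in>A. \<exists>f\<in>X. linear_change n \<sigma>0 f \<noteq> 0 \<and> leading_exponent (linear_change n \<sigma>0 f) = a"
    unfolding A_def leads_def by auto
  then obtain f where f: "\<And>a. a \<in> A \<Longrightarrow> f a \<in> X \<and> linear_change n \<sigma>0 (f a) \<noteq> 0 \<and>
      leading_exponent (linear_change n \<sigma>0 (f a)) = a"
    by metis
  define v where "v = (\<lambda>\<sigma> a. restrict_keys (not_below m) (linear_change n \<sigma> (f a)))"
  have "v \<sigma>0 a \<noteq> 0 \<and> leading_exponent (v \<sigma>0 a) = a" if "a \<in> A" for a
    using leading_exponent_restrict_keys[of "linear_change n \<sigma>0 (f a)" "not_below m"] f[OF that] that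
    by (auto simp: v_def A_def)
  then have "lin_indep A (v \<sigma>0)"
    by (intro lin_indep_if_leads_distinct finA) (auto simp: inj_on_def)
  moreover have "(\<lambda>\<sigma>. lookup (v \<sigma> a) m') \<in> mat_funs n" if "a \<in> A" for a m'
  proof -
    have "f a \<in> polys {..<n}"
      using f[OF that] X(2) forms_subset_polys by blast
    then have "(\<lambda>\<sigma>. lookup (linear_change n \<sigma> (f a)) m') \<in> mat_funs n"
      using poly_family_linear_change unfolding poly_family_def by blast
    then show ?thesis
      using function_ring_closed(1)[OF function_ring_mat_funs, of 0 n]
      by (cases "not_below m m'") (simp_all add: v_def)
  qed
  ultimately obtain h where h: "h \<in> mat_funs n" "h \<sigma>0 \<noteq> 0" "\<forall>\<sigma>. h \<sigma> \<noteq> 0 \<longrightarrow> lin_indep A (v \<sigma>)"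
    using lin_indep_open[OF function_ring_mat_funs finA, of v n \<sigma>0] by blast
  show ?thesis
  proof (intro bexI[of _ h] conjI allI impI h(1,2))
    fix \<sigma> assume "h \<sigma> \<noteq> 0"
    then have ind: "lin_indep A (v \<sigma>)"
      using h(3) by blast
    have sub: "mpoly.subspace (linear_change n \<sigma> ` X)"
      by (rule subspace_linear_change_image[OF X(1)])
    have fin: "finitely_supported (linear_change n \<sigma> ` X)"
      by (rule finitely_supported_forms[OF linear_change_image_forms[OF X(2)]])
    have "card A \<le> mpoly.dim (restrict_keys (not_below m) ` linear_change n \<sigma> ` X)"
      using f by (intro lin_indep_card_le_dim[OF _ _ finA ind] subspace_restrict_keys sub
          finitely_supported_restrict_keys fin) (auto simp: v_def)
    then show "card {m' \<in> leads (linear_change n \<sigma>0 ` X). not_below m m'} \<le>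
        card {m' \<in> leads (linear_change n \<sigma> ` X). not_below m m'}"
      unfolding dim_restrict_keys[OF sub fin up_closed_not_below] A_def .
  qed
qed

text \<open>Choose coordinates for which the sum of all the upper-segment counts is maximal. By semicontinuity
  none of the counts can drop nearby, and by maximality none can grow.\<close>

lemma generic_leads:
  fixes X :: "(nat, 'k::field) mpoly set"
  assumes X: "mpoly.subspace X" "X \<subseteq> forms n t"
  shows "\<exists>\<sigma>0\<in>GL n. \<exists>h\<in>mat_funs n. h \<sigma>0 \<noteq> 0 \<and>
    (\<forall>\<sigma>\<in>GL n. h \<sigma> \<noteq> 0 \<longrightarrow> leads (linear_change n \<sigma> ` X) = leads (linear_change n \<sigma>0 ` X))"
proof -
  define N where "N = (\<lambda>\<sigma> m. card {m' \<in> leads (linear_change n \<sigma> ` X). not_below m m'})"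
  have sub: "leads (linear_change n \<sigma> ` X) \<subseteq> monoms n t" for \<sigma>
    by (rule leads_forms[OF linear_change_image_forms[OF X(2)]])
  have Nle: "N \<sigma> m \<le> card (monoms n t)" for \<sigma> m
    unfolding N_def using sub[of \<sigma>] by (intro card_mono) auto
  have one: "(1\<^sub>m n :: 'k mat) \<in> GL n"
    by (simp add: GL_iff_det)
  have "(\<Sum>m\<in>monoms n t. N \<sigma> m) < Suc (card (monoms n t) * card (monoms n t))" for \<sigma>
    using sum_bounded_above[of "monoms n t" "N \<sigma>", OF Nle] by (simp add: less_Suc_eq_le)
  then obtain \<sigma>0 where \<sigma>0: "\<sigma>0 \<in> GL n"
    "\<forall>\<sigma>. \<sigma> \<in> GL n \<longrightarrow> (\<Sum>m\<in>monoms n t. N \<sigma> m) \<le> (\<Sum>m\<in>monoms n t. N \<sigma>0 m)"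
    using ex_has_greatest_nat[of "\<lambda>\<sigma>. \<sigma> \<in> GL n" "1\<^sub>m n" "\<lambda>\<sigma>. \<Sum>m\<in>monoms n t. N \<sigma> m"] one by blast
  have "\<forall>m. \<exists>h\<in>mat_funs n. h \<sigma>0 \<noteq> 0 \<and> (\<forall>\<sigma>. h \<sigma> \<noteq> 0 \<longrightarrow> N \<sigma>0 m \<le> N \<sigma> m)"
    unfolding N_def using rank_semicontinuous[OF X, of \<sigma>0] by blast
  then obtain h where h: "\<And>m. h m \<in> mat_funs n" "\<And>m. h m \<sigma>0 \<noteq> 0"
    "\<And>m \<sigma>. h m \<sigma> \<noteq> 0 \<Longrightarrow> N \<sigma>0 m \<le> N \<sigma> m"
    by metis
  show ?thesis
  proof (intro bexI[of _ \<sigma>0] bexI[of _ "\<lambda>\<sigma>. \<Prod>m\<in>monoms n t. h m \<sigma>"] conjI ballI impI \<sigma>0(1))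
    show "(\<Prod>m\<in>monoms n t. h m \<sigma>0) \<noteq> 0"
      using h(2) by simp
    show "(\<lambda>\<sigma>. \<Prod>m\<in>monoms n t. h m \<sigma>) \<in> mat_funs n"
      using h(1) by (intro function_ring_prod[OF function_ring_mat_funs])
    fix \<sigma> assume \<sigma>: "\<sigma> \<in> GL n" "(\<Prod>m\<in>monoms n t. h m \<sigma>) \<noteq> 0"
    have le: "N \<sigma>0 m \<le> N \<sigma> m" if "m \<in> monoms n t" for m
      using \<sigma>(2) that by (intro h(3)) simp
    have "N \<sigma> m = N \<sigma>0 m" if "m \<in> monoms n t" for m
    proof (rule ccontr)
      assume "N \<sigma> m \<noteq> N \<sigma>0 m"
      then have "N \<sigma>0 m < N \<sigma> m"
        using le[OF that] by simp
      then have "(\<Sum>m\<in>monoms n t. N \<sigma>0 m) < (\<Sum>m\<in>monoms n t. N \<sigma> m)"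
        using le that by (intro sum_strict_mono_ex1) auto
      then show False
        using \<sigma>0(2) \<sigma>(1) by (meson leD)
    qed
    then show "leads (linear_change n \<sigma> ` X) = leads (linear_change n \<sigma>0 ` X)"
      unfolding N_def by (intro eq_if_card_not_below_eq[OF finite_monoms sub sub])
  qed
qed

lemma dim_linear_change_image:
  fixes X :: "(nat, 'k::field) mpoly set"
  assumes X: "mpoly.subspace X" "X \<subseteq> forms n t" and \<sigma>: "\<sigma> \<in> GL n"
  shows "mpoly.dim (linear_change n \<sigma> ` X) = mpoly.dim X"
proof -
  obtain \<tau> where \<tau>: "\<tau> \<in> carrier_mat n n" "\<tau> * \<sigma> = 1\<^sub>m n"
    using GL_inverse[OF \<sigma>] by blast
  have c: "\<sigma> \<in> carrier_mat n n"
    using \<sigma> by (simp add: GL_def)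
  have inv: "linear_change n \<tau> (linear_change n \<sigma> f) = f" if "f \<in> X" for f
  proof -
    have "f \<in> polys {..<n}"
      using that X(2) forms_subset_polys by blast
    then show ?thesis
      using linear_change_compose[OF c \<tau>(1)] \<tau>(2) linear_change_one by simp
  qed
  note facts = X(1) finitely_supported_forms[OF X(2)] subspace_linear_change_image[OF X(1)]
    finitely_supported_forms[OF linear_change_image_forms[OF X(2)]]
  show ?thesis
  proof (rule antisym)
    show "mpoly.dim (linear_change n \<sigma> ` X) \<le> mpoly.dim X"
    proof (rule dim_le_of_injective[OF facts(3,4,1,2), where T = "linear_change n \<tau>"])
      fix f assume "f \<in> linear_change n \<sigma> ` X"
      then obtain g where g: "g \<in> X" "f = linear_change n \<sigma> g"
        by blast
      then show "linear_change n \<tau> f \<in> X"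
        using inv by simp
      show "f = 0" if "linear_change n \<tau> f = 0"
        using that g inv by simp
    qed (simp_all add: linear_change.hom_add linear_change_mult_const)
    show "mpoly.dim X \<le> mpoly.dim (linear_change n \<sigma> ` X)"
    proof (rule dim_le_of_injective[OF facts(1-4), where T = "linear_change n \<sigma>"])
      fix f assume "f \<in> X" "linear_change n \<sigma> f = 0"
      then show "f = 0"
        using inv[of f] by simp
    qed (simp_all add: linear_change.hom_add linear_change_mult_const)
  qed
qed

text \<open>Dickson's lemma by induction on the number of relevant coordinates. Exponents whose last coordinate
  is at least \<open>V\<close> are dominated by the set \<open>B\<close> for the other coordinates; the finitely many remaining
  values of the last coordinate are treated one at a time.\<close>

lemma dickson:
  fixes E :: "(nat \<Rightarrow>\<^sub>0 nat) set"
  shows "\<exists>B. finite B \<and> B \<subseteq> E \<and> (\<forall>m\<in>E. \<exists>b\<in>B. \<forall>i<n. lookup b i \<le> lookup m i)"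
proof (induction n arbitrary: E)
  case 0
  show ?case
  proof (cases "E = {}")
    case False
    then obtain e where "e \<in> E"
      by blast
    then show ?thesis
      by (intro exI[of _ "{e}"]) simp
  qed auto
next
  case (Suc n)
  obtain B where B: "finite B" "B \<subseteq> E" "\<And>m. m \<in> E \<Longrightarrow> \<exists>b\<in>B. \<forall>i<n. lookup b i \<le> lookup m i"
    using Suc.IH[of E] by auto
  have "\<forall>v. \<exists>C. finite C \<and> C \<subseteq> {m \<in> E. lookup m n = v} \<and>
      (\<forall>m\<in>{m \<in> E. lookup m n = v}. \<exists>b\<in>C. \<forall>i<n. lookup b i \<le> lookup m i)"
    using Suc.IH by blast
  then obtain C where "\<forall>v. finite (C v) \<and> C v \<subseteq> {m \<in> E. lookup m n = v} \<and>
      (\<forall>m\<in>{m \<in> E. lookup m n = v}. \<exists>b\<in>C v. \<forall>i<n. lookup b i \<le> lookup m i)"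
    by (rule choice[THEN exE])
  then have C: "\<And>v. finite (C v)" "\<And>v. C v \<subseteq> {m \<in> E. lookup m n = v}"
    "\<And>v m. m \<in> E \<Longrightarrow> lookup m n = v \<Longrightarrow> \<exists>b\<in>C v. \<forall>i<n. lookup b i \<le> lookup m i"
    by simp_all
  define V where "V = (\<Sum>b\<in>B. lookup b n)"
  have V: "lookup b n \<le> V" if "b \<in> B" for b
    unfolding V_def using that B(1) by (intro member_le_sum) auto
  show ?case
  proof (intro exI[of _ "B \<union> (\<Union>v<V. C v)"] conjI ballI)
    show "finite (B \<union> (\<Union>v<V. C v))"
      using B(1) C(1) by simp
    show "B \<union> (\<Union>v<V. C v) \<subseteq> E"
      using B(2) C(2) by blast
    fix m assume m: "m \<in> E"
    show "\<exists>b\<in>B \<union> (\<Union>v<V. C v). \<forall>i<Suc n. lookup b i \<le> lookup m i"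
    proof (cases "lookup m n < V")
      case True
      obtain b where b: "b \<in> C (lookup m n)" "\<forall>i<n. lookup b i \<le> lookup m i"
        using C(3)[OF m refl] by blast
      have "lookup b n = lookup m n"
        using C(2) b(1) by blast
      then show ?thesis
        using b True by (intro bexI[of _ b]) (auto simp: less_Suc_eq)
    next
      case False
      obtain b where b: "b \<in> B" "\<forall>i<n. lookup b i \<le> lookup m i"
        using B(3)[OF m] by blast
      then show ?thesis
        using V[OF b(1)] False by (intro bexI[of _ b]) (auto simp: less_Suc_eq)
    qed
  qed
qed

lemma ideal_closed:
  assumes "ideal I (R n)"
  shows "I \<subseteq> polys {..<n}" "0 \<in> I" "f \<in> I \<Longrightarrow> g \<in> I \<Longrightarrow> f + g \<in> I"
    "f \<in> I \<Longrightarrow> r \<in> polys {..<n} \<Longrightarrow> r * f \<in> I"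
proof -
  interpret ideal I "R n" by fact
  show "I \<subseteq> polys {..<n}"
    using a_subset by simp
  show "0 \<in> I"
    using additive_subgroup.zero_closed[OF is_additive_subgroup] by (simp add: poly_ring_def)
  show "f \<in> I \<Longrightarrow> g \<in> I \<Longrightarrow> f + g \<in> I"
    using additive_subgroup.a_closed[OF is_additive_subgroup, of f g] by (simp add: poly_ring_def)
  show "f \<in> I \<Longrightarrow> r \<in> polys {..<n} \<Longrightarrow> r * f \<in> I"
    using I_l_closed[of f r] by (simp add: poly_ring_def)
qed

lemma ideal_polysI:
  fixes Y :: "(nat, 'k::comm_ring_1) mpoly set"
  assumes "Y \<subseteq> polys {..<n}" "0 \<in> Y" "\<And>f g. f \<in> Y \<Longrightarrow> g \<in> Y \<Longrightarrow> f + g \<in> Y"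
    "\<And>f r. f \<in> Y \<Longrightarrow> r \<in> polys {..<n} \<Longrightarrow> r * f \<in> Y"
  shows "ideal Y (R n)"
proof (rule idealI)
  interpret cring "R n :: (nat, 'k) mpoly ring"
    by (rule cring_poly_ring)
  show "ring (R n :: (nat, 'k) mpoly ring)"
    by (rule ring_axioms)
  have neg: "- f \<in> Y" if "f \<in> Y" for f
  proof -
    have "single 0 (- 1) * f \<in> Y"
      by (rule assms(4)[OF that polys_const])
    then show ?thesis
      by (simp add: single_uminus)
  qed
  show "subgroup Y (add_monoid (R n))"
  proof (rule add.subgroupI)
    fix f assume f: "f \<in> Y"
    have "\<ominus>\<^bsub>R n\<^esub> f = - f"
    proof (rule minus_equality)
      show "f \<in> carrier (R n)" "- f \<in> carrier (R n)"
        using f neg assms(1) by auto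
      show "- f \<oplus>\<^bsub>R n\<^esub> f = \<zero>\<^bsub>R n\<^esub>"
        by (simp add: poly_ring_def)
    qed
    then show "\<ominus>\<^bsub>R n\<^esub> f \<in> Y"
      using neg[OF f] by simp
  qed (use assms in \<open>auto simp: poly_ring_def\<close>)
  fix f r :: "(nat, 'k) mpoly" assume "f \<in> Y" "r \<in> carrier (R n)"
  then show "r \<otimes>\<^bsub>R n\<^esub> f \<in> Y" "f \<otimes>\<^bsub>R n\<^esub> r \<in> Y"
    using assms(4)[of f r] by (simp_all add: poly_ring_def mult.commute)
qed

lemma ideal_genideal:
  "G \<subseteq> polys {..<n} \<Longrightarrow> ideal (genideal (R n) G) (R n)"
  using ring.genideal_ideal[OF cring.axioms(1)[OF cring_poly_ring], of G "{..<n}"] by simp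

lemma genideal_superset:
  "G \<subseteq> polys {..<n} \<Longrightarrow> G \<subseteq> genideal (R n) G"
  using ring.genideal_self[OF cring.axioms(1)[OF cring_poly_ring], of G "{..<n}"] by simp

lemma genideal_least:
  "ideal Y (R n) \<Longrightarrow> G \<subseteq> Y \<Longrightarrow> genideal (R n) G \<subseteq> Y"
  using ring.genideal_minimal[OF cring.axioms(1)[OF cring_poly_ring]] by blast

lemma graded_part_subset_forms: "graded_part n I t \<subseteq> forms n t"
  by (simp add: graded_part_def)

lemma subspace_graded_part:
  fixes I :: "(nat, 'k::field) mpoly set"
  assumes "ideal I (R n)"
  shows "mpoly.subspace (graded_part n I t)"
  by (rule subspaceI)
    (use ideal_closed[OF assms] subspace_closed[OF subspace_forms[of n t]] in \<open>auto simp: graded_part_def\<close>)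

abbreviation moved_part :: "nat \<Rightarrow> (nat, 'k::comm_ring_1) mpoly set \<Rightarrow> 'k mat \<Rightarrow> nat \<Rightarrow> (nat, 'k) mpoly set" where
  "moved_part n I \<sigma> t \<equiv> linear_change n \<sigma> ` graded_part n I t"

lemma moved_part_props:
  fixes I :: "(nat, 'k::field) mpoly set"
  assumes "ideal I (R n)"
  shows "mpoly.subspace (moved_part n I \<sigma> t)" "moved_part n I \<sigma> t \<subseteq> forms n t"
    "finitely_supported (moved_part n I \<sigma> t)" "leads (moved_part n I \<sigma> t) \<subseteq> monoms n t"
    "card (leads (moved_part n I \<sigma> t)) = mpoly.dim (moved_part n I \<sigma> t)"
proof -
  show 1: "mpoly.subspace (moved_part n I \<sigma> t)"
    by (intro subspace_linear_change_image subspace_graded_part assms)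
  show 2: "moved_part n I \<sigma> t \<subseteq> forms n t"
    by (intro linear_change_image_forms graded_part_subset_forms)
  show 3: "finitely_supported (moved_part n I \<sigma> t)"
    by (rule finitely_supported_forms[OF 2])
  show "leads (moved_part n I \<sigma> t) \<subseteq> monoms n t"
    by (rule leads_forms[OF 2])
  show "card (leads (moved_part n I \<sigma> t)) = mpoly.dim (moved_part n I \<sigma> t)"
    using dim_eq_card_leads[OF 1 3] by simp
qed

lemma forms_monomial: "m \<in> monoms n d \<Longrightarrow> single m c \<in> forms n d"
  by (simp add: forms_iff)

lemma moved_part_mult:
  fixes I :: "(nat, 'k::field) mpoly set"
  assumes I: "ideal I (R n)" and \<sigma>: "\<sigma> \<in> GL n" and f: "f \<in> moved_part n I \<sigma> t" and p: "p \<in> forms n s"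
  shows "p * f \<in> moved_part n I \<sigma> (s + t)"
proof -
  obtain \<tau> where \<tau>: "\<tau> \<in> carrier_mat n n" "\<sigma> * \<tau> = 1\<^sub>m n"
    using GL_inverse[OF \<sigma>] by blast
  have c: "\<sigma> \<in> carrier_mat n n"
    using \<sigma> by (simp add: GL_def)
  obtain g where g: "g \<in> graded_part n I t" "f = linear_change n \<sigma> g"
    using f by blast
  have pp: "p \<in> polys {..<n}"
    using p forms_subset_polys by blast
  have "linear_change n \<sigma> (linear_change n \<tau> p * g) = linear_change n \<sigma> (linear_change n \<tau> p) * f"
    using g(2) by (simp add: linear_change.hom_mult)
  also have "\<dots> = p * f"
    using linear_change_compose[OF \<tau>(1) c pp] \<tau>(2) linear_change_one[OF pp] by simp
  finally have "p * f = linear_change n \<sigma> (linear_change n \<tau> p * g)"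
    by simp
  moreover have "linear_change n \<tau> p * g \<in> graded_part n I (s + t)"
    using g(1) ideal_closed(4)[OF I _ linear_change_polys] forms_mult[OF linear_change_forms[OF p]]
    by (auto simp: graded_part_def)
  ultimately show ?thesis
    by blast
qed

lemma leads_moved_part_add:
  fixes I :: "(nat, 'k::field) mpoly set"
  assumes I: "ideal I (R n)" and \<sigma>: "\<sigma> \<in> GL n" and m: "m \<in> leads (moved_part n I \<sigma> t)" and a: "a \<in> monoms n s"
  shows "a + m \<in> leads (moved_part n I \<sigma> (s + t))"
proof -
  obtain f where f: "f \<in> moved_part n I \<sigma> t" "f \<noteq> 0" "m = leading_exponent f"
    using m unfolding leads_def by blast
  have "single a 1 * f \<in> moved_part n I \<sigma> (s + t)"
    by (rule moved_part_mult[OF I \<sigma> f(1) forms_monomial[OF a]])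
  moreover have "single a 1 * f \<noteq> 0"
    using f(2) by simp
  ultimately show ?thesis
    using leading_exponent_monomial_mult[OF f(2), of a] f(3) unfolding leads_def
    by (intro image_eqI[of _ _ "single a 1 * f"]) simp_all
qed

text \<open>Galligo's theorem. Each degree \<open>t\<close> has its own open set of good coordinates, with initial monomials
  \<open>L t\<close>. By Dickson's lemma all the \<open>L t\<close> are generated by the finitely many degrees in \<open>T\<close>. Coordinates
  good for those degrees are good for all degrees: the initial monomials contain \<open>L t\<close>, and both sets have as
  many elements as the dimension of the degree \<open>t\<close> component.\<close>

theorem generic_leads_all_degrees:
  fixes I :: "(nat, 'k::field_char_0) mpoly set"
  assumes I: "ideal I (R n)"
  obtains h \<sigma>0 L where "h \<in> mat_funs n" "\<sigma>0 \<in> GL n" "h \<sigma>0 \<noteq> 0"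
    "\<And>\<sigma> t. \<sigma> \<in> GL n \<Longrightarrow> h \<sigma> \<noteq> 0 \<Longrightarrow> leads (moved_part n I \<sigma> t) = L t"
proof -
  have "\<forall>t. \<exists>\<sigma>0 h. \<sigma>0 \<in> GL n \<and> h \<in> mat_funs n \<and> h \<sigma>0 \<noteq> 0 \<and>
      (\<forall>\<sigma>\<in>GL n. h \<sigma> \<noteq> 0 \<longrightarrow> leads (moved_part n I \<sigma> t) = leads (moved_part n I \<sigma>0 t))"
    using generic_leads[OF subspace_graded_part[OF I] graded_part_subset_forms] by blast
  then obtain \<sigma>0 h where \<sigma>0: "\<And>t. \<sigma>0 t \<in> GL n" and h: "\<And>t. h t \<in> mat_funs n" "\<And>t. h t (\<sigma>0 t) \<noteq> 0"
    and gen: "\<And>t \<sigma>. \<sigma> \<in> GL n \<Longrightarrow> h t \<sigma> \<noteq> 0 \<Longrightarrow> leads (moved_part n I \<sigma> t) = leads (moved_part n I (\<sigma>0 t) t)"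
    by metis
  define L where "L = (\<lambda>t. leads (moved_part n I (\<sigma>0 t) t))"
  have Lsub: "L t \<subseteq> monoms n t" for t
    unfolding L_def by (rule moved_part_props(4)[OF I])
  define E where "E = (\<Union>t. L t)"
  obtain B where B: "finite B" "B \<subseteq> E" "\<And>m. m \<in> E \<Longrightarrow> \<exists>b\<in>B. \<forall>i<n. lookup b i \<le> lookup m i"
    using dickson[of E n] by auto
  define T where "T = mdeg ` B"
  have finT: "finite T"
    using B(1) by (simp add: T_def)
  obtain \<sigma>1 where \<sigma>1: "\<sigma>1 \<in> GL n" "(\<Prod>t\<in>T. h t \<sigma>1) \<noteq> 0"
    using GL_irreducible_finite[OF finT, of h n] h \<sigma>0 by blast
  show ?thesis
  proof (rule that)
    show "(\<lambda>\<sigma>. \<Prod>t\<in>T. h t \<sigma>) \<in> mat_funs n"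
      using h(1) by (intro function_ring_prod[OF function_ring_mat_funs])
    show "\<sigma>1 \<in> GL n" "(\<Prod>t\<in>T. h t \<sigma>1) \<noteq> 0"
      by fact+
    fix \<sigma> t assume \<sigma>: "\<sigma> \<in> GL n" "(\<Prod>t\<in>T. h t \<sigma>) \<noteq> 0"
    have "L t \<subseteq> leads (moved_part n I \<sigma> t)"
    proof
      fix m assume m: "m \<in> L t"
      then have mt: "m \<in> monoms n t"
        using Lsub by blast
      have "m \<in> E"
        using m by (auto simp: E_def)
      then obtain b where b: "b \<in> B" "\<forall>i<n. lookup b i \<le> lookup m i"
        using B(3) by blast
      have bE: "b \<in> L (mdeg b)" "keys b \<subseteq> {..<n}"
        using b(1) B(2) Lsub by (auto simp: E_def monoms_def)
      have "h (mdeg b) \<sigma> \<noteq> 0"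
        using \<sigma>(2) b(1) finT by (auto simp: T_def)
      then have bl: "b \<in> leads (moved_part n I \<sigma> (mdeg b))"
        using gen[OF \<sigma>(1)] bE(1) by (simp add: L_def)
      have "lookup b i \<le> lookup m i" for i
      proof (cases "i < n")
        case False
        then have "i \<notin> keys b"
          using bE(2) by auto
        then show ?thesis
          by (simp add: in_keys_iff)
      qed (use b in simp)
      then have mb: "(m - b) + b = m"
        by (intro poly_mapping_eqI) (simp add: lookup_add lookup_minus)
      have "keys (m - b) \<subseteq> keys m"
        by (auto simp: in_keys_iff lookup_minus)
      moreover have "mdeg (m - b) = t - mdeg b" and "mdeg b \<le> t"
        using arg_cong[OF mb, of mdeg] mt by (auto simp: monoms_def)
      ultimately have "m - b \<in> monoms n (t - mdeg b)"
        using mt by (auto simp: monoms_def)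
      then show "m \<in> leads (moved_part n I \<sigma> t)"
        using leads_moved_part_add[OF I \<sigma>(1) bl, of "m - b" "t - mdeg b"] mb \<open>mdeg b \<le> t\<close> by simp
    qed
    moreover have "card (L t) = card (leads (moved_part n I \<sigma> t))"
      unfolding L_def moved_part_props(5)[OF I]
      using dim_linear_change_image[OF subspace_graded_part[OF I] graded_part_subset_forms] \<sigma>(1) \<sigma>0 by metis
    moreover have "finite (leads (moved_part n I \<sigma> t))"
      by (rule finite_leads[OF moved_part_props(3)[OF I]])
    ultimately show "leads (moved_part n I \<sigma> t) = L t"
      using card_subset_eq by metis
  qed
qed

lemma initial_ideal_moved:
  fixes I :: "(nat, 'k::field) mpoly set"
  assumes I: "ideal I (R n)" and \<sigma>: "\<sigma> \<in> GL n"
  shows "initial_ideal n (linear_change n \<sigma> ` I) =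
    genideal (R n) {single m 1 |m. \<exists>t. m \<in> leads (moved_part n I \<sigma> t)}"
proof -
  obtain \<tau> where \<tau>: "\<tau> \<in> carrier_mat n n" "\<tau> * \<sigma> = 1\<^sub>m n"
    using GL_inverse[OF \<sigma>] by blast
  have c: "\<sigma> \<in> carrier_mat n n"
    using \<sigma> by (simp add: GL_def)
  have "linear_change n \<sigma> ` I \<inter> forms n t = moved_part n I \<sigma> t" for t
  proof (intro equalityI subsetI)
    fix f assume "f \<in> linear_change n \<sigma> ` I \<inter> forms n t"
    then obtain g where g: "g \<in> I" "f = linear_change n \<sigma> g" "f \<in> forms n t"
      by blast
    have gp: "g \<in> polys {..<n}"
      using g(1) ideal_closed(1)[OF I] by blast
    have "g = linear_change n \<tau> f"
      using g(2) linear_change_compose[OF c \<tau>(1) gp] \<tau>(2) linear_change_one[OF gp] by simp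
    then have "g \<in> forms n t"
      using linear_change_forms[OF g(3)] by simp
    then show "f \<in> moved_part n I \<sigma> t"
      using g by (auto simp: graded_part_def)
  next
    fix f assume "f \<in> moved_part n I \<sigma> t"
    then show "f \<in> linear_change n \<sigma> ` I \<inter> forms n t"
      using moved_part_props(2)[OF I] by (auto simp: graded_part_def)
  qed
  then have "{single (leading_exponent f) 1 |f. f \<in> linear_change n \<sigma> ` I \<and> f \<noteq> 0 \<and> (\<exists>t. f \<in> forms n t)} =
      {single m (1::'k) |m. \<exists>t. m \<in> leads (moved_part n I \<sigma> t)}"
    unfolding leads_def by blast
  then show ?thesis
    unfolding initial_ideal_def by simp
qed

text \<open>The generic value is unique because nonempty open sets meet.\<close>

lemma gin_eq:
  fixes I :: "(nat, 'k::field_char_0) mpoly set"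
  assumes I: "ideal I (R n)" and h: "h \<in> mat_funs n" and \<sigma>0: "\<sigma>0 \<in> GL n" "h \<sigma>0 \<noteq> 0"
    and L: "\<And>\<sigma> t. \<sigma> \<in> GL n \<Longrightarrow> h \<sigma> \<noteq> 0 \<Longrightarrow> leads (moved_part n I \<sigma> t) = L t"
  shows "gin n I = genideal (R n) {single m 1 |m. \<exists>t. m \<in> L t}"
proof -
  define J where "J = genideal (R n) {single m (1::'k) |m. \<exists>t. m \<in> L t}"
  obtain p where p: "p \<in> polys ({..<n} \<times> {..<n})" "h = (\<lambda>\<sigma>. insertion id (\<lambda>ij. \<sigma> $$ ij) p)"
    using h unfolding mat_funs_def by blast
  define U where "U = {\<sigma> \<in> GL n. h \<sigma> \<noteq> 0}"
  have U: "zariski_open_GL n U"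
    unfolding zariski_open_GL_def U_def p(2) by (rule exI[of _ "{p}"]) (use p(1) in auto)
  have J: "initial_ideal n (linear_change n \<sigma> ` I) = J" if "\<sigma> \<in> U" for \<sigma>
  proof -
    have "\<sigma> \<in> GL n" "h \<sigma> \<noteq> 0"
      using that by (auto simp: U_def)
    then show ?thesis
      unfolding J_def initial_ideal_moved[OF I \<open>\<sigma> \<in> GL n\<close>] using L by simp
  qed
  have "gin n I = J"
    unfolding gin_def
  proof (rule the_equality)
    show "\<exists>U. zariski_open_GL n U \<and> U \<noteq> {} \<and> (\<forall>\<sigma>\<in>U. initial_ideal n (linear_change n \<sigma> ` I) = J)"
      using U J \<sigma>0 by (intro exI[of _ U]) (auto simp: U_def)
  next
    fix J'
    assume "\<exists>U. zariski_open_GL n U \<and> U \<noteq> {} \<and> (\<forall>\<sigma>\<in>U. initial_ideal n (linear_change n \<sigma> ` I) = J')"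
    then obtain U' where U': "zariski_open_GL n U'" "U' \<noteq> {}"
      "\<And>\<sigma>. \<sigma> \<in> U' \<Longrightarrow> initial_ideal n (linear_change n \<sigma> ` I) = J'"
      by blast
    obtain S where S: "S \<subseteq> polys ({..<n} \<times> {..<n})"
      "U' = {\<sigma> \<in> GL n. \<exists>p\<in>S. insertion id (\<lambda>ij. \<sigma> $$ ij) p \<noteq> 0}"
      using U'(1) unfolding zariski_open_GL_def by blast
    obtain \<sigma>' q where q: "\<sigma>' \<in> GL n" "q \<in> S" "insertion id (\<lambda>ij. \<sigma>' $$ ij) q \<noteq> 0"
      using U'(2) S(2) by blast
    have "(\<lambda>\<sigma>. insertion id (\<lambda>ij. \<sigma> $$ ij) q) \<in> mat_funs n"
      using q(2) S(1) unfolding mat_funs_def by blast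
    then obtain \<sigma> where "\<sigma> \<in> GL n" "h \<sigma> \<noteq> 0" "insertion id (\<lambda>ij. \<sigma> $$ ij) q \<noteq> 0"
      using GL_irreducible[OF h _ \<sigma>0 q(1)] q(3) by blast
    then have "\<sigma> \<in> U" "\<sigma> \<in> U'"
      using q(2) by (auto simp: U_def S(2))
    then show "J' = J"
      using J U'(3) by metis
  qed
  then show ?thesis
    by (simp add: J_def)
qed

lemma monomial_in_genideal_iff:
  fixes E :: "exponent set"
  assumes E: "\<And>m. m \<in> E \<Longrightarrow> keys m \<subseteq> {..<n}"
    and up: "\<And>m a. m \<in> E \<Longrightarrow> keys a \<subseteq> {..<n} \<Longrightarrow> a + m \<in> E"
  shows "single m (1 :: 'k::field) \<in> genideal (R n) {single m 1 |m. m \<in> E} \<longleftrightarrow> m \<in> E"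
proof
  let ?G = "{single m (1 :: 'k) |m. m \<in> E}"
  let ?Y = "{p :: (nat, 'k) mpoly. keys p \<subseteq> E}"
  have "ideal ?Y (R n)"
  proof (rule ideal_polysI)
    show "?Y \<subseteq> polys {..<n}"
    proof
      fix p assume "p \<in> ?Y"
      then have "keys m \<subseteq> {..<n}" if "m \<in> keys p" for m
        using that by (intro E) auto
      then show "p \<in> polys {..<n}"
        by (simp add: polys_iff)
    qed
    fix f g :: "(nat, 'k) mpoly" assume "f \<in> ?Y" "g \<in> ?Y"
    then show "f + g \<in> ?Y"
      using Poly_Mapping.keys_add[of f g] by blast
  next
    fix f r :: "(nat, 'k) mpoly" assume f: "f \<in> ?Y" and r: "r \<in> polys {..<n}"
    have "m \<in> E" if "m \<in> keys (r * f)" for m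
    proof -
      from subsetD[OF keys_mult that] obtain a b where "m = a + b" "a \<in> keys r" "b \<in> keys f"
        by blast
      then show ?thesis
        using up[of b a] f r by (auto simp: polys_iff)
    qed
    then show "r * f \<in> ?Y"
      by blast
  qed simp
  then have "genideal (R n) ?G \<subseteq> ?Y"
    by (rule genideal_least) auto
  then show "single m (1 :: 'k) \<in> genideal (R n) ?G \<Longrightarrow> m \<in> E"
    by auto
  have "?G \<subseteq> polys {..<n}"
    using E by (auto simp: polys_iff)
  then show "m \<in> E \<Longrightarrow> single m (1 :: 'k) \<in> genideal (R n) ?G"
    using genideal_superset by blast
qed

lemma monomial_in_gin_iff:
  fixes I :: "(nat, 'k::field_char_0) mpoly set"
  assumes I: "ideal I (R n)" and h: "h \<in> mat_funs n" and \<sigma>0: "\<sigma>0 \<in> GL n" "h \<sigma>0 \<noteq> 0"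
    and L: "\<And>\<sigma> t. \<sigma> \<in> GL n \<Longrightarrow> h \<sigma> \<noteq> 0 \<Longrightarrow> leads (moved_part n I \<sigma> t) = L t"
  shows "single m 1 \<in> graded_part n (gin n I) d \<longleftrightarrow> m \<in> L d"
proof -
  have L0: "L t = leads (moved_part n I \<sigma>0 t)" for t
    using L[OF \<sigma>0] by simp
  have Lsub: "L t \<subseteq> monoms n t" for t
    unfolding L0 by (rule moved_part_props(4)[OF I])
  have "single m (1::'k) \<in> gin n I \<longleftrightarrow> (\<exists>t. m \<in> L t)"
  proof -
    have "single m (1::'k) \<in> genideal (R n) {single m 1 |m. m \<in> (\<Union>t. L t)} \<longleftrightarrow> m \<in> (\<Union>t. L t)"
    proof (rule monomial_in_genideal_iff)
      show "keys m \<subseteq> {..<n}" if "m \<in> (\<Union>t. L t)" for m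
        using that Lsub by (auto simp: monoms_def)
      show "a + m \<in> (\<Union>t. L t)" if "m \<in> (\<Union>t. L t)" "keys a \<subseteq> {..<n}" for m a
        using that leads_moved_part_add[OF I \<sigma>0(1), of m _ a "mdeg a"] by (auto simp: L0 monoms_def)
    qed
    moreover have "gin n I = genideal (R n) {single m 1 |m. \<exists>t. m \<in> L t}"
      by (rule gin_eq[OF I h \<sigma>0]) (rule L)
    ultimately show ?thesis
      by simp
  qed
  moreover have "single m (1::'k) \<in> forms n d \<longleftrightarrow> m \<in> monoms n d"
    by (simp add: forms_iff)
  moreover have "m \<in> L t \<Longrightarrow> m \<in> monoms n d \<Longrightarrow> t = d" for t
    using Lsub[of t] by (auto simp: monoms_def)
  ultimately show ?thesis
    using Lsub[of d] by (auto simp: graded_part_def)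
qed


section \<open>Degenerating the line\<close>

lemma subspace_unscale:
  fixes Z :: "(nat, 'k::field) mpoly set"
  assumes "mpoly.subspace Z" "single 0 a * f \<in> Z" "a \<noteq> 0"
  shows "f \<in> Z"
proof -
  have "single 0 (inverse a) * (single 0 a * f) = single 0 (inverse a * a) * f"
    by (simp only: mult.assoc[symmetric] mult_single add_0)
  also have "\<dots> = f"
    using assms(3) by simp
  finally show ?thesis
    using subspace_closed(4)[OF assms(1,2), of "inverse a"] by (simp only:)
qed

text \<open>Written as a substitution, restriction to the line is visibly a ring homomorphism.\<close>

lemma line_part_eq_insertion:
  "line_part p = insertion (single 0) (\<lambda>i. if i < 2 then Var i else 0) (p :: (nat, 'k::comm_ring_1) mpoly)"
proof -
  let ?a = "\<lambda>i. if i < 2 then Var i else 0 :: (nat, 'k) mpoly"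
  have mon: "eval_monom ?a m = (if hi m = 0 then single m 1 else 0)" for m
  proof (cases "hi m = 0")
    case True
    have "eval_monom ?a m = eval_monom Var m"
      unfolding eval_monom_def
    proof (rule prod.cong[OF refl])
      fix i assume "i \<in> keys m"
      then have "i < 2"
        using True lookup_hi[of m i] by (auto simp: in_keys_iff split: if_splits)
      then show "?a i ^ lookup m i = Var i ^ lookup m i"
        by simp
    qed
    then show ?thesis
      using True monomial_eq_prod[of m "1::'k"] by simp
  next
    case False
    then obtain i where "lookup (hi m) i \<noteq> 0"
      by (metis lookup_zero poly_mapping_eqI)
    then have "i \<in> keys m" "\<not> i < 2" "lookup m i > 0"
      by (auto simp: lookup_hi in_keys_iff split: if_splits)
    then have "eval_monom ?a m = 0"
      unfolding eval_monom_def by (intro prod_zero) (auto intro!: bexI[of _ i] simp: zero_power)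
    then show ?thesis
      using False by simp
  qed
  have "insertion (single 0) ?a p = (\<Sum>m\<in>keys p. if hi m = 0 then single m (lookup p m) else 0)"
    unfolding insertion_def eval_monom_def[symmetric] mon by (intro sum.cong) (auto simp: mult_single)
  also have "\<dots> = line_part p"
  proof (rule poly_mapping_eqI)
    fix k
    have "lookup (\<Sum>m\<in>keys p. if hi m = 0 then single m (lookup p m) else 0) k =
        (\<Sum>m\<in>keys p. if m = k then if hi k = 0 then lookup p k else 0 else 0)"
      unfolding lookup_sum by (intro sum.cong) (auto simp: lookup_single when_def)
    then show "lookup (\<Sum>m\<in>keys p. if hi m = 0 then single m (lookup p m) else 0) k = lookup (line_part p) k"
      by (simp add: line_part_def in_keys_iff)
  qed
  finally show ?thesis
    by simp
qed

lemma comm_ring_hom_line_part: "comm_ring_hom (line_part :: (nat, 'k::comm_ring_1) mpoly \<Rightarrow> _)"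
proof -
  have eq: "line_part = insertion (single 0) (\<lambda>i. if i < 2 then Var i else 0 :: (nat, 'k) mpoly)"
    by (rule ext) (rule line_part_eq_insertion)
  show ?thesis
    unfolding eq by (rule comm_ring_hom_insertion[OF comm_ring_hom_const])
qed

interpretation line_part: comm_ring_hom "line_part :: (nat, 'k::comm_ring_1) mpoly \<Rightarrow> _"
  by (rule comm_ring_hom_line_part)

lemma line_part_monomial: "line_part (single m c) = (if hi m = 0 then single m c else 0)"
  by (rule poly_mapping_eqI) (auto simp: line_part_def lookup_single when_def)

lemma lo_single: "lo (single i e) = (if i < 2 then single i e else 0)"
  and hi_single: "hi (single i e) = (if i < 2 then 0 else single i e)"
  by (rule poly_mapping_eqI, auto simp: lookup_lo lookup_hi lookup_single when_def)+

text \<open>The exponent read as a number in base \<open>B\<close>, with the later variables as the leading digits. For exponents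
  below \<open>B\<close> a smaller weight means a reverse lexicographically larger monomial; so along a path where \<open>x\<^sub>i\<close>
  vanishes to order \<open>B\<^sup>i\<close> the initial monomial dominates.\<close>

definition weight :: "nat \<Rightarrow> exponent \<Rightarrow> nat" where
  "weight B j = (\<Sum>i\<in>keys j. B ^ i * lookup j i)"

lemma geometric_less: "(\<Sum>k<i. (B :: nat) ^ k * (B - 1)) < B ^ i" if "B > 0"
proof (induction i)
  case (Suc i)
  have "(\<Sum>k<Suc i. B ^ k * (B - 1)) < B ^ i + B ^ i * (B - 1)"
    using Suc by simp
  also have "\<dots> = B ^ i * (1 + (B - 1))"
    by (simp only: distrib_left mult_1_right)
  also have "1 + (B - 1) = B"
    using that by simp
  finally show ?case
    by (simp add: mult.commute)
qed simp

lemma weight_less: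
  assumes bound: "\<And>k. lookup j k < B" and less: "revlex_less j' j"
  shows "weight B j < weight B j'"
proof -
  obtain i where i: "lookup j i < lookup j' i" "\<forall>k>i. lookup j k = lookup j' k"
    using less unfolding revlex_less_def by blast
  have B: "B > 0"
    using bound[of 0] by simp
  define K where "K = keys j \<union> keys j' \<union> {..i}"
  have finK: "finite K" and iK: "{..i} \<subseteq> K"
    by (simp_all add: K_def)
  have wt: "weight B x = (\<Sum>k<i. B ^ k * lookup x k) + B ^ i * lookup x i + (\<Sum>k\<in>K - {..i}. B ^ k * lookup x k)"
    if "keys x \<subseteq> K" for x
  proof -
    have "weight B x = (\<Sum>k\<in>K. B ^ k * lookup x k)"
      unfolding weight_def using that finK by (intro sum.mono_neutral_left) (auto simp: in_keys_iff)
    also have "\<dots> = (\<Sum>k\<in>K - {..i}. B ^ k * lookup x k) + (\<Sum>k\<in>{..i}. B ^ k * lookup x k)"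
      by (rule sum.subset_diff[OF iK finK])
    also have "(\<Sum>k\<in>{..i}. B ^ k * lookup x k) = (\<Sum>k<i. B ^ k * lookup x k) + B ^ i * lookup x i"
      by (simp add: lessThan_Suc_atMost[symmetric])
    finally show ?thesis
      by simp
  qed
  have "(\<Sum>k<i. B ^ k * lookup j k) \<le> (\<Sum>k<i. B ^ k * (B - 1))"
  proof (intro sum_mono mult_le_mono2)
    show "lookup j k \<le> B - 1" for k
      using bound[of k] by simp
  qed
  also have "\<dots> < B ^ i"
    by (rule geometric_less[OF B])
  finally have "(\<Sum>k<i. B ^ k * lookup j k) + B ^ i * lookup j i < B ^ i * Suc (lookup j i)"
    by simp
  also have "\<dots> \<le> B ^ i * lookup j' i"
    using i(1) by (intro mult_left_mono) auto
  also have "\<dots> \<le> (\<Sum>k<i. B ^ k * lookup j' k) + B ^ i * lookup j' i"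
    by simp
  finally have "(\<Sum>k<i. B ^ k * lookup j k) + B ^ i * lookup j i <
      (\<Sum>k<i. B ^ k * lookup j' k) + B ^ i * lookup j' i" .
  moreover have "(\<Sum>k\<in>K - {..i}. B ^ k * lookup j k) = (\<Sum>k\<in>K - {..i}. B ^ k * lookup j' k)"
    using i(2) by (intro sum.cong) auto
  moreover have "keys j \<subseteq> K" "keys j' \<subseteq> K"
    by (auto simp: K_def)
  ultimately show ?thesis
    using wt[of j] wt[of j'] by simp
qed

lemma revlex_hi:
  assumes "revlex_less m m'" "hi m \<noteq> hi m'"
  shows "revlex_less (hi m) (hi m')"
proof -
  obtain i where i: "lookup m' i < lookup m i" "\<forall>k>i. lookup m' k = lookup m k"
    using assms(1) unfolding revlex_less_def by blast
  have "\<not> i < 2"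
  proof
    assume "i < 2"
    then have "hi m = hi m'"
      using i(2) by (intro poly_mapping_eqI) (simp add: lookup_hi)
    then show False
      using assms(2) by blast
  qed
  then show ?thesis
    unfolding revlex_less_def using i by (intro exI[of _ i]) (simp add: lookup_hi)
qed

lemma weight_leading_exponent:
  assumes f: "f \<in> forms n t" "f \<noteq> 0" and m: "m \<in> keys f" and B: "t < B"
  shows "weight B (hi (leading_exponent f)) \<le> weight B (hi m)"
    and "weight B (hi m) = weight B (hi (leading_exponent f)) \<longleftrightarrow> hi m = hi (leading_exponent f)"
proof -
  let ?l = "leading_exponent f"
  have less: "weight B (hi ?l) < weight B (hi m)" if "hi m \<noteq> hi ?l"
  proof (rule weight_less)
    have "m \<noteq> ?l"
      using that by auto
    then show "revlex_less (hi m) (hi ?l)"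
      using leading_exponent_max[OF m] revlex_hi that by blast
    fix k
    have "mdeg ?l = t"
      using leading_exponent_in_keys[OF f(2)] f(1) by (auto simp: forms_iff monoms_def)
    then show "lookup (hi ?l) k < B"
      using lookup_le_mdeg[of ?l k] B by (simp add: lookup_hi)
  qed
  then show "weight B (hi ?l) \<le> weight B (hi m)" "weight B (hi m) = weight B (hi ?l) \<longleftrightarrow> hi m = hi ?l"
    by (cases "hi m = hi ?l", auto)+
qed

text \<open>The coordinate change that replaces the line by the nearby line on which the transversal variable
  \<open>Var k\<close> takes the value \<open>x\<close> to the power \<open>B\<^sup>k\<close>, times the linear form \<open>Var 0 + c Var 1\<close>.\<close>

definition bend :: "nat \<Rightarrow> nat \<Rightarrow> 'k::comm_ring_1 \<Rightarrow> 'k \<Rightarrow> 'k mat" where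
  "bend n B c x = mat n n (\<lambda>(i, k). (if i = k then 1 else 0) +
     (if k < 2 then 0 else if i = 0 then x ^ (B ^ k) else if i = 1 then c * x ^ (B ^ k) else 0))"

text \<open>What the monomial with exponent \<open>m\<close> contributes to the restriction to the bent line, up to a power of the
  parameter (\<open>line_part_bend\<close>).\<close>

definition bend_term :: "'k::comm_ring_1 \<Rightarrow> exponent \<Rightarrow> (nat, 'k) mpoly" where
  "bend_term c m = single (lo m) 1 * (Var 0 + single 0 c * Var 1) ^ mdeg (hi m)"

lemma line_part_linear_form_bend:
  assumes "k < n" "2 \<le> n"
  shows "line_part (linear_form n (bend n B c x) k) =
    (if k < 2 then Var k else single 0 (x ^ (B ^ k)) * (Var 0 + single 0 c * Var 1))"
proof -
  have "line_part (linear_form n (bend n B c x) k) =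
      (\<Sum>i<n. if i < 2 then single (single i 1) (bend n B c x $$ (i, k)) else 0)"
    unfolding linear_form_def line_part.hom_sum line_part_monomial by (intro sum.cong) (auto simp: hi_single)
  also have "\<dots> = (\<Sum>i\<in>{0, 1}. single (single i 1) (bend n B c x $$ (i, k)))"
    using assms(2) by (intro sum.mono_neutral_cong_right) auto
  also have "\<dots> = (if k < 2 then Var k else single 0 (x ^ (B ^ k)) * (Var 0 + single 0 c * Var 1))"
  proof -
    have "k = 0 \<or> k = 1 \<or> \<not> k < 2"
      by linarith
    then show ?thesis
      using assms by (elim disjE) (simp_all add: bend_def distrib_left mult.assoc[symmetric] mult_single mult.commute)
  qed
  finally show ?thesis .
qed

lemma eval_monom_bend:
  "eval_monom (\<lambda>k. if k < 2 then Var k else single 0 (x ^ (B ^ k)) * (Var 0 + single 0 c * Var 1)) m =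
    single 0 (x ^ weight B (hi m)) * (bend_term c m :: (nat, 'k::comm_ring_1) mpoly)"
    (is "eval_monom ?b m = _")
proof -
  have "eval_monom ?b (lo m) = Var 0 ^ lookup m 0 * Var 1 ^ lookup m 1"
    by (simp add: lo_def eval_monom_add)
  also have "\<dots> = eval_monom Var (lo m)"
    by (simp add: lo_def eval_monom_add)
  also have "\<dots> = single (lo m) 1"
    using monomial_eq_prod[of "lo m" "1::'k"] by simp
  finally have lo: "eval_monom ?b (lo m) = single (lo m) 1" .
  let ?l = "Var 0 + single 0 c * Var 1 :: (nat, 'k) mpoly"
  have pow: "single 0 y ^ e = (single 0 (y ^ e) :: (nat, 'k) mpoly)" for y e
    by (induction e) (simp_all add: mult_single)
  have prod: "(\<Prod>i\<in>A. single 0 (g i)) = (single 0 (\<Prod>i\<in>A. g i) :: (nat, 'k) mpoly)" for g and A :: "nat set"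
    by (induction A rule: infinite_finite_induct) (simp_all add: mult_single)
  have "eval_monom ?b (hi m) = (\<Prod>i\<in>keys (hi m). single 0 (x ^ (B ^ i * lookup (hi m) i)) * ?l ^ lookup (hi m) i)"
    unfolding eval_monom_def
  proof (rule prod.cong[OF refl])
    fix i assume "i \<in> keys (hi m)"
    then have "\<not> i < 2"
      by (auto simp: in_keys_iff lookup_hi)
    then show "?b i ^ lookup (hi m) i = single 0 (x ^ (B ^ i * lookup (hi m) i)) * ?l ^ lookup (hi m) i"
      by (simp add: power_mult_distrib pow power_mult)
  qed
  also have "\<dots> = single 0 (x ^ weight B (hi m)) * ?l ^ mdeg (hi m)"
    by (simp add: prod.distrib prod weight_def mdeg_def power_sum)
  finally have "eval_monom ?b (hi m) = single 0 (x ^ weight B (hi m)) * ?l ^ mdeg (hi m)" .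
  then have "eval_monom ?b (lo m + hi m) = single 0 (x ^ weight B (hi m)) * bend_term c m"
    unfolding eval_monom_add lo by (simp add: bend_term_def ac_simps)
  then show ?thesis
    by simp
qed

lemma line_part_bend:
  fixes f :: "(nat, 'k::comm_ring_1) mpoly"
  assumes "f \<in> polys {..<n}" "2 \<le> n"
  shows "line_part (linear_change n (bend n B c x) f) =
    (\<Sum>m\<in>keys f. single 0 (lookup f m * x ^ weight B (hi m)) * bend_term c m)"
proof -
  let ?b = "\<lambda>k. if k < 2 then Var k else single 0 (x ^ (B ^ k)) * (Var 0 + single 0 c * Var 1)"
  have hom: "comm_ring_hom (\<lambda>f. line_part (linear_change n (bend n B c x) f))"
    by unfold_locales
      (simp_all add: linear_change.hom_add linear_change.hom_mult line_part.hom_add line_part.hom_mult)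
  have "line_part (linear_change n (bend n B c x) f) =
      insertion (\<lambda>c. single 0 c) (\<lambda>k. line_part (linear_form n (bend n B c x) k)) f"
    using hom_eq_insertion[OF hom, of f] by (simp add: line_part_monomial)
  also have "\<dots> = insertion (single 0) ?b f"
    by (rule insertion_cong[OF assms(1)]) (simp only: lessThan_iff line_part_linear_form_bend[OF _ assms(2)])
  also have "\<dots> = (\<Sum>m\<in>keys f. single 0 (lookup f m) * (single 0 (x ^ weight B (hi m)) * bend_term c m))"
    unfolding insertion_def eval_monom_def[symmetric] eval_monom_bend ..
  finally show ?thesis
    by (simp add: mult.assoc[symmetric] mult_single)
qed

lemma bend_0:
  assumes "B > 0"
  shows "bend n B c 0 = 1\<^sub>m n"
  by (rule eq_matI) (use assms in \<open>auto simp: bend_def zero_power\<close>)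

lemma bend_carrier [simp]: "bend n B c x \<in> carrier_mat n n"
  by (simp add: bend_def)

lemma bend_poly_funs:
  assumes "i < n" "j < n"
  shows "(\<lambda>x. bend n B c x $$ (i, j)) \<in> poly_funs"
proof -
  note R = function_ring_poly_funs
  have "(\<lambda>x. x ^ (B ^ j)) \<in> poly_funs" "(\<lambda>x. c * x ^ (B ^ j)) \<in> poly_funs"
    by (intro function_ring_closed[OF R] power_poly_funs id_poly_funs)+
  then have "(\<lambda>x. if j < 2 then 0 else if i = 0 then x ^ (B ^ j) else if i = 1 then c * x ^ (B ^ j) else 0) \<in> poly_funs"
    using function_ring_closed(1)[OF R, of 0] by (cases "j < 2"; cases "i = 0"; cases "i = 1") simp_all
  then show ?thesis
    using assms by (simp add: bend_def function_ring_closed[OF R])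
qed

text \<open>For \<open>P(c)\<close> the given sum, \<open>P(2c) - 2\<^sup>q P(c)\<close> has lower degree in \<open>c\<close>, and its coefficients are nonzero
  multiples of the \<open>u p\<close> with \<open>p < q\<close>. Characteristic 0 enters here.\<close>

lemma interpolation:
  fixes Z :: "(nat, 'k::field_char_0) mpoly set"
  assumes Z: "mpoly.subspace Z" and mem: "\<And>c. (\<Sum>p\<le>q. single 0 (c ^ p) * u p) \<in> Z"
  shows "p \<le> q \<Longrightarrow> u p \<in> Z"
  using mem
proof (induction q arbitrary: u p)
  case 0
  then show ?case
    using 0(2)[of 1] by simp
next
  case (Suc q)
  have "single 0 (2 ^ p - 2 ^ Suc q) * u p \<in> Z" if "p \<le> q" for p
  proof (rule Suc.IH[OF that])
    fix c :: 'k
    have "(\<Sum>p\<le>Suc q. single 0 ((2 * c) ^ p) * u p) - single 0 (2 ^ Suc q) * (\<Sum>p\<le>Suc q. single 0 (c ^ p) * u p) \<in> Z"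
      by (intro subspace_closed(3,4)[OF Z] Suc.prems(2))
    also have "(\<Sum>p\<le>Suc q. single 0 ((2 * c) ^ p) * u p) - single 0 (2 ^ Suc q) * (\<Sum>p\<le>Suc q. single 0 (c ^ p) * u p)
        = (\<Sum>p\<le>Suc q. single 0 (c ^ p) * (single 0 (2 ^ p - 2 ^ Suc q) * u p))"
      unfolding sum_distrib_left sum_subtractf[symmetric]
    proof (rule sum.cong[OF refl])
      fix p
      have "single 0 ((2 * c) ^ p) * u p - single 0 (2 ^ Suc q) * (single 0 (c ^ p) * u p) =
          (single 0 ((2 * c) ^ p) - single 0 (2 ^ Suc q * c ^ p)) * u p"
        by (simp only: mult.assoc[symmetric] mult_single left_diff_distrib add_0)
      also have "single 0 ((2 * c) ^ p) - single 0 (2 ^ Suc q * c ^ p) = (single 0 (c ^ p * (2 ^ p - 2 ^ Suc q)) :: (nat, 'k) mpoly)"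
        by (simp add: single_diff[symmetric] algebra_simps power_mult_distrib)
      finally show "single 0 ((2 * c) ^ p) * u p - single 0 (2 ^ Suc q) * (single 0 (c ^ p) * u p) =
          single 0 (c ^ p) * (single 0 (2 ^ p - 2 ^ Suc q) * u p)"
        by (simp only: mult.assoc[symmetric] mult_single add_0)
    qed
    also have "\<dots> = (\<Sum>p\<le>q. single 0 (c ^ p) * (single 0 (2 ^ p - 2 ^ Suc q) * u p))"
      by simp
    finally show "(\<Sum>p\<le>q. single 0 (c ^ p) * (single 0 (2 ^ p - 2 ^ Suc q) * u p)) \<in> Z" .
  qed
  note scaled = this
  have low: "u p \<in> Z" if "p \<le> q" for p
  proof -
    define a where "a = (2 :: 'k) ^ p - 2 ^ Suc q"
    have "(2 :: nat) ^ p \<noteq> 2 ^ Suc q"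
      using that by (simp del: power_Suc)
    then have "of_nat (2 ^ p) \<noteq> (of_nat (2 ^ Suc q) :: 'k)"
      unfolding of_nat_eq_iff .
    then have "a \<noteq> 0"
      by (simp add: a_def)
    show ?thesis
      by (rule subspace_unscale[OF Z scaled[OF that]]) (use \<open>a \<noteq> 0\<close> in \<open>simp add: a_def\<close>)
  qed
  have "(\<Sum>p\<le>Suc q. single 0 (1 ^ p) * u p) - (\<Sum>p\<le>q. u p) \<in> Z"
    using low by (intro subspace_closed(3)[OF Z] Suc.prems(2) subspace_closed(5)[OF Z]) auto
  then have "u (Suc q) \<in> Z"
    by simp
  then show ?case
    using low Suc.prems(1) by (auto simp: le_Suc_eq)
qed


lemma lin_indep_cong:
  "(\<And>a. a \<in> A \<Longrightarrow> v a = w a) \<Longrightarrow> lin_indep A v \<longleftrightarrow> lin_indep A w"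
  by (simp add: lin_indep_def cong: sum.cong)

text \<open>An element outside a space can be adjoined to an echelon basis; the index \<open>None\<close> stands for it.\<close>

lemma lin_indep_adjoin:
  fixes Z :: "(nat, 'k::field) mpoly set"
  assumes Z: "mpoly.subspace Z" "finitely_supported Z"
    and v: "\<And>m. m \<in> leads Z \<Longrightarrow> v m \<in> Z \<and> v m \<noteq> 0 \<and> leading_exponent (v m) = m"
    and g: "g \<notin> Z"
  shows "lin_indep (insert None (Some ` leads Z)) (case_option g v)"
  unfolding lin_indep_def
proof (intro allI impI)
  fix d
  assume d: "(\<Sum>a\<in>insert None (Some ` leads Z). single 0 (d a) * case_option g v a) = 0"
  have "(\<Sum>a\<in>insert None (Some ` leads Z). single 0 (d a) * case_option g v a) =
      single 0 (d None) * g + (\<Sum>a\<in>leads Z. single 0 (d (Some a)) * v a)"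
    using finite_leads[OF Z(2)] by (subst sum.insert) (auto simp: sum.reindex)
  then have sum0: "single 0 (d None) * g + (\<Sum>a\<in>leads Z. single 0 (d (Some a)) * v a) = 0"
    using d by simp
  have inZ: "(\<Sum>a\<in>leads Z. single 0 (d (Some a)) * v a) \<in> Z"
    using v by (intro subspace_closed(4,5)[OF Z(1)]) blast
  have dN: "d None = 0"
  proof (rule ccontr)
    assume nz: "d None \<noteq> 0"
    have "single 0 (d None) * g = 0 - (\<Sum>a\<in>leads Z. single 0 (d (Some a)) * v a)"
      using sum0 by (simp add: eq_neg_iff_add_eq_0)
    also have "\<dots> \<in> Z"
      by (rule subspace_closed(3)[OF Z(1) subspace_closed(1)[OF Z(1)] inZ])
    finally have "g \<in> Z"
      using subspace_unscale[OF Z(1) _ nz] by blast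
    then show False
      using g by blast
  qed
  then have "(\<Sum>a\<in>leads Z. single 0 (d (Some a)) * v a) = 0"
    using sum0 by simp
  moreover have "lin_indep (leads Z) v"
    by (rule lin_indep_leads[OF Z(2) v])
  ultimately have "\<forall>a\<in>leads Z. d (Some a) = 0"
    by (auto dest: lin_indepD)
  then show "\<forall>a\<in>insert None (Some ` leads Z). d a = 0"
    using dN by simp
qed

text \<open>Coordinates with \<open>h \<noteq> 0\<close> are generic for \<open>I\<close>, in all degrees at once, and \<open>L t\<close> is the set of degree \<open>t\<close>
  exponents of the generic initial ideal.\<close>

locale generic_coordinates =
  fixes n :: nat and I :: "(nat, 'k::field_char_0) mpoly set" and h :: "'k mat \<Rightarrow> 'k"
    and L :: "nat \<Rightarrow> exponent set"
  assumes n: "2 \<le> n" and I: "ideal I (R n)" and h: "h \<in> mat_funs n"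
    and L: "\<And>\<sigma> t. \<sigma> \<in> GL n \<Longrightarrow> h \<sigma> \<noteq> 0 \<Longrightarrow> leads (moved_part n I \<sigma> t) = L t"
begin

lemma finitely_supported_line:
  "finitely_supported (line_part ` moved_part n I \<sigma> t)"
  unfolding line_part_def by (rule finitely_supported_restrict_keys[OF moved_part_props(3)[OF I]])

lemma subspace_line: "mpoly.subspace (line_part ` moved_part n I \<sigma> t)"
  unfolding line_part_def by (rule subspace_restrict_keys[OF moved_part_props(1)[OF I]])

lemma dim_line:
  assumes "\<sigma> \<in> GL n" "h \<sigma> \<noteq> 0"
  shows "mpoly.dim (line_part ` moved_part n I \<sigma> t) = card {m \<in> L t. hi m = 0}"
  unfolding line_part_def dim_restrict_keys[OF moved_part_props(1,3)[OF I] up_closed_hi_0] L[OF assms] ..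

text \<open>The degeneration argument. Suppose that the alleged limit \<open>?g\<close> lies outside the restriction \<open>?Z\<close>. Then
  an echelon basis of \<open>?Z\<close> together with \<open>?g\<close> is independent. These vectors are the values at parameter 0 of
  vectors in the restriction to the bent line, so for a suitable nonzero parameter they are independent as
  well. But the restriction to the bent line has the same dimension as \<open>?Z\<close>.\<close>

lemma slice_power_in_line:
  assumes \<sigma>: "\<sigma> \<in> GL n" "h \<sigma> \<noteq> 0" and f: "f \<in> moved_part n I \<sigma> t" "f \<noteq> 0"
    and j: "j = hi (leading_exponent f)"
  shows "slice j f * (Var 0 + single 0 c * Var 1) ^ mdeg j \<in> line_part ` moved_part n I \<sigma> t"
    (is "?g \<in> ?Z")
proof (rule ccontr)
  assume g: "?g \<notin> ?Z"
  define B where "B = Suc t"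
  note subZ = subspace_line[of \<sigma> t] and finZ = finitely_supported_line[of \<sigma> t]
  obtain v where v: "\<And>m. m \<in> leads ?Z \<Longrightarrow> v m \<in> ?Z \<and> v m \<noteq> 0 \<and> leading_exponent (v m) = m"
    using lead_representatives[of ?Z] by blast
  have "\<forall>a\<in>leads ?Z. \<exists>F. F \<in> moved_part n I \<sigma> t \<and> line_part F = v a"
    using v by (metis imageE)
  then obtain F where F: "\<And>a. a \<in> leads ?Z \<Longrightarrow> F a \<in> moved_part n I \<sigma> t \<and> line_part (F a) = v a"
    by metis
  have forms: "x \<in> forms n t" if "x \<in> moved_part n I \<sigma> t" for x
    using moved_part_props(2)[OF I] that by blast
  have polys: "x \<in> polys {..<n}" if "x \<in> moved_part n I \<sigma> t" for x
    using forms[OF that] forms_subset_polys by blast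
  have weight: "weight B j \<le> weight B (hi m)" "weight B (hi m) = weight B j \<longleftrightarrow> hi m = j" if "m \<in> keys f" for m
    unfolding j using weight_leading_exponent[OF forms[OF f(1)] f(2) that] by (simp_all add: B_def)
  \<comment> \<open>\<open>V x None\<close> is the restriction of \<open>f\<close> to the bent line, divided by the power of \<open>x\<close> that belongs to \<open>j\<close>.
    After the division only the terms with transversal part \<open>j\<close> survive at 0.\<close>
  define e where "e = (\<lambda>m. weight B (hi m) - weight B j)"
  define V where "V = (\<lambda>x a. case a of Some a \<Rightarrow> line_part (linear_change n (bend n B c x) (F a))
    | None \<Rightarrow> \<Sum>m\<in>keys f. single 0 (lookup f m * x ^ e m) * bend_term c m)"
  define A where "A = insert None (Some ` leads ?Z)"
  have finA: "finite A"
    using finite_leads[OF finZ] by (simp add: A_def)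
  have V0: "V 0 (Some a) = v a" if "a \<in> leads ?Z" for a
    using F[OF that] linear_change_one[OF polys] by (simp add: V_def bend_0 B_def)
  have V1: "V 0 None = ?g"
  proof -
    have "V 0 None = (\<Sum>m\<in>{m \<in> keys f. hi m = j}. single 0 (lookup f m) * bend_term c m)"
      unfolding V_def option.case
    proof (rule sum.mono_neutral_cong_right)
      show "\<forall>m\<in>keys f - {m \<in> keys f. hi m = j}. single 0 (lookup f m * 0 ^ e m) * bend_term c m = 0"
      proof
        fix m assume "m \<in> keys f - {m \<in> keys f. hi m = j}"
        then have "e m > 0"
          using weight[of m] by (simp add: e_def)
        then show "single 0 (lookup f m * 0 ^ e m) * bend_term c m = 0"
          by (simp add: zero_power)
      qed
      show "single 0 (lookup f m * 0 ^ e m) * bend_term c m = single 0 (lookup f m) * bend_term c m"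
        if "m \<in> {m \<in> keys f. hi m = j}" for m
        using that by (simp add: e_def)
    qed auto
    also have "\<dots> = (\<Sum>m\<in>{m \<in> keys f. hi m = j}. single (lo m) (lookup f m) * (Var 0 + single 0 c * Var 1) ^ mdeg j)"
      by (rule sum.cong) (auto simp: bend_term_def mult.assoc[symmetric] mult_single)
    finally show ?thesis
      by (simp add: slice_def sum_distrib_right)
  qed
  have "lin_indep A (case_option ?g v)"
    unfolding A_def by (rule lin_indep_adjoin[OF subZ finZ v g])
  then have "lin_indep A (V 0)"
    by (rule lin_indep_cong[THEN iffD1, rotated]) (auto simp: A_def V0 V1)
  moreover have "(\<lambda>x. lookup (V x a) m') \<in> poly_funs" if "a \<in> A" for a m'
  proof -
    have *: "(\<lambda>x. lookup (\<Sum>m\<in>K. single 0 (C m * x ^ E m) * bend_term c m) m') \<in> poly_funs"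
      for K :: "exponent set" and C :: "exponent \<Rightarrow> 'k" and E :: "exponent \<Rightarrow> nat"
      unfolding lookup_sum lookup_const_mult
      by (rule function_ring_sum[OF function_ring_poly_funs])
        (intro function_ring_closed(1,3)[OF function_ring_poly_funs] power_poly_funs id_poly_funs)
    show ?thesis
    proof (cases a)
      case None
      then show ?thesis
        using * by (simp add: V_def)
    next
      case (Some b)
      then have "F b \<in> polys {..<n}"
        using that F polys by (auto simp: A_def)
      then show ?thesis
        using * by (simp add: V_def Some line_part_bend[OF _ n])
    qed
  qed
  ultimately obtain h0 where h0: "h0 \<in> poly_funs" "h0 0 \<noteq> 0" "\<And>x. h0 x \<noteq> 0 \<Longrightarrow> lin_indep A (V x)"
    using lin_indep_open[OF function_ring_poly_funs finA, of V 0] by metis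
  define path where "path = (\<lambda>x. bend n B c x * \<sigma>)"
  have c\<sigma>: "\<sigma> \<in> carrier_mat n n"
    using \<sigma>(1) by (simp add: GL_def)
  have path0: "path 0 = \<sigma>"
    using c\<sigma> by (simp add: path_def bend_0 B_def)
  have pathc: "path x \<in> carrier_mat n n" for x
    unfolding path_def by (rule mult_carrier_mat[OF bend_carrier c\<sigma>])
  have pathe: "(\<lambda>x. path x $$ (i, k)) \<in> poly_funs" if "i < n" "k < n" for i k
  proof -
    have "(\<lambda>x. \<Sum>l = 0..<n. bend n B c x $$ (i, l) * \<sigma> $$ (l, k)) \<in> poly_funs"
      using that by (intro function_ring_sum[OF function_ring_poly_funs]
          function_ring_closed(1,3)[OF function_ring_poly_funs] bend_poly_funs) auto
    moreover have "path x $$ (i, k) = (\<Sum>l = 0..<n. bend n B c x $$ (i, l) * \<sigma> $$ (l, k))" for x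
      using that c\<sigma> carrier_matD[OF bend_carrier[of n B c x]] unfolding path_def
      by (auto simp: scalar_prod_def intro!: sum.cong)
    ultimately show ?thesis
      by simp
  qed
  have "finite ({x. \<not> (path x \<in> GL n \<and> h (path x) \<noteq> 0)} \<union> {x. h0 x = 0} \<union> {0})"
  proof (intro finite_UnI)
    show "finite {x. \<not> (path x \<in> GL n \<and> h (path x) \<noteq> 0)}"
    proof (rule finite_exceptions_on_path[of path n h 0])
      show "path x \<in> carrier_mat n n" for x
        by (rule pathc)
      show "(\<lambda>x. path x $$ (i, k)) \<in> poly_funs" if "i < n" "k < n" for i k
        by (rule pathe[OF that])
    qed (use h path0 \<sigma> in simp_all)
    show "finite {x. h0 x = 0}"
      by (rule finite_zeros_poly_funs[OF h0(1,2)])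
  qed simp
  from ex_new_if_finite[OF infinite_UNIV_char_0 this]
  obtain x where "x \<notin> {x. \<not> (path x \<in> GL n \<and> h (path x) \<noteq> 0)} \<union> {x. h0 x = 0} \<union> {0}" ..
  then have x: "path x \<in> GL n" "h (path x) \<noteq> 0" "h0 x \<noteq> 0" "x \<noteq> 0"
    by simp_all
  let ?Y = "line_part ` moved_part n I (path x) t"
  have moved: "line_part (linear_change n (bend n B c x) y) \<in> ?Y" if y: "y \<in> moved_part n I \<sigma> t" for y
  proof -
    obtain y0 where y0: "y0 \<in> graded_part n I t" "y = linear_change n \<sigma> y0"
      using y by blast
    have "y0 \<in> polys {..<n}"
      using y0(1) graded_part_subset_forms forms_subset_polys by blast
    then have "linear_change n (bend n B c x) y = linear_change n (path x) y0"
      unfolding y0(2) path_def by (rule linear_change_compose[OF c\<sigma> bend_carrier])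
    then show ?thesis
      using y0(1) by blast
  qed
  have "V x a \<in> ?Y" if a: "a \<in> A" for a
  proof (cases a)
    case (Some b)
    then show ?thesis
      using a moved F by (auto simp: A_def V_def)
  next
    case None
    have "single 0 (x ^ weight B j) * V x None = line_part (linear_change n (bend n B c x) f)"
      unfolding V_def option.case line_part_bend[OF polys[OF f(1)] n] sum_distrib_left
    proof (rule sum.cong[OF refl])
      fix m assume "m \<in> keys f"
      then have "x ^ weight B j * x ^ e m = x ^ weight B (hi m)"
        using weight(1) by (simp add: e_def power_add[symmetric])
      then have "x ^ weight B j * (lookup f m * x ^ e m) = lookup f m * x ^ weight B (hi m)"
        by (metis mult.left_commute)
      then show "single 0 (x ^ weight B j) * (single 0 (lookup f m * x ^ e m) * bend_term c m) =
          single 0 (lookup f m * x ^ weight B (hi m)) * bend_term c m"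
        by (simp only: mult.assoc[symmetric] mult_single add_0)
    qed
    then have "single 0 (x ^ weight B j) * V x None \<in> ?Y"
      using moved[OF f(1)] by simp
    moreover have "x ^ weight B j \<noteq> 0"
      using x by simp
    ultimately have "V x None \<in> ?Y"
      by (rule subspace_unscale[OF subspace_line])
    then show ?thesis
      using None by simp
  qed
  then have "card A \<le> mpoly.dim ?Y"
    using h0(3) x by (intro lin_indep_card_le_dim[OF subspace_line finitely_supported_line finA]) auto
  also have "\<dots> = mpoly.dim ?Z"
    using x \<sigma> by (simp add: dim_line)
  also have "\<dots> = card (leads ?Z)"
    by (rule dim_eq_card_leads[OF subZ finZ])
  also have "\<dots> < card A"
    using finite_leads[OF finZ] by (simp add: A_def card_image)
  finally show False
    by simp
qed

text \<open>Expand the power of \<open>Var 0 + c Var 1\<close> by the binomial theorem and separate the powers of \<open>c\<close> by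
  interpolation.\<close>

lemma slice_in_colon:
  assumes \<sigma>: "\<sigma> \<in> GL n" "h \<sigma> \<noteq> 0" and f: "f \<in> moved_part n I \<sigma> t" "f \<noteq> 0"
    and j: "j = hi (leading_exponent f)"
  shows "slice j f \<in> (colon ^^ mdeg j) (line_part ` moved_part n I \<sigma> t)"
  unfolding funpow_colon_iff
proof (intro allI impI)
  fix a b assume ab: "a + b = mdeg j"
  let ?Z = "line_part ` moved_part n I \<sigma> t"
  define u where "u = (\<lambda>p. of_nat (mdeg j choose p) * (Var 1 ^ p * Var 0 ^ (mdeg j - p)) * slice j f)"
  have pow: "single 0 y ^ e = (single 0 (y ^ e) :: (nat, 'k) mpoly)" for y e
    by (induction e) (simp_all add: mult_single)
  have mem: "(\<Sum>p\<le>mdeg j. single 0 (c ^ p) * u p) \<in> ?Z" for c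
  proof -
    have "(Var 0 + single 0 c * Var 1) ^ mdeg j = (single 0 c * Var 1 + Var 0 :: (nat, 'k) mpoly) ^ mdeg j"
      by (simp add: add.commute)
    also have "\<dots> = (\<Sum>p\<le>mdeg j. of_nat (mdeg j choose p) * (single 0 c * Var 1) ^ p * Var 0 ^ (mdeg j - p))"
      by (rule binomial_ring)
    finally have "slice j f * (Var 0 + single 0 c * Var 1) ^ mdeg j = (\<Sum>p\<le>mdeg j. single 0 (c ^ p) * u p)"
      by (simp add: sum_distrib_left u_def power_mult_distrib pow ac_simps)
    then show ?thesis
      using slice_power_in_line[OF assms, of c] by simp
  qed
  have "u b \<in> ?Z"
    by (rule interpolation[OF subspace_line mem]) (use ab in simp)
  moreover have "u b = single 0 (of_nat (mdeg j choose b)) * (single (single 0 a + single 1 b) 1 * slice j f)"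
  proof -
    have var_pow: "Var i ^ e = (single (single i e) 1 :: (nat, 'k) mpoly)" for i e
      by (induction e) (simp_all add: mult_single single_add[symmetric] One_nat_def)
    have "mdeg j - b = a"
      using ab by simp
    then show ?thesis
      by (simp only: u_def var_pow mult_single single_of_nat mult_1_right add.commute[of "single 1 b"] mult.assoc)
  qed
  ultimately have "single 0 (of_nat (mdeg j choose b)) * (single (single 0 a + single 1 b) 1 * slice j f) \<in> ?Z"
    by simp
  then show "single (single 0 a + single 1 b) 1 * slice j f \<in> ?Z"
    by (rule subspace_unscale[OF subspace_line]) (use ab in simp)
qed

text \<open>The slices of elements with these initial monomials have different leading exponents.\<close>

lemma card_leads_over_exponent:
  assumes \<sigma>: "\<sigma> \<in> GL n" "h \<sigma> \<noteq> 0"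
  shows "card {m \<in> L t. hi m = j} \<le> mpoly.dim ((colon ^^ mdeg j) (line_part ` moved_part n I \<sigma> t))"
proof -
  let ?X = "(colon ^^ mdeg j) (line_part ` moved_part n I \<sigma> t)"
  have X: "mpoly.subspace ?X" "finitely_supported ?X"
    by (rule subspace_funpow_colon[OF subspace_line], rule finitely_supported_funpow_colon[OF finitely_supported_line])
  have "lo ` {m \<in> L t. hi m = j} \<subseteq> leads ?X"
  proof (rule image_subsetI)
    fix m assume "m \<in> {m \<in> L t. hi m = j}"
    then have "m \<in> leads (moved_part n I \<sigma> t)" "hi m = j"
      using L[OF \<sigma>] by auto
    then obtain f where f: "f \<in> moved_part n I \<sigma> t" "f \<noteq> 0" "m = leading_exponent f" "hi (leading_exponent f) = j"
      unfolding leads_def by auto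
    have "slice j f \<in> ?X"
      by (rule slice_in_colon[OF \<sigma> f(1,2) f(4)[symmetric]])
    then show "lo m \<in> leads ?X"
      unfolding leads_def using leading_exponent_slice[OF f(2,4)] f(3)
      by (intro image_eqI[of _ _ "slice j f"]) simp_all
  qed
  moreover have "inj_on lo {m \<in> L t. hi m = j}"
    by (rule inj_onI) (metis (mono_tags, lifting) lo_plus_hi mem_Collect_eq)
  ultimately have "card {m \<in> L t. hi m = j} \<le> card (leads ?X)"
    using finite_leads[OF X(2)] by (intro card_inj_on_le)
  then show ?thesis
    using dim_eq_card_leads[OF X] by simp
qed

end


section \<open>Ideals generated in one degree\<close>

lemma genideal_eq_span:
  fixes G :: "(nat, 'k::field) mpoly set"
  assumes G: "G \<subseteq> polys {..<n}"
  shows "genideal (R n) G = mpoly.span {single m 1 * g |m g. keys m \<subseteq> {..<n} \<and> g \<in> G}"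
    (is "_ = mpoly.span ?S")
proof
  have S_polys: "?S \<subseteq> polys {..<n}"
    using G by (auto intro!: polys_mult simp: polys_iff[of "single _ _"])
  have sub_polys: "mpoly.subspace (polys {..<n} :: (nat, 'k) mpoly set)"
    by (rule subspaceI) (auto intro: polys_add polys_mult simp: polys_iff[of 0])
  have "ideal (mpoly.span ?S) (R n)"
  proof (rule ideal_polysI)
    show "mpoly.span ?S \<subseteq> polys {..<n}"
      by (rule mpoly.span_minimal[OF S_polys sub_polys])
    show "0 \<in> mpoly.span ?S" "\<And>f g. f \<in> mpoly.span ?S \<Longrightarrow> g \<in> mpoly.span ?S \<Longrightarrow> f + g \<in> mpoly.span ?S"
      by (rule subspace_closed[OF mpoly.subspace_span], assumption?)+
    fix f r :: "(nat, 'k) mpoly" assume f: "f \<in> mpoly.span ?S" and r: "r \<in> polys {..<n}"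
    have mon: "single a 1 * f \<in> mpoly.span ?S" if a: "keys a \<subseteq> {..<n}" for a
      using f
    proof (rule mpoly.span_induct)
      show "mpoly.subspace {f. single a 1 * f \<in> mpoly.span ?S}"
        by (rule subspaceI)
          (auto simp: distrib_left mult.left_commute[of _ "single 0 _"] intro: subspace_closed[OF mpoly.subspace_span])
      fix p assume "p \<in> ?S"
      then obtain m g where p: "p = single m 1 * g" "keys m \<subseteq> {..<n}" "g \<in> G"
        by blast
      have "single a 1 * p = single (a + m) 1 * g"
        unfolding p(1) by (simp add: mult.assoc[symmetric] mult_single)
      moreover have "keys (a + m) \<subseteq> {..<n}"
        using a p(2) Poly_Mapping.keys_add[of a m] by blast
      ultimately have "single a 1 * p \<in> ?S"
        using p(3) by blast
      then show "single a 1 * p \<in> mpoly.span ?S"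
        by (rule mpoly.span_base)
    qed
    have "r * f = (\<Sum>a\<in>keys r. single 0 (lookup r a) * (single a 1 * f))"
    proof -
      have "r * f = (\<Sum>a\<in>keys r. single a (lookup r a)) * f"
        using poly_as_sum[of "keys r" r] by simp
      also have "\<dots> = (\<Sum>a\<in>keys r. single 0 (lookup r a) * (single a 1 * f))"
        unfolding sum_distrib_right
        by (intro sum.cong refl) (simp add: mult.assoc[symmetric] mult_single)
      finally show ?thesis .
    qed
    also have "\<dots> \<in> mpoly.span ?S"
      using r mon by (intro subspace_closed(4,5)[OF mpoly.subspace_span]) (simp add: polys_iff)
    finally show "r * f \<in> mpoly.span ?S" .
  qed
  moreover have "G \<subseteq> mpoly.span ?S"
  proof
    fix g assume "g \<in> G"
    then have "single 0 1 * g \<in> ?S"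
      by (intro CollectI exI[of _ 0] exI[of _ g]) simp
    then have "single 0 1 * g \<in> mpoly.span ?S"
      by (rule mpoly.span_base)
    then show "g \<in> mpoly.span ?S"
      by simp
  qed
  ultimately show "genideal (R n) G \<subseteq> mpoly.span ?S"
    by (rule genideal_least)
next
  note I = ideal_closed[OF ideal_genideal[OF G]]
  have "?S \<subseteq> genideal (R n) G"
  proof
    fix p assume "p \<in> ?S"
    then obtain m g where p: "p = single m 1 * g" "keys m \<subseteq> {..<n}" "g \<in> G"
      by blast
    have "single m 1 \<in> polys {..<n}"
      using p(2) by (simp add: polys_iff)
    then show "p \<in> genideal (R n) G"
      unfolding p(1) using p(3) genideal_superset[OF G] by (intro I(4)) auto
  qed
  moreover have "mpoly.subspace (genideal (R n) G)"
    by (rule subspaceI) (use I in auto)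
  ultimately show "mpoly.span ?S \<subseteq> genideal (R n) G"
    by (rule mpoly.span_minimal)
qed

text \<open>Elements of an ideal generated by forms of degree \<open>d\<close> have no terms of smaller degree.\<close>

lemma genideal_min_degree:
  fixes G :: "(nat, 'k::field) mpoly set"
  assumes G: "G \<subseteq> forms n d" and p: "p \<in> genideal (R n) G" and m: "m \<in> keys p"
  shows "d \<le> mdeg m"
proof -
  have Gp: "G \<subseteq> polys {..<n}"
    using G forms_subset_polys by blast
  have "\<forall>m\<in>keys p. d \<le> mdeg m"
    using p unfolding genideal_eq_span[OF Gp]
  proof (rule mpoly.span_induct)
    show "mpoly.subspace {p :: (nat, 'k) mpoly. \<forall>m\<in>keys p. d \<le> mdeg m}"
    proof (rule subspaceI)
      fix f g :: "(nat, 'k) mpoly"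
      assume "f \<in> {p. \<forall>m\<in>keys p. d \<le> mdeg m}" "g \<in> {p. \<forall>m\<in>keys p. d \<le> mdeg m}"
      then show "f + g \<in> {p. \<forall>m\<in>keys p. d \<le> mdeg m}"
        using Poly_Mapping.keys_add[of f g] by auto
    qed (auto simp: in_keys_iff)
    fix q assume "q \<in> {single m 1 * g |m g. keys m \<subseteq> {..<n} \<and> g \<in> G}"
    then obtain a g where q: "q = single a 1 * g" "g \<in> G"
      by blast
    have "g \<in> forms n d"
      using q(2) G by blast
    then have "mdeg b = d" if "b \<in> keys g" for b
      using that by (auto simp: forms_iff monoms_def)
    then show "\<forall>m\<in>keys q. d \<le> mdeg m"
      unfolding q(1) by (auto simp: keys_monomial_mult)
  qed
  then show ?thesis
    using m by blast
qed

text \<open>Regularity puts the last coefficient of a syzygy into the ideal of the preceding elements. That ideal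
  has no nonzero elements of degree less than \<open>d\<close>, so the coefficient vanishes.\<close>

lemma no_syzygies_of_low_degree:
  fixes fs :: "(nat, 'k::field) mpoly list"
  assumes reg: "regular_sequence n fs" and fs: "set fs \<subseteq> forms n d" and k: "k < d"
    and g: "\<And>i. i < length fs \<Longrightarrow> g i \<in> forms n k" and sum: "(\<Sum>i<length fs. g i * fs ! i) = 0"
  shows "\<forall>i<length fs. g i = 0"
proof -
  have "\<forall>i<l. g i = 0" if "l \<le> length fs" "(\<Sum>i<l. g i * fs ! i) = 0" for l
    using that
  proof (induction l)
    case (Suc l)
    let ?J = "genideal (R n) (set (take l fs))"
    have l: "l < length fs"
      using Suc.prems(1) by simp
    have Gf: "set (take l fs) \<subseteq> forms n d"
      using fs set_take_subset by fast
    then have Gp: "set (take l fs) \<subseteq> polys {..<n}"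
      using forms_subset_polys by blast
    note J = ideal_closed[OF ideal_genideal[OF Gp]]
    have sub: "mpoly.subspace ?J"
      by (rule subspaceI) (use J in auto)
    have gp: "g i \<in> polys {..<n}" if "i < length fs" for i
      using g[OF that] forms_subset_polys by blast
    have "(\<Sum>i<l. g i * fs ! i) \<in> ?J"
    proof (rule subspace_closed(5)[OF sub])
      fix i assume "i \<in> {..<l}"
      then have "fs ! i \<in> set (take l fs)"
        using l by (metis in_set_conv_nth length_take lessThan_iff min.absorb4 nth_take)
      then show "g i * fs ! i \<in> ?J"
        using genideal_superset[OF Gp] gp[of i] \<open>i \<in> {..<l}\<close> l by (intro J(4)) auto
    qed
    then have "0 - (\<Sum>i<l. g i * fs ! i) \<in> ?J"
      by (intro subspace_closed(1,3)[OF sub])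
    moreover have "fs ! l * g l = 0 - (\<Sum>i<l. g i * fs ! i)"
      using Suc.prems(2) by (simp add: eq_neg_iff_add_eq_0 add.commute mult.commute)
    ultimately have "fs ! l * g l \<in> ?J"
      by simp
    then have gJ: "g l \<in> ?J"
      using reg l gp[OF l] unfolding regular_sequence_def by simp
    have "keys (g l) = {}"
    proof (rule ccontr)
      assume "keys (g l) \<noteq> {}"
      then obtain m where m: "m \<in> keys (g l)"
        by blast
      then have "d \<le> mdeg m"
        by (rule genideal_min_degree[OF Gf gJ])
      moreover have "mdeg m = k"
        using m g[OF l] by (auto simp: forms_iff monoms_def)
      ultimately show False
        using k by simp
    qed
    then have "g l = 0"
      by simp
    then show ?case
      using Suc.IH Suc.prems by (auto simp: less_Suc_eq)
  qed simp
  then show ?thesis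
    using sum by blast
qed

lemma dim_ge_regular_sequence:
  fixes I :: "(nat, 'k::field) mpoly set"
  assumes I: "ideal I (R n)" and fs: "regular_sequence n fs" "set fs \<subseteq> graded_part n I d" and k: "k < d"
  shows "length fs * card (monoms n k) \<le> mpoly.dim (graded_part n I (d + k))"
proof -
  define A where "A = {..<length fs} \<times> monoms n k"
  define v where "v = (\<lambda>(i, m). single m 1 * fs ! i)"
  have finA: "finite A"
    by (simp add: A_def)
  have ff: "set fs \<subseteq> forms n d"
    using fs(2) by (auto simp: graded_part_def)
  have "lin_indep A v"
    unfolding lin_indep_def
  proof (intro allI impI)
    fix c assume c: "(\<Sum>a\<in>A. single 0 (c a) * v a) = 0"
    define g where "g = (\<lambda>i. \<Sum>m\<in>monoms n k. single m (c (i, m)))"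
    have lg: "lookup (g i) m = c (i, m)" if "m \<in> monoms n k" for i m
    proof -
      have "lookup (g i) m = (\<Sum>m'\<in>monoms n k. if m' = m then c (i, m) else 0)"
        unfolding g_def lookup_sum by (intro sum.cong) (auto simp: lookup_single when_def)
      then show ?thesis
        using that by simp
    qed
    have "(\<Sum>a\<in>A. single 0 (c a) * v a) = (\<Sum>i<length fs. \<Sum>m\<in>monoms n k. single 0 (c (i, m)) * v (i, m))"
      unfolding A_def by (subst sum.cartesian_product) simp
    also have "\<dots> = (\<Sum>i<length fs. g i * fs ! i)"
      unfolding g_def sum_distrib_right v_def prod.case
      by (intro sum.cong refl) (simp add: mult.assoc[symmetric] mult_single)
    finally have "(\<Sum>i<length fs. g i * fs ! i) = 0"
      using c by simp
    moreover have "g i \<in> forms n k" for i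
      unfolding g_def by (rule subspace_closed(5)[OF subspace_forms forms_monomial])
    ultimately have "\<forall>i<length fs. g i = 0"
      by (intro no_syzygies_of_low_degree[OF fs(1) ff k])
    then have "c (i, m) = 0" if "i < length fs" "m \<in> monoms n k" for i m
      using lg[OF that(2), of i] that(1) by simp
    then show "\<forall>a\<in>A. c a = 0"
      by (auto simp: A_def)
  qed
  moreover have "v a \<in> graded_part n I (d + k)" if "a \<in> A" for a
  proof -
    from that obtain i m where a: "a = (i, m)" "i < length fs" "m \<in> monoms n k"
      unfolding A_def by blast
    have fi: "fs ! i \<in> I" "fs ! i \<in> forms n d"
      using fs(2) nth_mem[OF a(2)] by (auto simp: graded_part_def)
    have m: "single m (1::'k) \<in> forms n k"
      by (rule forms_monomial[OF a(3)])
    have "single m 1 * fs ! i \<in> I"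
      using m forms_subset_polys by (intro ideal_closed(4)[OF I fi(1)]) blast
    moreover have "single m 1 * fs ! i \<in> forms n (d + k)"
      using forms_mult[OF m fi(2)] by (simp add: add.commute)
    ultimately show ?thesis
      by (simp add: a(1) v_def graded_part_def)
  qed
  ultimately have "card A \<le> mpoly.dim (graded_part n I (d + k))"
    by (intro lin_indep_card_le_dim[OF subspace_graded_part[OF I] finitely_supported_forms[OF graded_part_subset_forms] finA])
  then show ?thesis
    by (simp add: A_def)
qed

section \<open>Counting monomials\<close>

text \<open>The last \<open>n - 1\<close> exponents can be chosen freely up to \<open>s\<close>; the first one then makes up the degree.\<close>

lemma card_monoms_ge:
  assumes "n \<ge> 1"
  shows "Suc s ^ (n - 1) \<le> card (monoms n ((n - 1) * s))"
proof -
  let ?P = "\<Pi>\<^sub>E i\<in>{1..<n}. {..s}"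
  define \<phi> where "\<phi> = (\<lambda>f. single 0 ((n - 1) * s - (\<Sum>i\<in>{1..<n}. f i)) + (\<Sum>i\<in>{1..<n}. single i (f i)) :: exponent)"
  have look: "lookup (\<phi> f) k = f k" if "k \<in> {1..<n}" for f k
  proof -
    have "lookup (\<Sum>i\<in>{1..<n}. single i (f i)) k = (\<Sum>i\<in>{1..<n}. if i = k then f k else 0)"
      unfolding lookup_sum by (intro sum.cong) (auto simp: lookup_single when_def)
    then show ?thesis
      using that by (simp add: \<phi>_def lookup_add lookup_single)
  qed
  have "inj_on \<phi> ?P"
  proof (rule inj_onI)
    fix f g assume fg: "f \<in> ?P" "g \<in> ?P" "\<phi> f = \<phi> g"
    show "f = g"
    proof (rule PiE_ext[OF fg(1,2)])
      show "f k = g k" if "k \<in> {1..<n}" for k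
        using look[OF that, of f] look[OF that, of g] fg(3) by simp
    qed
  qed
  moreover have "\<phi> ` ?P \<subseteq> monoms n ((n - 1) * s)"
  proof (rule image_subsetI)
    fix f assume f: "f \<in> ?P"
    have "(\<Sum>i\<in>{1..<n}. f i) \<le> (\<Sum>i\<in>{1..<n}. s)"
      using f by (intro sum_mono) auto
    then have le: "(\<Sum>i\<in>{1..<n}. f i) \<le> (n - 1) * s"
      by simp
    have "mdeg (\<Sum>i\<in>B. single i (f i)) = (\<Sum>i\<in>B. f i)" for B
      by (induction B rule: infinite_finite_induct) simp_all
    then have "mdeg (\<phi> f) = (n - 1) * s"
      using le by (simp add: \<phi>_def)
    moreover have "keys (\<phi> f) \<subseteq> {..<n}"
    proof -
      have "keys (\<Sum>i\<in>{1..<n}. single i (f i)) \<subseteq> (\<Union>i\<in>{1..<n}. keys (single i (f i)))"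
        by (rule keys_sum)
      also have "\<dots> \<subseteq> {..<n}"
        by (auto split: if_splits)
      finally have "keys (\<Sum>i\<in>{1..<n}. single i (f i)) \<subseteq> {..<n}" .
      moreover have "keys (single 0 ((n - 1) * s - (\<Sum>i\<in>{1..<n}. f i))) \<subseteq> {..<n}"
        using assms by auto
      ultimately show ?thesis
        unfolding \<phi>_def using Poly_Mapping.keys_add[of "single 0 ((n - 1) * s - (\<Sum>i\<in>{1..<n}. f i))"] by blast
    qed
    ultimately show "\<phi> f \<in> monoms n ((n - 1) * s)"
      by (simp add: monoms_def)
  qed
  ultimately have "card ?P \<le> card (monoms n ((n - 1) * s))"
    by (rule card_inj_on_le[OF _ _ finite_monoms])
  then show ?thesis
    by (simp add: card_PiE)
qed

text \<open>The left-hand side counts monomials of degree \<open>k\<close> by their transversal part \<open>j\<close>, leaving out for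
  each \<open>j\<close> the one without the variable \<open>Var 1\<close>.\<close>

lemma sum_line_degrees_le:
  assumes "n \<ge> 2"
  shows "(\<Sum>j\<in>{j. keys j \<subseteq> {2..<n} \<and> mdeg j \<le> Q}. k - mdeg j) \<le> card (monoms n k)"
proof -
  let ?J = "{j. keys j \<subseteq> {2..<n} \<and> mdeg j \<le> Q}"
  let ?S = "Sigma ?J (\<lambda>j. {..<k - mdeg j})"
  define \<phi> where "\<phi> = (\<lambda>(j, a). single 0 a + single 1 (k - mdeg j - a) + j :: exponent)"
  have look: "lookup (\<phi> (j, a)) i = (if i = 0 then a else lookup j i)" if "j \<in> ?J" "i \<noteq> 1" for j a i
    using that by (auto simp: \<phi>_def lookup_add lookup_single when_def in_keys_iff)
  have j1: "lookup j 1 = 0" if "j \<in> ?J" for j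
    using that by (auto simp: in_keys_iff)
  have "inj_on \<phi> ?S"
  proof (rule inj_onI)
    fix x y assume x: "x \<in> ?S" and y: "y \<in> ?S" and eq: "\<phi> x = \<phi> y"
    obtain j a j' a' where xy: "x = (j, a)" "y = (j', a')" "j \<in> ?J" "j' \<in> ?J"
      using x y by blast
    have "a = a'"
      using look[of j 0 a] look[of j' 0 a'] eq xy by simp
    moreover have "j = j'"
    proof (rule poly_mapping_eqI)
      fix i
      have "0 \<notin> keys j" "0 \<notin> keys j'"
        using xy(3,4) by auto
      then show "lookup j i = lookup j' i"
        using look[of j i a] look[of j' i a'] eq xy j1[of j] j1[of j']
        by (cases "i = 0"; cases "i = 1") (simp_all add: in_keys_iff)
    qed
    ultimately show "x = y"
      using xy by simp
  qed
  moreover have "\<phi> ` ?S \<subseteq> monoms n k"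
  proof (rule image_subsetI)
    fix x assume "x \<in> ?S"
    then obtain j a where x: "x = (j, a)" "j \<in> ?J" "a < k - mdeg j"
      by blast
    have "keys (\<phi> x) \<subseteq> {..<n}"
    proof
      fix i assume "i \<in> keys (\<phi> x)"
      then have "i = 0 \<or> i = 1 \<or> i \<in> keys j"
        using x(1) by (auto simp: \<phi>_def in_keys_iff lookup_add lookup_single when_def split: if_splits)
      then show "i \<in> {..<n}"
        using x(2) assms by auto
    qed
    then show "\<phi> x \<in> monoms n k"
      using x by (simp add: monoms_def \<phi>_def)
  qed
  ultimately have "card ?S \<le> card (monoms n k)"
    by (rule card_inj_on_le[OF _ _ finite_monoms])
  then show ?thesis
    using exponents_bounded(1)[of "{2..<n}" Q] by (simp add: card_SigmaI)
qed


section \<open>Growth of the restriction to a generic line\<close>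

lemma subspace_pencil:
  "mpoly.subspace Z \<Longrightarrow> mpoly.subspace (pencil Z :: (nat, 'k::field) mpoly set)"
  unfolding pencil_def by (intro mpoly.subspace_sums subspace_mult_image)

lemma pencil_linear_form:
  fixes Z :: "(nat, 'k::field) mpoly set"
  assumes Z: "mpoly.subspace Z" and g: "g \<in> Z" and n: "2 \<le> n"
  shows "line_part (linear_form n \<sigma> i) * g \<in> pencil Z"
proof -
  have "line_part (linear_form n \<sigma> i) =
      (\<Sum>k<n. if k < 2 then single (single k 1) (\<sigma> $$ (k, i)) else 0)"
    unfolding linear_form_def line_part.hom_sum line_part_monomial by (intro sum.cong) (auto simp: hi_single)
  also have "\<dots> = (\<Sum>k\<in>{0, 1}. single (single k 1) (\<sigma> $$ (k, i)))"
    using n by (intro sum.mono_neutral_cong_right) auto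
  finally have "line_part (linear_form n \<sigma> i) * g =
      single (single 0 1) (\<sigma> $$ (0, i)) * g + single (single 1 1) (\<sigma> $$ (1, i)) * g"
    by (simp add: distrib_right)
  moreover have "single (single k 1) c * g = Var k * (single 0 c * g)" for k :: nat and c
    by (simp only: mult.assoc[symmetric] mult_single add_0_right mult_1_left)
  ultimately have "line_part (linear_form n \<sigma> i) * g =
      Var 0 * (single 0 (\<sigma> $$ (0, i)) * g) + Var 1 * (single 0 (\<sigma> $$ (1, i)) * g)"
    by (simp only:)
  then show ?thesis
    unfolding pencil_def using subspace_closed(4)[OF Z g] by blast
qed

context generic_coordinates
begin

abbreviation line :: "'k mat \<Rightarrow> nat \<Rightarrow> (nat, 'k) mpoly set" where
  "line \<sigma> t \<equiv> line_part ` moved_part n I \<sigma> t"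

lemma Var_mult_line:
  assumes \<sigma>: "\<sigma> \<in> GL n" and k: "k < 2" and z: "z \<in> line \<sigma> t"
  shows "Var k * z \<in> line \<sigma> (Suc t)"
proof -
  obtain f where f: "f \<in> moved_part n I \<sigma> t" "z = line_part f"
    using z by blast
  have "Var k \<in> (forms n 1 :: (nat, 'k) mpoly set)"
    using k n by (intro forms_monomial) (auto simp: monoms_def)
  then have "Var k * f \<in> moved_part n I \<sigma> (1 + t)"
    by (rule moved_part_mult[OF I \<sigma> f(1)])
  moreover have "line_part (Var k * f) = Var k * z"
    using k unfolding line_part.hom_mult f(2) line_part_monomial by (simp add: hi_single)
  ultimately show ?thesis
    by (metis image_eqI plus_1_eq_Suc)
qed

lemma line_subset_colon:
  assumes "\<sigma> \<in> GL n"
  shows "line \<sigma> t \<subseteq> colon (line \<sigma> (Suc t))"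
proof
  fix z assume "z \<in> line \<sigma> t"
  then show "z \<in> colon (line \<sigma> (Suc t))"
    unfolding colon_iff by (intro conjI Var_mult_line[OF assms]) simp_all
qed

text \<open>Here generation in degree \<open>d\<close> enters: an element of larger degree is a combination of variables times
  elements of the preceding degree, and on the line every variable becomes a linear form in \<open>x\<^sub>1, x\<^sub>2\<close>.\<close>

lemma line_Suc_eq_pencil:
  assumes \<sigma>: "\<sigma> \<in> GL n" and G: "G \<subseteq> forms n d" "genideal (R n) G = I" and t: "d \<le> t"
  shows "line \<sigma> (Suc t) = pencil (line \<sigma> t)"
proof
  have Gp: "G \<subseteq> polys {..<n}"
    using G(1) forms_subset_polys by blast
  \<comment> \<open>Elements of the span need not be homogeneous; the induction follows their component of degree \<open>t + 1\<close>.\<close>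
  define top where "top = (restrict_keys (\<lambda>m. mdeg m = Suc t) :: (nat, 'k) mpoly \<Rightarrow> _)"
  have subP: "mpoly.subspace (pencil (line \<sigma> t))"
    by (rule subspace_pencil[OF subspace_line])
  have span: "line_part (linear_change n \<sigma> (top p)) \<in> pencil (line \<sigma> t)"
    if "p \<in> mpoly.span {single m 1 * g |m g. keys m \<subseteq> {..<n} \<and> g \<in> G}" for p
    using that
  proof (rule mpoly.span_induct)
    show "mpoly.subspace {p. line_part (linear_change n \<sigma> (top p)) \<in> pencil (line \<sigma> t)}"
    proof (rule subspaceI)
      fix f c assume "f \<in> {p. line_part (linear_change n \<sigma> (top p)) \<in> pencil (line \<sigma> t)}"
      then show "single 0 c * f \<in> {p. line_part (linear_change n \<sigma> (top p)) \<in> pencil (line \<sigma> t)}"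
        using subspace_closed(4)[OF subP]
        by (simp add: top_def restrict_keys_scale linear_change.hom_mult line_part.hom_mult line_part_monomial)
    qed (use subspace_closed(1,2)[OF subP] in
      \<open>simp_all add: top_def restrict_keys_add linear_change.hom_add line_part.hom_add\<close>)
    fix p assume "p \<in> {single m 1 * g |m g. keys m \<subseteq> {..<n} \<and> g \<in> G}"
    then obtain m g where p: "p = single m 1 * g" "keys m \<subseteq> {..<n}" "g \<in> G"
      by blast
    have deg: "mdeg b = mdeg m + d" if "b \<in> keys p" for b
    proof -
      from that obtain a where a: "b = m + a" "a \<in> keys g"
        unfolding p(1) keys_monomial_mult by blast
      have "g \<in> forms n d"
        using p(3) G(1) by blast
      then show ?thesis
        using a by (auto simp: forms_iff monoms_def)
    qed
    show "line_part (linear_change n \<sigma> (top p)) \<in> pencil (line \<sigma> t)"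
    proof (cases "mdeg m + d = Suc t")
      case False
      then have "keys (top p) = {}"
        unfolding top_def keys_restrict_keys using deg by auto
      then have "top p = 0"
        by simp
      then show ?thesis
        using subspace_closed(1)[OF subP] by simp
    next
      case True
      have "lookup (top p) b = lookup p b" for b
        using deg[of b] True by (auto simp: top_def in_keys_iff)
      then have top: "top p = p"
        by (intro poly_mapping_eqI)
      have "m \<noteq> 0"
        using True t by auto
      then obtain i where i: "i \<in> keys m"
        by (metis keys_eq_empty equals0I)
      define m' where "m' = m - single i 1"
      have m: "single i 1 + m' = m"
        using i unfolding m'_def
        by (intro poly_mapping_eqI) (auto simp: lookup_add lookup_minus lookup_single when_def in_keys_iff)
      have "keys m' \<subseteq> keys m"
        unfolding m'_def by (auto simp: in_keys_iff lookup_minus)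
      then have m'n: "keys m' \<subseteq> {..<n}"
        using p(2) by blast
      have "mdeg m' + d = t"
        using True arg_cong[OF m, of mdeg] by simp
      define q where "q = single m' 1 * g"
      have "q \<in> I"
        unfolding q_def using p(3) G(2) genideal_superset[OF Gp] m'n
        by (intro ideal_closed(4)[OF I]) (auto simp: polys_iff)
      moreover have "q \<in> forms n t"
      proof -
        have "single m' 1 * g \<in> forms n (mdeg m' + d)"
          using m'n p(3) G(1) by (intro forms_mult forms_monomial) (auto simp: monoms_def)
        then show ?thesis
          using \<open>mdeg m' + d = t\<close> by (simp add: q_def)
      qed
      ultimately have "line_part (linear_change n \<sigma> q) \<in> line \<sigma> t"
        by (simp add: graded_part_def)
      moreover have "p = Var i * q"
        unfolding p(1) q_def m[symmetric] by (simp add: mult.assoc[symmetric] mult_single)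
      ultimately show ?thesis
        unfolding top using pencil_linear_form[OF subspace_line _ n]
        by (simp add: linear_change.hom_mult line_part.hom_mult)
    qed
  qed
  show "line \<sigma> (Suc t) \<subseteq> pencil (line \<sigma> t)"
  proof
    fix z assume "z \<in> line \<sigma> (Suc t)"
    then obtain f where f: "f \<in> I" "f \<in> forms n (Suc t)" "z = line_part (linear_change n \<sigma> f)"
      by (auto simp: graded_part_def)
    have "lookup (top f) b = lookup f b" for b
      using f(2) by (auto simp: top_def forms_iff monoms_def in_keys_iff)
    then have "top f = f"
      by (intro poly_mapping_eqI)
    moreover have "f \<in> mpoly.span {single m 1 * g |m g. keys m \<subseteq> {..<n} \<and> g \<in> G}"
      using f(1) G(2) genideal_eq_span[OF Gp] by simp
    ultimately show "z \<in> pencil (line \<sigma> t)"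
      using span[of f] f(3) by simp
  qed
  show "pencil (line \<sigma> t) \<subseteq> line \<sigma> (Suc t)"
  proof
    fix x assume "x \<in> pencil (line \<sigma> t)"
    then obtain y z where "y \<in> line \<sigma> t" "z \<in> line \<sigma> t" and x: "x = Var 0 * y + Var 1 * z"
      unfolding pencil_def by blast
    then have "Var 0 * y \<in> line \<sigma> (Suc t)" "Var 1 * z \<in> line \<sigma> (Suc t)"
      using Var_mult_line[OF \<sigma>, of 0 y] Var_mult_line[OF \<sigma>, of 1 z] by (simp_all only: zero_less_numeral one_less_numeral_iff semiring_norm)
    then show "x \<in> line \<sigma> (Suc t)"
      unfolding x by (rule subspace_closed(2)[OF subspace_line])
  qed
qed

lemma dim_line_growth:
  assumes \<sigma>: "\<sigma> \<in> GL n" and G: "G \<subseteq> forms n d" "genideal (R n) G = I" and t: "d \<le> t"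
  shows "mpoly.dim (line \<sigma> (Suc t)) + mpoly.dim (colon (line \<sigma> t)) = 2 * mpoly.dim (line \<sigma> t)"
  unfolding line_Suc_eq_pencil[OF assms] by (rule dim_pencil_colon[OF subspace_line finitely_supported_line])

end

text \<open>A fixed generic line, for an ideal generated in degree \<open>d\<close>.\<close>

locale generic_line = generic_coordinates n I h L
  for n and I :: "(nat, 'k::field_char_0) mpoly set" and h L +
  fixes \<sigma> :: "'k mat" and d :: nat and G :: "(nat, 'k) mpoly set"
  assumes \<sigma>: "\<sigma> \<in> GL n" "h \<sigma> \<noteq> 0" and G: "G \<subseteq> forms n d" "genideal (R n) G = I"
begin

definition line_dim :: "nat \<Rightarrow> nat" where
  "line_dim k = mpoly.dim (line \<sigma> (d + k))"

definition line_growth :: "nat \<Rightarrow> nat" where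
  "line_growth k = line_dim (Suc k) - line_dim k"

lemma line_dim_colon: "line_dim (Suc k) + mpoly.dim (colon (line \<sigma> (d + k))) = 2 * line_dim k"
  using dim_line_growth[OF \<sigma>(1) G, of "d + k"] by (simp add: line_dim_def)

lemma dim_colon_le: "mpoly.dim (colon (line \<sigma> t)) \<le> mpoly.dim (line \<sigma> t)"
  using dim_funpow_colon_le[OF subspace_line finitely_supported_line, where q = "Suc 0"] by simp

lemma line_dim_Suc: "line_dim (Suc k) = line_dim k + line_growth k"
  using line_dim_colon[of k] dim_colon_le[of "d + k"] by (simp add: line_growth_def line_dim_def)

lemma dim_colon: "mpoly.dim (colon (line \<sigma> (d + k))) + line_growth k = line_dim k"
  using line_dim_colon[of k] line_dim_Suc[of k] by simp

lemma line_le_colon: "line_dim k \<le> mpoly.dim (colon (line \<sigma> (d + Suc k)))"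
  unfolding line_dim_def using line_subset_colon[OF \<sigma>(1), of "d + k"]
  by (intro dim_mono subspace_line subspace_colon finitely_supported_colon finitely_supported_line) simp

text \<open>The growth equals the codimension of the colon space, and the colon space contains the
  restriction in the preceding degree.\<close>

lemma line_growth_antimono: "i \<le> k \<Longrightarrow> line_growth k \<le> line_growth i"
proof (rule lift_Suc_antimono_le[of line_growth])
  show "line_growth (Suc k) \<le> line_growth k" for k
    using line_le_colon[of k] dim_colon[of "Suc k"] line_dim_Suc[of k] by simp
qed

lemma line_growth_0_le: "line_growth 0 \<le> line_dim 0"
  using dim_colon[of 0] by simp

lemma line_dim_le: "line_dim k \<le> line_dim 0 * Suc k"
proof (induction k)
  case (Suc k)
  have "line_growth k \<le> line_dim 0"
    using line_growth_antimono[of 0 k] line_growth_0_le by simp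
  then show ?case
    using Suc line_dim_Suc[of k] by simp
qed simp

text \<open>Where the growth does not change, that inclusion is an equality for reasons of dimension.\<close>

lemma colon_line_eq:
  assumes "line_growth (Suc k) = line_growth k"
  shows "colon (line \<sigma> (d + Suc k)) = line \<sigma> (d + k)"
proof -
  have "mpoly.dim (colon (line \<sigma> (d + Suc k))) \<le> mpoly.dim (line \<sigma> (d + k))"
    using dim_colon[of "Suc k"] line_dim_Suc[of k] assms by (simp add: line_dim_def)
  moreover have "line \<sigma> (d + k) \<subseteq> colon (line \<sigma> (d + Suc k))"
    using line_subset_colon[OF \<sigma>(1), of "d + k"] by simp
  ultimately show ?thesis
    by (intro subspace_eq_if_dim_le[symmetric] subspace_line subspace_colon finitely_supported_colon
        finitely_supported_line)
qed

context
  fixes k0 k1 :: nat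
  assumes k01: "k0 \<le> k1" and stalled: "line_growth k0 = line_growth k1"
begin

lemma line_growth_between: "k0 \<le> k \<Longrightarrow> k \<le> k1 \<Longrightarrow> line_growth k = line_growth k0"
  using line_growth_antimono[of k0 k] line_growth_antimono[of k k1] stalled by simp

text \<open>While the growth is constant, taking colon spaces runs back through the restrictions.\<close>

lemma funpow_colon_line: "q \<le> k1 - k0 \<Longrightarrow> (colon ^^ q) (line \<sigma> (d + k1)) = line \<sigma> (d + (k1 - q))"
proof (induction q)
  case (Suc q)
  have k: "k1 - q = Suc (k1 - Suc q)"
    using Suc.prems by simp
  have "line_growth (Suc (k1 - Suc q)) = line_growth (k1 - Suc q)"
    using Suc.prems line_growth_between[of "Suc (k1 - Suc q)"] line_growth_between[of "k1 - Suc q"] by simp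
  then have "colon (line \<sigma> (d + (k1 - q))) = line \<sigma> (d + (k1 - Suc q))"
    unfolding k by (rule colon_line_eq)
  then show ?case
    using Suc by simp
qed simp

lemma line_dim_between: "k0 + i \<le> k1 \<Longrightarrow> line_dim (k0 + i) = line_dim k0 + line_growth k0 * i"
proof (induction i)
  case (Suc i)
  then show ?case
    using line_dim_Suc[of "k0 + i"] line_growth_between[of "k0 + i"] by simp
qed simp

lemma funpow_colon_line_late:
  assumes "k1 - k0 \<le> q"
  shows "(colon ^^ q) (line \<sigma> (d + k1)) = (colon ^^ (q - (k1 - k0))) (line \<sigma> (d + k0))"
proof -
  have "(colon ^^ (q - (k1 - k0) + (k1 - k0))) (line \<sigma> (d + k1)) =
      (colon ^^ (q - (k1 - k0))) ((colon ^^ (k1 - k0)) (line \<sigma> (d + k1)))"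
    by (simp only: funpow_add o_apply)
  then show ?thesis
    using assms funpow_colon_line[of "k1 - k0"] k01 by simp
qed

lemma dim_funpow_colon_bound:
  "mpoly.dim ((colon ^^ q) (line \<sigma> (d + k1))) \<le> line_growth k0 * (k1 - q) + line_dim k0"
proof (cases "q \<le> k1 - k0")
  case True
  then have "mpoly.dim ((colon ^^ q) (line \<sigma> (d + k1))) = line_dim (k0 + (k1 - q - k0))"
    using k01 by (simp add: funpow_colon_line line_dim_def)
  also have "\<dots> = line_dim k0 + line_growth k0 * (k1 - q - k0)"
    using True k01 by (intro line_dim_between) simp
  also have "\<dots> \<le> line_dim k0 + line_growth k0 * (k1 - q)"
    by (intro add_left_mono mult_le_mono2) simp
  finally show ?thesis
    by simp
next
  case False
  then have "mpoly.dim ((colon ^^ q) (line \<sigma> (d + k1))) \<le> mpoly.dim (line \<sigma> (d + k0))"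
    using dim_funpow_colon_le[OF subspace_line finitely_supported_line] by (simp add: funpow_colon_line_late)
  then show ?thesis
    by (simp add: line_dim_def)
qed

lemma dim_funpow_colon_vanishes:
  assumes "k1 + line_dim k0 < q"
  shows "mpoly.dim ((colon ^^ q) (line \<sigma> (d + k1))) = 0"
proof -
  have "(colon ^^ q) (line \<sigma> (d + k1)) \<subseteq> {0}"
    using assms funpow_colon_trivial[OF subspace_line finitely_supported_line, of \<sigma> "d + k0" "q - (k1 - k0)"]
    by (simp add: funpow_colon_line_late line_dim_def)
  then have "leads ((colon ^^ q) (line \<sigma> (d + k1))) = {}"
    unfolding leads_def by blast
  then show ?thesis
    by (simp add: dim_eq_card_leads[OF subspace_funpow_colon[OF subspace_line]
          finitely_supported_funpow_colon[OF finitely_supported_line]])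
qed

lemma hi_L:
  assumes "m \<in> L t"
  shows "keys (hi m) \<subseteq> {2..<n}"
proof -
  have "keys m \<subseteq> {..<n}"
    using assms moved_part_props(4)[OF I, of \<sigma> t] L[OF \<sigma>] by (auto simp: monoms_def)
  moreover have "i \<in> keys (hi m) \<Longrightarrow> i \<in> keys m \<and> 2 \<le> i" for i
    by (auto simp: in_keys_iff lookup_hi split: if_splits)
  ultimately show ?thesis
    by fastforce
qed

text \<open>Sort the initial monomials by their transversal part \<open>j\<close>. The bound \<open>line_growth k0 * (k1 - mdeg j) + B\<close> for each
  \<open>j\<close> gives the main term; the constant \<open>B\<close> is summed over polynomially many \<open>j\<close> of one order less in \<open>k1\<close>.\<close>

lemma card_L_upper_bound:
  assumes B: "line_dim k0 \<le> B"
  shows "card (L (d + k1)) \<le> line_growth k0 * card (monoms n k1) + B * Suc (k1 + B) ^ (n - 2)"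
proof -
  let ?t = "d + k1"
  let ?J = "{j. keys j \<subseteq> {2..<n} \<and> mdeg j \<le> k1 + B}"
  let ?x = "\<lambda>j. mpoly.dim ((colon ^^ mdeg j) (line \<sigma> ?t))"
  note J = exponents_bounded[of "{2..<n}" "k1 + B", simplified]
  have finL: "finite (L ?t)"
    using finite_leads[OF moved_part_props(3)[OF I, of \<sigma> ?t]] L[OF \<sigma>] by simp
  have x0: "?x j = 0" if "j \<in> hi ` L ?t - ?J" for j
    using that B hi_L by (intro dim_funpow_colon_vanishes) auto
  have "card (L ?t) = (\<Sum>m\<in>L ?t. 1)"
    by simp
  also have "\<dots> = (\<Sum>j\<in>hi ` L ?t. \<Sum>m\<in>{m \<in> L ?t. hi m = j}. 1)"
    by (rule sum.image_gen[OF finL])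
  also have "\<dots> \<le> (\<Sum>j\<in>hi ` L ?t. ?x j)"
    using card_leads_over_exponent[OF \<sigma>, of ?t] by (intro sum_mono) simp
  also have "\<dots> = (\<Sum>j\<in>hi ` L ?t \<inter> ?J. ?x j)"
    using finL x0 by (intro sum.mono_neutral_right) auto
  also have "\<dots> \<le> (\<Sum>j\<in>?J. ?x j)"
    using J(1) by (intro sum_mono2) auto
  also have "\<dots> \<le> (\<Sum>j\<in>?J. line_growth k0 * (k1 - mdeg j) + B)"
    using B by (intro sum_mono le_trans[OF dim_funpow_colon_bound]) simp
  also have "\<dots> = line_growth k0 * (\<Sum>j\<in>?J. k1 - mdeg j) + B * card ?J"
    by (simp add: sum.distrib sum_distrib_left)
  also have "\<dots> \<le> line_growth k0 * card (monoms n k1) + B * Suc (k1 + B) ^ (n - 2)"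
    using sum_line_degrees_le[OF n, of k1 "k1 + B"] J(2) by (intro add_mono mult_left_mono) auto
  finally show ?thesis .
qed

end

lemma card_L: "card (L t) = mpoly.dim (graded_part n I t)"
  using moved_part_props(5)[OF I, of \<sigma> t] L[OF \<sigma>]
    dim_linear_change_image[OF subspace_graded_part[OF I] graded_part_subset_forms \<sigma>(1), of t] by simp

lemma finite_L: "finite (L t)"
  using finite_leads[OF moved_part_props(3)[OF I, of \<sigma> t]] L[OF \<sigma>] by simp

lemma line_dim_0_le: "line_dim 0 \<le> mpoly.dim (graded_part n I d)"
  using card_mono[OF finite_L, of "{m \<in> L d. hi m = 0}" d] dim_line[OF \<sigma>, of d] by (simp add: line_dim_def card_L)

end


section \<open>Uncovered monomials\<close>

lemma x_monom_eq: "x_monom a b c = single (single 0 a + single 1 b + single 2 c) 1"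
  by (simp add: x_monom_def)

context generic_line
begin

text \<open>Here \<open>A\<close> collects the \<open>k\<close> whose monomial \<open>x\<^sub>1\<^sup>d\<^sup>-\<^sup>k x\<^sub>2\<^sup>k\<close> is initial, and \<open>C\<close> those whose covering monomial is
  initial. The exponent \<open>k = 0\<close> accounts for the summand 1.\<close>

lemma ubl_ge:
  assumes n3: "3 \<le> n" and gin: "\<And>m. single m 1 \<in> graded_part n (gin n I) d \<longleftrightarrow> m \<in> L d"
  shows "line_growth 0 \<le> ubl n I d + 1"
proof -
  let ?e = "\<lambda>k. single 0 (d - k) + single (1::nat) k"
  let ?e3 = "\<lambda>k. single 0 (d - k) + single 1 (k - 1) + single (2::nat) 1"
  define A where "A = {k \<in> {1..d}. ?e k \<in> L d}"
  define C where "C = {k \<in> {1..d}. ?e3 k \<in> L d}"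
  have Ld: "L d \<subseteq> monoms n d"
    using moved_part_props(4)[OF I, of \<sigma> d] L[OF \<sigma>] by simp
  have uncovered: "uncovered n I d k \<longleftrightarrow> k \<in> A - C" if "k \<in> {1..d}" for k
    using that gin unfolding uncovered_def x_monom_eq A_def C_def by simp
  have inj: "inj_on (\<lambda>k. x_monom (d - k) k 0 :: (nat, 'k) mpoly) S" for S
  proof (rule inj_onI)
    fix i k assume "x_monom (d - i) i 0 = (x_monom (d - k) k 0 :: (nat, 'k) mpoly)"
    then have "?e i = ?e k"
      unfolding x_monom_eq by (metis add_0_right lookup_single_eq lookup_single_not_eq single_zero zero_neq_one)
    then have "lookup (?e i) 1 = lookup (?e k) 1"
      by simp
    then show "i = k"
      by (simp add: lookup_add lookup_single)
  qed
  have "{m :: (nat, 'k) mpoly. \<exists>k\<in>{1..d}. m = x_monom (d - k) k 0 \<and> uncovered n I d k} =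
      (\<lambda>k. x_monom (d - k) k 0) ` (A - C)"
    using uncovered by (auto simp: A_def)
  then have ubl: "ubl n I d = card (A - C)"
    unfolding ubl_def by (simp add: card_image[OF inj])
  have finA: "finite A" and finC: "finite C"
    by (simp_all add: A_def C_def)
  have "{m \<in> L d. hi m = 0} \<subseteq> insert (single 0 d) (?e ` A)"
  proof
    fix m assume m: "m \<in> {m \<in> L d. hi m = 0}"
    then have "mdeg m = d"
      using Ld by (auto simp: monoms_def)
    have lo: "m = single 0 (lookup m 0) + single 1 (lookup m 1)"
      using m hi_eq_0_iff[of m] by (simp add: lo_def)
    have "mdeg m = lookup m 0 + lookup m 1"
      using arg_cong[OF lo, of mdeg] by simp
    then have e: "m = ?e (lookup m 1)" "lookup m 1 \<le> d"
      using lo \<open>mdeg m = d\<close> by simp_all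
    show "m \<in> insert (single 0 d) (?e ` A)"
    proof (cases "lookup m 1 = 0")
      case True
      then show ?thesis
        using e(1) by simp
    next
      case False
      then have "lookup m 1 \<in> A"
        using e m unfolding A_def by simp
      then show ?thesis
        using e(1) by blast
    qed
  qed
  then have "card {m \<in> L d. hi m = 0} \<le> card (insert (single 0 d) (?e ` A))"
    using finA by (intro card_mono) auto
  also have "\<dots> \<le> Suc (card A)"
    using card_insert_le_m1[of "Suc (card A)" "?e ` A" "single 0 d"] card_image_le[OF finA, of ?e] by simp
  finally have zA: "line_dim 0 \<le> Suc (card A)"
    using dim_line[OF \<sigma>, of d] by (simp add: line_dim_def)
  have "card C \<le> card {m \<in> L d. hi m = single 2 1}"
  proof (rule card_inj_on_le[where f = ?e3])
    show "inj_on ?e3 C"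
    proof (rule inj_onI)
      fix i k assume ik: "i \<in> C" "k \<in> C" "?e3 i = ?e3 k"
      then have "lookup (?e3 i) 1 = lookup (?e3 k) 1"
        by simp
      then have "i - 1 = k - 1"
        by (simp add: lookup_add lookup_single)
      then show "i = k"
        using ik(1,2) by (auto simp: C_def)
    qed
    have "hi (?e3 k) = single 2 1" for k
      by (simp add: hi_add hi_single)
    then show "?e3 ` C \<subseteq> {m \<in> L d. hi m = single 2 1}"
      by (auto simp: C_def)
    show "finite {m \<in> L d. hi m = single 2 1}"
      using finite_L by simp
  qed
  also have "\<dots> \<le> mpoly.dim ((colon ^^ mdeg (single (2::nat) 1)) (line \<sigma> d))"
    by (rule card_leads_over_exponent[OF \<sigma>])
  also have "\<dots> = mpoly.dim (colon (line \<sigma> d))"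
    by (simp add: One_nat_def)
  finally have "card C + line_growth 0 \<le> line_dim 0"
    using dim_colon[of 0] by simp
  moreover have "card A - card C \<le> card (A - C)"
    by (rule diff_card_le_card_Diff[OF finC])
  ultimately show ?thesis
    using zA ubl by simp
qed

text \<open>Compare the two bounds for the number of initial monomials of degree \<open>d + k1\<close>. If the regular sequence were
  longer than the growth, the number of monomials of degree \<open>k1\<close> in \<open>n\<close> variables, of order \<open>s\<^sup>n\<^sup>-\<^sup>1\<close>, would be
  at most \<open>B\<close> times a quantity of order \<open>s\<^sup>n\<^sup>-\<^sup>2\<close>, which the size of \<open>s\<close> excludes.\<close>

lemma regular_length_le:
  assumes k01: "k0 \<le> k1" and stalled: "line_growth k0 = line_growth k1" and k1: "k1 < d"
    and fs: "regular_sequence n fs" "set fs \<subseteq> graded_part n I d"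
    and B: "mpoly.dim (graded_part n I d) * Suc k0 \<le> B"
    and s: "k1 = (n - 1) * s" "B * n ^ n \<le> s"
  shows "length fs \<le> line_growth k0"
proof (rule ccontr)
  assume "\<not> length fs \<le> line_growth k0"
  then have less: "Suc (line_growth k0) \<le> length fs"
    by simp
  define c where "c = card (monoms n k1)"
  have "line_dim k0 \<le> line_dim 0 * Suc k0"
    by (rule line_dim_le)
  also have "\<dots> \<le> B"
    using le_trans[OF mult_le_mono1[OF line_dim_0_le] B] .
  finally have zB: "line_dim k0 \<le> B" .
  have "Suc (line_growth k0) * c \<le> length fs * c"
    using less by (rule mult_le_mono1)
  also have "\<dots> \<le> card (L (d + k1))"
    using dim_ge_regular_sequence[OF I fs k1] by (simp add: card_L c_def)
  also have "\<dots> \<le> line_growth k0 * c + B * Suc (k1 + B) ^ (n - 2)"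
    unfolding c_def by (rule card_L_upper_bound[OF k01 stalled zB])
  finally have "c \<le> B * Suc (k1 + B) ^ (n - 2)"
    by simp
  moreover have "Suc s ^ (n - 1) \<le> c"
    unfolding c_def s(1) using n by (intro card_monoms_ge) simp
  ultimately have "Suc s ^ (n - 1) \<le> B * Suc (k1 + B) ^ (n - 2)"
    by simp
  also have "\<dots> \<le> B * (n * Suc s) ^ (n - 2)"
  proof -
    have "B * 1 \<le> B * n ^ n"
      using n by (intro mult_le_mono2) simp
    from le_trans[OF this s(2)] have "B \<le> s"
      by simp
    moreover have "n * Suc s = (n - 1) * s + s + n"
      using n by (cases n) simp_all
    ultimately have "Suc (k1 + B) \<le> n * Suc s"
      using n unfolding s(1) by simp
    then show ?thesis
      by (intro mult_le_mono2 power_mono) auto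
  qed
  also have "\<dots> = B * n ^ (n - 2) * Suc s ^ (n - 2)"
    by (simp only: power_mult_distrib mult.assoc)
  also have "Suc s ^ (n - 1) = Suc s * Suc s ^ (n - 2)"
    using n by (simp flip: power_Suc add: Suc_diff_le numeral_2_eq_2 Suc_diff_Suc One_nat_def)
  finally have "Suc s \<le> B * n ^ (n - 2)"
    by (simp only: mult_le_cancel2) simp
  also have "\<dots> \<le> B * n ^ n"
    using n by (intro mult_le_mono2 power_increasing) auto
  also have "\<dots> \<le> s"
    by (rule s(2))
  finally show False
    by simp
qed

end

section \<open>The bound for large degrees\<close>

lemma antitone_stalls:
  fixes r :: "nat \<Rightarrow> nat"
  assumes anti: "\<And>i k. i \<le> k \<Longrightarrow> r k \<le> r i" and K: "\<And>i. K i \<le> K (Suc i)" and b: "r (K 0) \<le> b"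
  shows "\<exists>i\<le>b. r (K i) = r (K (Suc i))"
proof (rule ccontr)
  assume "\<not> ?thesis"
  then have drop: "r (K (Suc i)) < r (K i)" if "i \<le> b" for i
    using that anti[OF K[of i]] by (metis le_neq_implies_less)
  have "r (K i) + i \<le> b" if "i \<le> Suc b" for i
    using that
  proof (induction i)
    case (Suc i)
    then show ?case
      using drop[of i] by simp
  qed (use b in simp)
  from this[of "Suc b"] show False
    by simp
qed

text \<open>Between two consecutive checkpoints there is enough room for \<open>regular_length_le\<close>: the next one is \<open>(n - 1) * s\<close>
  with the \<open>s\<close> required there for \<open>k0\<close> the current one. Adding the current one to \<open>s\<close> keeps the sequence
  nondecreasing.\<close>

fun checkpoint :: "nat \<Rightarrow> nat \<Rightarrow> nat \<Rightarrow> nat" where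
  "checkpoint n \<delta> 0 = 0"
| "checkpoint n \<delta> (Suc i) = (n - 1) * (\<delta> * Suc (checkpoint n \<delta> i) * n ^ n + checkpoint n \<delta> i)"

text \<open>The growth starts at a value at most \<open>\<delta>\<close>, so it is the same at two consecutive ones among the first
  \<open>\<delta> + 2\<close> checkpoints, all of which are smaller than \<open>d\<close>.\<close>

theorem theorem1p1:
  fixes n \<delta> :: nat
  assumes "n \<ge> 3"
  shows "\<exists>D::nat. \<forall>(l::nat) (d::nat) (I :: (nat, 'k::field_char_0) mpoly set).
    d \<ge> D \<and> homogeneous_ideal n I \<and> equigenerated n d I \<and>
    mpoly.dim (graded_part n I d) = \<delta> \<and>
    (\<exists>fs. length fs = l \<and> set fs \<subseteq> graded_part n I d \<and> regular_sequence n fs) \<longrightarrow>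
    int (ubl n I d) \<ge> int l - 1"
proof -
  let ?K = "checkpoint n \<delta>"
  have K: "?K i \<le> ?K (Suc i)" for i
  proof -
    have "1 * ?K i \<le> (n - 1) * (\<delta> * Suc (?K i) * n ^ n + ?K i)"
      using assms by (intro mult_le_mono) auto
    then show ?thesis
      by simp
  qed
  have main: "int l - 1 \<le> int (ubl n I d)"
    if d: "Suc (?K (Suc \<delta>)) \<le> d" and hom: "homogeneous_ideal n I" and equi: "equigenerated n d I"
      and dim: "mpoly.dim (graded_part n I d) = \<delta>"
      and fs: "length fs = l" "set fs \<subseteq> graded_part n I d" "regular_sequence n fs"
    for l d fs and I :: "(nat, 'k) mpoly set"
  proof -
    have I: "ideal I (R n)"
      using hom by (simp add: homogeneous_ideal_def)
    obtain G where G: "G \<subseteq> forms n d" "genideal (R n) G = I"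
      using equi unfolding equigenerated_def minimal_generators_def by blast
    obtain h \<sigma> L where h: "h \<in> mat_funs n" and \<sigma>: "\<sigma> \<in> GL n" "h \<sigma> \<noteq> 0"
      and L: "\<And>\<sigma> t. \<sigma> \<in> GL n \<Longrightarrow> h \<sigma> \<noteq> 0 \<Longrightarrow> leads (moved_part n I \<sigma> t) = L t"
      using generic_leads_all_degrees[OF I] by metis
    interpret generic_line n I h L \<sigma> d G
      by (intro generic_line.intro generic_coordinates.intro generic_line_axioms.intro I h L \<sigma> G)
        (use assms in simp_all)
    have gin: "single m 1 \<in> graded_part n (gin n I) d \<longleftrightarrow> m \<in> L d" for m
      by (rule monomial_in_gin_iff[OF I h \<sigma>]) (rule L)
    obtain i where i: "i \<le> \<delta>" "line_growth (?K i) = line_growth (?K (Suc i))"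
      using antitone_stalls[of line_growth ?K \<delta>] line_growth_antimono K line_growth_0_le line_dim_0_le dim by auto
    have "?K (Suc i) \<le> ?K (Suc \<delta>)"
      by (rule lift_Suc_mono_le[of ?K, OF K]) (use i(1) in simp)
    then have "?K (Suc i) < d"
      by (rule le_less_trans) (use d in \<open>simp only: Suc_le_eq\<close>)
    then have "length fs \<le> line_growth (?K i)"
      by (rule regular_length_le[OF K i(2) _ fs(3,2), where B = "\<delta> * Suc (?K i)"
            and s = "\<delta> * Suc (?K i) * n ^ n + ?K i"]) (simp_all add: dim)
    also have "\<dots> \<le> line_growth 0"
      by (rule line_growth_antimono) simp
    also have "\<dots> \<le> ubl n I d + 1"
      by (rule ubl_ge[OF assms gin])
    finally show ?thesis
      using fs(1) by simp
  qed
  show ?thesis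
    by (rule exI[of _ "Suc (?K (Suc \<delta>))"]) (use main in blast)
qed

end
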